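(* Let $f\in L^2(\Omega)^2$, $\nu>0$, and assume $C_BC_F\nu^{-2}\|f\|_{0,\Omega}<1$ and $\lambda_h:=C_{B_h}C_{F_h}(\widetilde\alpha\nu)^{-2}\|f\|_{0,\Omega}<1$. Let $\psi\in\Phi$ and $\psi_h\in\mathcal M_h$ be the unique solutions of $$\nu A(\psi,\phi)+B(\psi;\psi,\phi)=F(\phi)\ \ \forall\phi\in\Phi,\qquad \nu A_h(\psi_h,\phi_h)+B_h(\psi_h;\psi_h,\phi_h)=F_h(\phi_h)\ \ \forall\phi_h\in\mathcal M_h .$$ There exists a positive constant $C$, independent of $h$, such that $$|\psi-\psi_h|_{2,h}\le C\Big(\inf_{\phi_h\in\mathcal M_h}|\psi-\phi_h|_{2,h}+\inf_{\chi\in\mathbb P_2(\mathcal T_h)}|\psi-\chi|_{2,h}+\|F-F_h\|+\sup_{\substack{\phi_h\in\mathcal M_h\\ \phi_h\ne0}}\Big(\frac{|\mathcal N_h(\psi;\phi_h)|}{|\phi_h|_{2,h}}+\frac{|\mathcal C_h(\psi;\phi_h)|}{|\phi_h|_{2,h}}\Big)\Big),$$ where $\mathcal N_h(\psi;\phi_h)=\nu A(\psi,\phi_h)+B(\psi;\psi,\phi_h)-F(\phi_h)$, $\mathcal C_h(\psi;\phi_h)=B(\psi;\psi,\phi_h)-B_h(\psi;\psi,\phi_h)$, and $\|F-F_h\|=\sup_{0\ne\phi_h\in\mathcal M_h}|F(\phi_h)-F_h(\phi_h)|/|\phi_h|_{2,h}$.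
   Context: Setting. $\Omega\subset\mathbb R^2$ is a simply connected bounded domain with polygonal Lipschitz boundary $\Gamma$. $(\cdot,\cdot)_{0,D}$ is the $L^2(D)$ inner product (scalar, vector or tensor); $|\cdot|_{\ell,D}$ is the $H^{\ell}(D)$ seminorm. $\mathbf{curl}\,\phi=(\partial_y\phi,-\partial_x\phi)$, $\mathbf D^2\phi$ is the Hessian. $\Phi=\{\varphi\in H^2(\Omega):\varphi=\partial_n\varphi=0\text{ on }\Gamma\}$ with norm $\|\varphi\|_{2,\Omega}=\|\mathbf D^2\varphi\|_{0,\Omega}$. $A(\psi,\phi)=(\mathbf D^2\psi,\mathbf D^2\phi)_{0,\Omega}$, $B(\zeta;\psi,\phi)=(\Delta\zeta\,\mathbf{curl}\,\psi,\nabla\phi)_{0,\Omega}$, $F(\phi)=(f,\mathbf{curl}\,\phi)_{0,\Omega}$; for elementwise functions these are sums over the mesh elements $K$ of the corresponding integrals (in particular $A^K(\varphi,\phi)=(\mathbf D^2\varphi,\mathbf D^2\phi)_{0,K}$). $C_F$ is a constant with $|F(\phi)|\le C_F\|f\|_{0,\Omega}\|\phi\|_{2,\Omega}$ on $\Phi$; $C_B=\widetilde C_{\rm sob}^2$ with $\|v\|_{L^4(\Omega)}\le\widetilde C_{\rm sob}\|v\|_{1,\Omega}$ for $v\in H^1(\Omega)^2$, so that $|B(\zeta;\varphi,\phi)|\le C_B\|\zeta\|_{2,\Omega}\|\varphi\|_{2,\Omega}\|\phi\|_{2,\Omega}$ on $\Phi$. $\mathbb P_\ell(D)$: polynomials of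 degree $\le\ell$ on $D$. Meshes. $\{\mathcal T_h\}_{h>0}$ is a family of decompositions of $\Omega$ into non-overlapping simple polygons $K$ with diameters $h_K$, $h=\max_Kh_K$. There is $\rho>0$ independent of $h$ such that every $K\in\mathcal T_h$ is star-shaped with respect to every point of a ball of radius $\ge\rho h_K$, and every edge $e$ of $K$ has length $h_e\ge\rho h_K$. $\mathcal E_h$ is the set of all edges; $n_e$ is a unit normal to $e$. The vertices are split into interior and boundary vertices. $H^\ell(\mathcal T_h)$ (resp. $\mathbb P_\ell(\mathcal T_h)$) is the space of functions that are elementwise in $H^\ell$ (resp. $\mathbb P_\ell$), and $|\phi|_{\ell,h}=\big(\sum_{K}|\phi|_{\ell,K}^2\big)^{1/2}$. The jump $[\![\cdot]\!]$ across an interior edge is the difference of traces; on a boundary edge it is the trace. Morley-type space $\mathcal M_h$. Locally put $\widetilde{\mathcal M}_h(K)=\{\phi\in H^2(K):\Delta^2\phi\in\mathbb P_2(K),\ \phi|_e\in\mathbb P_2(e),\ \Delta\phi|_e\in\mathbb P_0(e)\ \forall e\subset\partial K\}$. The projector $\Pi_K^{\mathbf D}:\widetilde{\mathcal M}_h(K)\to\mathbb P_2(K)$ is defined by $A^K(\Pi_K^{\mathbf D}\phi,\chi)=A^K(\phi,\chi)$ $\forall\chi\in\mathbb P_2(K)$ and $\sum_i(\Pi_K^{\mathbf D}\phi)(v_i)\chi(v_i)=\sum_i\phi(v_i)\chi(v_i)$ $\forall\chi\in\mathbb P_1(K)$ (sum over vertices $v_i$ of $K$). For vector fields $v$, $\boldsymbol\Pi_K^{\nabla}v\in\mathbb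 P_1(K)^2$ is defined by $(\nabla(\boldsymbol\Pi_K^\nabla v-v),\nabla\chi)_{0,K}=0$ $\forall\chi\in\mathbb P_1(K)^2$ and $\int_{\partial K}(\boldsymbol\Pi_K^\nabla v-v)=0$. Then $\mathcal M_h(K)$ is the set of $\phi\in\widetilde{\mathcal M}_h(K)$ with $(\mathbf{curl}\,\phi\cdot n_e-(\boldsymbol\Pi_K^\nabla\mathbf{curl}\,\phi)\cdot n_e,\chi)_{0,e}=0$ for every edge $e$ of $K$ and every $\chi\in\mathbb P_1(e)$ with zero mean on $e$, and $(\phi-\Pi_K^{\mathbf D}\phi,\chi)_{0,K}=0$ $\forall\chi\in\mathbb P_2(K)$. Globally, $\mathcal M_h$ is the set of $\phi_h\in H^2(\mathcal T_h)$ with $\phi_h|_K\in\mathcal M_h(K)$ for all $K$, continuous at interior vertices, zero at boundary vertices, and $([\![\partial_{n_e}\phi_h]\!],1)_{0,e}=0$ for all $e\in\mathcal E_h$. Discrete forms. $\Pi_K^m$ (vector version $\boldsymbol\Pi_K^m$) is the $L^2(K)$-orthogonal projection onto $\mathbb P_m(K)$. $S_{\mathbf D}^K$ is a symmetric positive definite bilinear form on $\mathcal M_h(K)$ with $c_*A^K(\phi,\phi)\le S_{\mathbf D}^K(\phi,\phi)\le c^*A^K(\phi,\phi)$ for all $\phi\in\ker\Pi_K^{\mathbf D}$, with $c_*,c^*>0$ independent of $K$ and $h$. Set $A_h(\varphi,\phi)=\sum_K\big[A^K(\Pi_K^{\mathbf D}\varphi,\Pi_K^{\mathbf D}\phi)+S_{\mathbf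 D}^K(\varphi-\Pi_K^{\mathbf D}\varphi,\phi-\Pi_K^{\mathbf D}\phi)\big]$, $B_h(\zeta;\varphi,\phi)=\sum_K(\Pi_K^0\Delta\zeta\;\boldsymbol\Pi_K^1\mathbf{curl}\,\varphi,\boldsymbol\Pi_K^1\nabla\phi)_{0,K}$ (also defined on $\Phi+\mathcal M_h$), $F_h(\phi)=\sum_K(\boldsymbol\Pi_K^1f,\mathbf{curl}\,\phi)_{0,K}$. $\widetilde\alpha,C_{B_h},C_{F_h}>0$ denote $h$-independent constants with $A_h(\phi,\phi)\ge\widetilde\alpha|\phi|_{2,h}^2$ and $|F_h(\phi)|\le C_{F_h}\|f\|_{0,\Omega}|\phi|_{2,h}$ for all $\phi\in\mathcal M_h$, and $|B_h(\zeta;\varphi,\phi)|\le C_{B_h}|\zeta|_{2,h}|\varphi|_{2,h}|\phi|_{2,h}$ for all $\zeta,\varphi,\phi\in\Phi+\mathcal M_h$. Under the two smallness conditions both the continuous and the discrete problem are uniquely solvable. "Independent of $h$" means uniform over the mesh family. *)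

theory Defs
  imports "HOL-Analysis.Analysis"
begin

type_synonym pt = "real^2"

section \<open>Square integrable functions, weak derivatives, Sobolev spaces\<close>

definition L2 :: "pt set \<Rightarrow> (pt \<Rightarrow> real) set" where
  "L2 D = {u. u \<in> borel_measurable (lebesgue_on D) \<and> integrable (lebesgue_on D) (\<lambda>x. (u x)\<^sup>2)}"

definition L2norm :: "pt set \<Rightarrow> (pt \<Rightarrow> real) \<Rightarrow> real" where
  "L2norm D u = sqrt (LINT x|lebesgue_on D. (u x)\<^sup>2)"

definition L2v :: "pt set \<Rightarrow> (pt \<Rightarrow> pt) set" where
  "L2v D = {v. \<forall>i. (\<lambda>x. v x $ i) \<in> L2 D}"

definition L2vnorm :: "pt set \<Rightarrow> (pt \<Rightarrow> pt) \<Rightarrow> real" where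
  "L2vnorm D v = sqrt (LINT x|lebesgue_on D. (norm (v x))\<^sup>2)"

text \<open>Classical partial derivative.\<close>
definition pd :: "2 \<Rightarrow> (pt \<Rightarrow> real) \<Rightarrow> pt \<Rightarrow> real" where
  "pd i v x = frechet_derivative v (at x) (axis i 1)"

text \<open>\<open>smooth_fun v\<close> says that all iterated partial derivatives of \<open>v\<close> are differentiable on the
  whole plane, that is, \<open>v\<close> is of class C-infinity.\<close>
coinductive smooth_fun :: "(pt \<Rightarrow> real) \<Rightarrow> bool" where
  "(\<forall>x. v differentiable (at x)) \<Longrightarrow> (\<forall>i. smooth_fun (pd i v)) \<Longrightarrow> smooth_fun v"

definition supp :: "(pt \<Rightarrow> real) \<Rightarrow> pt set" where
  "supp v = closure {x. v x \<noteq> 0}"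

definition test_fun :: "pt set \<Rightarrow> (pt \<Rightarrow> real) set" where
  "test_fun D = {v. smooth_fun v \<and> compact (supp v) \<and> supp v \<subseteq> D}"

definition weak_partial :: "pt set \<Rightarrow> 2 \<Rightarrow> (pt \<Rightarrow> real) \<Rightarrow> (pt \<Rightarrow> real) \<Rightarrow> bool" where
  "weak_partial D i u g \<longleftrightarrow>
     (\<forall>v\<in>test_fun D. (LINT x|lebesgue_on D. u x * pd i v x) = - (LINT x|lebesgue_on D. g x * v x))"

definition H1 :: "pt set \<Rightarrow> (pt \<Rightarrow> real) set" where
  "H1 D = {u \<in> L2 D. \<forall>i. \<exists>g\<in>L2 D. weak_partial D i u g}"

text \<open>The weak derivative; the choice only concerns the representative in its a.e. class.\<close>
definition wd :: "pt set \<Rightarrow> 2 \<Rightarrow> (pt \<Rightarrow> real) \<Rightarrow> pt \<Rightarrow> real" where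
  "wd D i u = (SOME g. g \<in> L2 D \<and> weak_partial D i u g)"

definition H2 :: "pt set \<Rightarrow> (pt \<Rightarrow> real) set" where
  "H2 D = {u \<in> H1 D. \<forall>i. wd D i u \<in> H1 D}"

definition hess :: "pt set \<Rightarrow> 2 \<Rightarrow> 2 \<Rightarrow> (pt \<Rightarrow> real) \<Rightarrow> pt \<Rightarrow> real" where
  "hess D i j u = wd D i (wd D j u)"

definition lap :: "pt set \<Rightarrow> (pt \<Rightarrow> real) \<Rightarrow> pt \<Rightarrow> real" where
  "lap D u x = (\<Sum>i\<in>UNIV. hess D i i u x)"

definition grad :: "pt set \<Rightarrow> (pt \<Rightarrow> real) \<Rightarrow> pt \<Rightarrow> pt" where
  "grad D u x = (\<chi> i. wd D i u x)"

definition curl :: "pt set \<Rightarrow> (pt \<Rightarrow> real) \<Rightarrow> pt \<Rightarrow> pt" where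
  "curl D u x = vector [wd D 2 u x, - wd D 1 u x]"

definition H1v :: "pt set \<Rightarrow> (pt \<Rightarrow> pt) set" where
  "H1v D = {v. \<forall>k. (\<lambda>x. v x $ k) \<in> H1 D}"

definition H1vnorm :: "pt set \<Rightarrow> (pt \<Rightarrow> pt) \<Rightarrow> real" where
  "H1vnorm D v = sqrt (\<Sum>k\<in>UNIV. (L2norm D (\<lambda>x. v x $ k))\<^sup>2
                          + (\<Sum>i\<in>UNIV. (L2norm D (wd D i (\<lambda>x. v x $ k)))\<^sup>2))"

text \<open>\<open>weak_lap D w p\<close>: the distributional Laplacian of the L2 function \<open>w\<close> is the L2 function \<open>p\<close>
  (the first derivatives of \<open>w\<close> need not be functions).\<close>
definition weak_lap :: "pt set \<Rightarrow> (pt \<Rightarrow> real) \<Rightarrow> (pt \<Rightarrow> real) \<Rightarrow> bool" where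
  "weak_lap D w p \<longleftrightarrow> w \<in> L2 D \<and> p \<in> L2 D \<and>
     (\<forall>v\<in>test_fun D. (LINT x|lebesgue_on D. w x * (\<Sum>i\<in>UNIV. pd i (pd i v) x))
                      = (LINT x|lebesgue_on D. p x * v x))"


section \<open>Segments and traces\<close>

text \<open>Integral with respect to arc length over the segment from \<open>a\<close> to \<open>b\<close>.\<close>
definition edge_int :: "pt \<Rightarrow> pt \<Rightarrow> (pt \<Rightarrow> real) \<Rightarrow> real" where
  "edge_int a b g = dist a b * (LINT t|lebesgue_on {0..1}. g (linepath a b t))"

definition edge_L2 :: "pt \<Rightarrow> pt \<Rightarrow> (pt \<Rightarrow> real) set" where
  "edge_L2 a b = {g. (\<lambda>t. g (linepath a b t)) \<in> borel_measurable (lebesgue_on {0..1}) \<and>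
                     integrable (lebesgue_on {0..1}) (\<lambda>t. (g (linepath a b t))\<^sup>2)}"

text \<open>A unit normal to the segment; exchanging \<open>a\<close> and \<open>b\<close> flips the sign.\<close>
definition edge_normal :: "pt \<Rightarrow> pt \<Rightarrow> pt" where
  "edge_normal a b = (1 / dist a b) *\<^sub>R vector [(b - a) $ 2, - ((b - a) $ 1)]"

text \<open>\<open>trace_on D a b u g\<close>: the trace on the segment \<open>[a,b]\<close> (contained in the boundary of \<open>D\<close>) of
  the H1 function \<open>u\<close> is \<open>g\<close>. The trace operator is the extension by continuity, from H1 to L2 of
  the segment, of the restriction of functions that are smooth up to the boundary.\<close>
definition trace_on :: "pt set \<Rightarrow> pt \<Rightarrow> pt \<Rightarrow> (pt \<Rightarrow> real) \<Rightarrow> (pt \<Rightarrow> real) \<Rightarrow> bool" where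
  "trace_on D a b u g \<longleftrightarrow> u \<in> H1 D \<and> g \<in> edge_L2 a b \<and>
     (\<exists>U :: nat \<Rightarrow> pt \<Rightarrow> real. (\<forall>n. smooth_fun (U n)) \<and>
        (\<lambda>n. L2norm D (\<lambda>x. U n x - u x)) \<longlonglongrightarrow> 0 \<and>
        (\<forall>i. (\<lambda>n. L2norm D (\<lambda>x. pd i (U n) x - wd D i u x)) \<longlonglongrightarrow> 0) \<and>
        (\<lambda>n. edge_int a b (\<lambda>x. (U n x - g x)\<^sup>2)) \<longlonglongrightarrow> 0)"

text \<open>The same for L2 functions \<open>w\<close> whose distributional Laplacian \<open>p\<close> is in L2: on the space of
  these functions with the graph norm the restriction to an edge extends by continuity with values
  in distributions on the relatively open edge. This gives a meaning to the restriction to an edge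
  of the Laplacian of an H2 function with square integrable bilaplacian.\<close>
definition weak_trace_on :: "pt set \<Rightarrow> pt \<Rightarrow> pt \<Rightarrow> (pt \<Rightarrow> real) \<Rightarrow> (pt \<Rightarrow> real) \<Rightarrow> (pt \<Rightarrow> real) \<Rightarrow> bool" where
  "weak_trace_on D a b w p g \<longleftrightarrow> weak_lap D w p \<and> g \<in> edge_L2 a b \<and>
     (\<exists>W :: nat \<Rightarrow> pt \<Rightarrow> real. (\<forall>n. smooth_fun (W n)) \<and>
        (\<lambda>n. L2norm D (\<lambda>x. W n x - w x)) \<longlonglongrightarrow> 0 \<and>
        (\<lambda>n. L2norm D (\<lambda>x. (\<Sum>i\<in>UNIV. pd i (pd i (W n)) x) - p x)) \<longlonglongrightarrow> 0 \<and>
        (\<forall>\<eta>. smooth_fun \<eta> \<and> a \<notin> supp \<eta> \<and> b \<notin> supp \<eta> \<longrightarrow>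
             (\<lambda>n. edge_int a b (\<lambda>x. W n x * \<eta> x)) \<longlonglongrightarrow> edge_int a b (\<lambda>x. g x * \<eta> x)))"


section \<open>Polynomials\<close>

text \<open>Polynomials on a set are represented by polynomial functions on the plane.\<close>
definition polys :: "nat \<Rightarrow> (pt \<Rightarrow> real) set" where
  "polys m = {p. \<exists>c :: nat \<Rightarrow> nat \<Rightarrow> real.
                 p = (\<lambda>x. \<Sum>i\<le>m. \<Sum>j\<le>m - i. c i j * (x $ 1) ^ i * (x $ 2) ^ j)}"

definition polysv :: "nat \<Rightarrow> (pt \<Rightarrow> pt) set" where
  "polysv m = {q. \<forall>k. (\<lambda>x. q x $ k) \<in> polys m}"

definition L2proj :: "pt set \<Rightarrow> nat \<Rightarrow> (pt \<Rightarrow> real) \<Rightarrow> pt \<Rightarrow> real" where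
  "L2proj D m u = (THE p. p \<in> polys m \<and>
      (\<forall>q\<in>polys m. (LINT x|lebesgue_on D. (p x - u x) * q x) = 0))"

definition L2projv :: "pt set \<Rightarrow> nat \<Rightarrow> (pt \<Rightarrow> pt) \<Rightarrow> pt \<Rightarrow> pt" where
  "L2projv D m v x = (\<chi> k. L2proj D m (\<lambda>y. v y $ k) x)"


section \<open>The domain and the meshes\<close>

text \<open>Near every boundary point the set is, in suitable orthonormal coordinates, the part below the
  graph of a Lipschitz function.\<close>
definition lipschitz_boundary :: "pt set \<Rightarrow> bool" where
  "lipschitz_boundary D \<longleftrightarrow>
     (\<forall>x\<in>frontier D. \<exists>e1 e2. \<exists>r>0. \<exists>L. \<exists>g :: real \<Rightarrow> real.
        norm e1 = 1 \<and> norm e2 = 1 \<and> e1 \<bullet> e2 = 0 \<and> L-lipschitz_on UNIV g \<and>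
        (\<forall>y\<in>ball x r. y \<in> D \<longleftrightarrow> (y - x) \<bullet> e2 < g ((y - x) \<bullet> e1)))"

definition polygonal_boundary :: "pt set \<Rightarrow> bool" where
  "polygonal_boundary D \<longleftrightarrow>
     (\<exists>S :: (pt \<times> pt) set. finite S \<and> frontier D = (\<Union>(a,b)\<in>S. closed_segment a b))"

definition polygonal_domain :: "pt set \<Rightarrow> bool" where
  "polygonal_domain D \<longleftrightarrow> open D \<and> connected D \<and> D \<noteq> {} \<and> bounded D \<and> simply_connected D \<and>
     polygonal_boundary D \<and> lipschitz_boundary D"

text \<open>A polygon is the cyclic list of its vertices (angles equal to \<open>pi\<close> are allowed); the
  corresponding open set is \<open>region P\<close>.\<close>
type_synonym polygon = "pt list"

definition edges :: "polygon \<Rightarrow> (pt \<times> pt) set" where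
  "edges P = set (zip P (rotate1 P))"

definition region :: "polygon \<Rightarrow> pt set" where
  "region P = inside (\<Union>(a,b)\<in>edges P. closed_segment a b)"

text \<open>Different edges meet at most in common end points.\<close>
definition edges_match :: "(pt \<times> pt) set \<Rightarrow> bool" where
  "edges_match E \<longleftrightarrow> (\<forall>(a,b)\<in>E. \<forall>(c,d)\<in>E. {a,b} \<noteq> {c,d} \<longrightarrow>
      closed_segment a b \<inter> closed_segment c d \<subseteq> {a,b} \<inter> {c,d})"

definition simple_polygon :: "polygon \<Rightarrow> bool" where
  "simple_polygon P \<longleftrightarrow> 3 \<le> length P \<and> distinct P \<and> edges_match (edges P)"

text \<open>A hanging node is a vertex of all the elements it belongs to; hence every edge that does not
  lie on the boundary of the domain is an edge of two elements.\<close>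
definition is_mesh :: "pt set \<Rightarrow> polygon set \<Rightarrow> bool" where
  "is_mesh D T \<longleftrightarrow> finite T \<and> (\<forall>P\<in>T. simple_polygon P \<and> region P \<subseteq> D) \<and>
     closure D = (\<Union>P\<in>T. closure (region P)) \<and>
     (\<forall>P\<in>T. \<forall>Q\<in>T. P \<noteq> Q \<longrightarrow> region P \<inter> region Q = {}) \<and>
     edges_match (\<Union>P\<in>T. edges P)"

definition mesh_size :: "polygon set \<Rightarrow> real" where
  "mesh_size T = Max ((\<lambda>P. diameter (region P)) ` T)"

definition shape_regular :: "real \<Rightarrow> polygon set \<Rightarrow> bool" where
  "shape_regular \<rho> T \<longleftrightarrow> (\<forall>P\<in>T.
     (\<exists>x r. 0 < r \<and> \<rho> * diameter (region P) \<le> r \<and> ball x r \<subseteq> region P \<and>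
        (\<forall>y\<in>ball x r. \<forall>z\<in>region P. closed_segment y z \<subseteq> region P)) \<and>
     (\<forall>(a,b)\<in>edges P. \<rho> * diameter (region P) \<le> dist a b))"


section \<open>Continuous forms\<close>

definition hess_form :: "pt set \<Rightarrow> (pt \<Rightarrow> real) \<Rightarrow> (pt \<Rightarrow> real) \<Rightarrow> real" where
  "hess_form D u v =
     (LINT x|lebesgue_on D. (\<Sum>i\<in>UNIV. \<Sum>j\<in>UNIV. hess D i j u x * hess D i j v x))"

definition conv_form :: "pt set \<Rightarrow> (pt \<Rightarrow> real) \<Rightarrow> (pt \<Rightarrow> real) \<Rightarrow> (pt \<Rightarrow> real) \<Rightarrow> real" where
  "conv_form D z u v = (LINT x|lebesgue_on D. lap D z x * (curl D u x \<bullet> grad D v x))"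

definition load_form :: "pt set \<Rightarrow> (pt \<Rightarrow> pt) \<Rightarrow> (pt \<Rightarrow> real) \<Rightarrow> real" where
  "load_form D f v = (LINT x|lebesgue_on D. f x \<bullet> curl D v x)"

definition H2semi :: "pt set \<Rightarrow> (pt \<Rightarrow> real) \<Rightarrow> real" where
  "H2semi D u = sqrt (hess_form D u u)"

text \<open>The space called \<open>\<Phi>\<close> of H2 functions with vanishing trace and normal derivative.\<close>
definition Phi :: "pt set \<Rightarrow> (pt \<Rightarrow> real) set" where
  "Phi D = {u \<in> H2 D. \<forall>a b. a \<noteq> b \<and> closed_segment a b \<subseteq> frontier D \<longrightarrow>
      trace_on D a b u (\<lambda>x. 0) \<and>
      trace_on D a b (\<lambda>x. grad D u x \<bullet> edge_normal a b) (\<lambda>x. 0)}"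

definition sobolev_L4_const :: "pt set \<Rightarrow> real \<Rightarrow> bool" where
  "sobolev_L4_const D c \<longleftrightarrow> 0 < c \<and>
     (\<forall>v\<in>H1v D. integrable (lebesgue_on D) (\<lambda>x. norm (v x) ^ 4) \<and>
        root 4 (LINT x|lebesgue_on D. norm (v x) ^ 4) \<le> c * H1vnorm D v)"


section \<open>The Morley-type virtual element space\<close>

text \<open>In \<open>local_pre P\<close>, an H2 function is given by its representative that is continuous on the
  closed element; this makes the vertex values and the restrictions to the edges meaningful.\<close>
definition local_pre :: "polygon \<Rightarrow> (pt \<Rightarrow> real) set" where
  "local_pre P = {u. u \<in> H2 (region P) \<and> continuous_on (closure (region P)) u \<and>
     (\<forall>(a,b)\<in>edges P. \<exists>q\<in>polys 2. \<forall>x\<in>closed_segment a b. u x = q x) \<and>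
     (\<exists>p\<in>polys 2. weak_lap (region P) (lap (region P) u) p \<and>
        (\<forall>(a,b)\<in>edges P. \<exists>c\<in>polys 0. weak_trace_on (region P) a b (lap (region P) u) p c))}"

definition PiD :: "polygon \<Rightarrow> (pt \<Rightarrow> real) \<Rightarrow> pt \<Rightarrow> real" where
  "PiD P u = (THE p. p \<in> polys 2 \<and>
      (\<forall>r\<in>polys 2. hess_form (region P) p r = hess_form (region P) u r) \<and>
      (\<forall>r\<in>polys 1. (\<Sum>v\<in>set P. p v * r v) = (\<Sum>v\<in>set P. u v * r v)))"

text \<open>\<open>is_PiNabla P v q\<close>: \<open>q\<close> is the projection of the vector field \<open>v\<close> onto linear vector fields
  with respect to the gradient inner product and the boundary mean.\<close>
definition is_PiNabla :: "polygon \<Rightarrow> (pt \<Rightarrow> pt) \<Rightarrow> (pt \<Rightarrow> pt) \<Rightarrow> bool" where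
  "is_PiNabla P v q \<longleftrightarrow> q \<in> polysv 1 \<and>
     (\<forall>r\<in>polysv 1. (LINT x|lebesgue_on (region P). (\<Sum>k\<in>UNIV. \<Sum>i\<in>UNIV.
          wd (region P) i (\<lambda>y. q y $ k - v y $ k) x * wd (region P) i (\<lambda>y. r y $ k) x)) = 0) \<and>
     (\<forall>k. \<exists>g. (\<forall>(a,b)\<in>edges P. trace_on (region P) a b (\<lambda>x. v x $ k) (g a b)) \<and>
          (\<Sum>(a,b)\<in>edges P. edge_int a b (\<lambda>x. q x $ k - g a b x)) = 0)"

definition morley_local :: "polygon \<Rightarrow> (pt \<Rightarrow> real) set" where
  "morley_local P = {u \<in> local_pre P.
     (\<exists>q. is_PiNabla P (curl (region P) u) q \<and>
        (\<forall>(a,b)\<in>edges P. \<exists>g.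
           trace_on (region P) a b (\<lambda>x. curl (region P) u x \<bullet> edge_normal a b) g \<and>
           (\<forall>r\<in>polys 1. edge_int a b r = 0 \<longrightarrow>
              edge_int a b (\<lambda>x. (g x - q x \<bullet> edge_normal a b) * r x) = 0))) \<and>
     (\<forall>r\<in>polys 2. (LINT x|lebesgue_on (region P). (u x - PiD P u x) * r x) = 0)}"

text \<open>An elementwise function is a family of functions indexed by the elements, so that it can take
  different values on the two sides of an edge.\<close>
type_synonym broken = "polygon \<Rightarrow> pt \<Rightarrow> real"

definition br_diff :: "broken \<Rightarrow> broken \<Rightarrow> broken" where
  "br_diff u v = (\<lambda>P x. u P x - v P x)"

definition br_polys :: "nat \<Rightarrow> polygon set \<Rightarrow> broken set" where
  "br_polys m T = {r. \<forall>P\<in>T. r P \<in> polys m}"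

definition normal_trace :: "polygon \<Rightarrow> pt \<Rightarrow> pt \<Rightarrow> (pt \<Rightarrow> real) \<Rightarrow> (pt \<Rightarrow> real) \<Rightarrow> bool" where
  "normal_trace P a b u g \<longleftrightarrow>
     trace_on (region P) a b (\<lambda>x. grad (region P) u x \<bullet> edge_normal a b) g"

text \<open>The two elements sharing an edge may list its end points in opposite orders; the edge is
  therefore taken with both orientations.\<close>
definition morley :: "pt set \<Rightarrow> polygon set \<Rightarrow> broken set" where
  "morley D T = {u.
     (\<forall>P\<in>T. u P \<in> morley_local P) \<and>
     (\<forall>P\<in>T. \<forall>Q\<in>T. \<forall>v \<in> set P \<inter> set Q \<inter> D. u P v = u Q v) \<and>
     (\<forall>P\<in>T. \<forall>v \<in> set P \<inter> frontier D. u P v = 0) \<and>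
     (\<forall>P\<in>T. \<forall>Q\<in>T. P \<noteq> Q \<longrightarrow>
        (\<forall>(a,b) \<in> (edges P \<union> (edges P)\<inverse>) \<inter> (edges Q \<union> (edges Q)\<inverse>).
           \<exists>g g'. normal_trace P a b (u P) g \<and> normal_trace Q a b (u Q) g' \<and>
                  edge_int a b (\<lambda>x. g x - g' x) = 0)) \<and>
     (\<forall>P\<in>T. \<forall>(a,b)\<in>edges P. closed_segment a b \<subseteq> frontier D \<longrightarrow>
        (\<exists>g. normal_trace P a b (u P) g \<and> edge_int a b g = 0))}"

definition br_zero :: "polygon set \<Rightarrow> broken \<Rightarrow> bool" where
  "br_zero T u \<longleftrightarrow> (\<forall>P\<in>T. \<forall>x\<in>closure (region P). u P x = 0)"

definition Phi_plus_morley :: "pt set \<Rightarrow> polygon set \<Rightarrow> broken set" where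
  "Phi_plus_morley D T = {w. \<exists>u\<in>Phi D. \<exists>v\<in>morley D T. w = (\<lambda>P x. u x + v P x)}"

definition br_A :: "polygon set \<Rightarrow> broken \<Rightarrow> broken \<Rightarrow> real" where
  "br_A T u v = (\<Sum>P\<in>T. hess_form (region P) (u P) (v P))"

definition br_B :: "polygon set \<Rightarrow> broken \<Rightarrow> broken \<Rightarrow> broken \<Rightarrow> real" where
  "br_B T z u v = (\<Sum>P\<in>T. conv_form (region P) (z P) (u P) (v P))"

definition br_F :: "polygon set \<Rightarrow> (pt \<Rightarrow> pt) \<Rightarrow> broken \<Rightarrow> real" where
  "br_F T f v = (\<Sum>P\<in>T. load_form (region P) f (v P))"

definition br_seminorm :: "polygon set \<Rightarrow> broken \<Rightarrow> real" where
  "br_seminorm T u = sqrt (\<Sum>P\<in>T. (H2semi (region P) (u P))\<^sup>2)"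


section \<open>Discrete forms\<close>

type_synonym stab = "polygon \<Rightarrow> (pt \<Rightarrow> real) \<Rightarrow> (pt \<Rightarrow> real) \<Rightarrow> real"

text \<open>The second condition says that the form depends only on the restrictions of its arguments to
  the element, that is, on the elements of the local space.\<close>
definition stabilization :: "real \<Rightarrow> real \<Rightarrow> polygon set \<Rightarrow> stab \<Rightarrow> bool" where
  "stabilization c1 c2 T S \<longleftrightarrow> (\<forall>P\<in>T.
     (\<forall>u\<in>morley_local P. \<forall>v\<in>morley_local P. S P u v = S P v u) \<and>
     (\<forall>u\<in>morley_local P. \<forall>v\<in>morley_local P. \<forall>w\<in>morley_local P.
        (\<forall>x\<in>closure (region P). u x = v x) \<longrightarrow> S P u w = S P v w) \<and>
     (\<forall>u\<in>morley_local P. \<forall>v\<in>morley_local P. \<forall>w\<in>morley_local P.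
        S P (\<lambda>x. u x + v x) w = S P u w + S P v w) \<and>
     (\<forall>u\<in>morley_local P. \<forall>w\<in>morley_local P. \<forall>c. S P (\<lambda>x. c * u x) w = c * S P u w) \<and>
     (\<forall>u\<in>morley_local P. (\<exists>x\<in>closure (region P). u x \<noteq> 0) \<longrightarrow> 0 < S P u u) \<and>
     (\<forall>u\<in>morley_local P. PiD P u = (\<lambda>x. 0) \<longrightarrow>
        c1 * hess_form (region P) u u \<le> S P u u \<and> S P u u \<le> c2 * hess_form (region P) u u))"

definition A_h :: "stab \<Rightarrow> polygon set \<Rightarrow> broken \<Rightarrow> broken \<Rightarrow> real" where
  "A_h S T u v = (\<Sum>P\<in>T. hess_form (region P) (PiD P (u P)) (PiD P (v P))
      + S P (\<lambda>x. u P x - PiD P (u P) x) (\<lambda>x. v P x - PiD P (v P) x))"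

definition B_h :: "polygon set \<Rightarrow> broken \<Rightarrow> broken \<Rightarrow> broken \<Rightarrow> real" where
  "B_h T z u v = (\<Sum>P\<in>T. LINT x|lebesgue_on (region P).
      L2proj (region P) 0 (lap (region P) (z P)) x *
      (L2projv (region P) 1 (curl (region P) (u P)) x \<bullet> L2projv (region P) 1 (grad (region P) (v P)) x))"

definition F_h :: "polygon set \<Rightarrow> (pt \<Rightarrow> pt) \<Rightarrow> broken \<Rightarrow> real" where
  "F_h T f v = (\<Sum>P\<in>T. LINT x|lebesgue_on (region P).
      L2projv (region P) 1 f x \<bullet> curl (region P) (v P) x)"

definition continuous_solution :: "pt set \<Rightarrow> real \<Rightarrow> (pt \<Rightarrow> pt) \<Rightarrow> (pt \<Rightarrow> real) \<Rightarrow> bool" where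
  "continuous_solution D \<nu> f \<psi> \<longleftrightarrow> \<psi> \<in> Phi D \<and>
     (\<forall>\<phi>\<in>Phi D. \<nu> * hess_form D \<psi> \<phi> + conv_form D \<psi> \<psi> \<phi> = load_form D f \<phi>)"

definition discrete_solution ::
    "pt set \<Rightarrow> real \<Rightarrow> (pt \<Rightarrow> pt) \<Rightarrow> stab \<Rightarrow> polygon set \<Rightarrow> broken \<Rightarrow> bool" where
  "discrete_solution D \<nu> f S T \<psi> \<longleftrightarrow> \<psi> \<in> morley D T \<and>
     (\<forall>\<phi>\<in>morley D T. \<nu> * A_h S T \<psi> \<phi> + B_h T \<psi> \<psi> \<phi> = F_h T f \<phi>)"


section \<open>Consistency terms\<close>

text \<open>Suprema and infima are taken in the extended nonnegative reals, so that they always exist; the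
  supremum over the empty set is 0.\<close>

definition N_term :: "real \<Rightarrow> (pt \<Rightarrow> pt) \<Rightarrow> polygon set \<Rightarrow> (pt \<Rightarrow> real) \<Rightarrow> broken \<Rightarrow> real" where
  "N_term \<nu> f T \<psi> \<phi> =
     \<nu> * br_A T (\<lambda>_. \<psi>) \<phi> + br_B T (\<lambda>_. \<psi>) (\<lambda>_. \<psi>) \<phi> - br_F T f \<phi>"

definition C_term :: "polygon set \<Rightarrow> (pt \<Rightarrow> real) \<Rightarrow> broken \<Rightarrow> real" where
  "C_term T \<psi> \<phi> = br_B T (\<lambda>_. \<psi>) (\<lambda>_. \<psi>) \<phi> - B_h T (\<lambda>_. \<psi>) (\<lambda>_. \<psi>) \<phi>"

definition load_error :: "pt set \<Rightarrow> (pt \<Rightarrow> pt) \<Rightarrow> polygon set \<Rightarrow> ennreal" where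
  "load_error D f T = (SUP \<phi>\<in>{\<phi>\<in>morley D T. \<not> br_zero T \<phi>}.
     ennreal (\<bar>br_F T f \<phi> - F_h T f \<phi>\<bar> / br_seminorm T \<phi>))"

end

theory Submission
  imports Defs
begin

text \<open>Fix \<open>\<phi>\<close> in the Morley space and put \<open>\<delta> = \<psi>\<^sub>h - \<phi>\<close>. Coercivity of \<open>A\<^sub>h\<close> and the discrete
  equation tested with \<open>\<delta>\<close> bound \<open>\<alpha> \<nu> |\<delta>|\<^sup>2\<close> by the data error, \<open>N\<^sub>h(\<psi>;\<delta>)\<close>, \<open>C\<^sub>h(\<psi>;\<delta>)\<close>,
  \<open>\<nu> (A(\<psi>,\<delta>) - A\<^sub>h(\<phi>,\<delta>))\<close> and \<open>B\<^sub>h(\<psi>;\<psi>,\<delta>) - B\<^sub>h(\<psi>\<^sub>h;\<psi>\<^sub>h,\<delta>)\<close>. The fourth is controlled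
  elementwise by the consistency of \<open>A\<^sub>h\<close> on quadratic polynomials; in the last one \<open>B\<^sub>h(\<psi>;\<delta>,\<delta>)\<close>
  vanishes and \<open>B\<^sub>h(\<delta>;\<psi>\<^sub>h,\<delta>)\<close> is absorbed on the left by the smallness of \<open>\<lambda>\<^sub>h\<close>, since testing the
  discrete equation with \<open>\<psi>\<^sub>h\<close> gives \<open>|\<psi>\<^sub>h| \<le> C\<^sub>F\<^sub>h |f| / (\<alpha> \<nu>)\<close>. That \<open>\<delta>\<close> is an admissible test function
  and that the forms are multilinear rests on the almost everywhere uniqueness of weak derivatives
  and on the unisolvence of the polynomial projections.\<close>

section \<open>Smooth functions\<close>

text \<open>The estimate itself is short; the length comes from the definitions. \<open>wd\<close>
  is a \<open>SOME\<close>, \<open>PiD\<close> and \<open>L2proj\<close> are a \<open>THE\<close>,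
  so linearity of \<open>wd\<close> is available only almost everywhere, and only once weak
  derivatives are known to be unique. That needs a supply of compactly supported smooth functions,
  built from exp(-1/t). Two devices keep the almost everywhere statements manageable: functions
  equal almost everywhere satisfy the same weak predicate, so the choice returns the same
  representative and derivatives can be iterated by rewriting; and linearity of traces and
  projections is stated for any function that agrees almost everywhere with the combination. In
  \<open>morley\<close> the traces and the projected curls are existential witnesses, so closure
  under combinations means combining witnesses. The constant is 1 + (1 + \<nu> (2 + c2) + CBh
  \<open>growth\<close>) / \<open>gap\<close>: \<open>gap\<close> is \<alpha> \<nu> reduced by the
  absorbed term, and \<open>growth\<close> adds the Hessian norm of \<psi> on the whole domain to
  the a priori bound for the discrete solution, so no mesh quantity enters. Since suprema may be
  infinite, the estimate is proved first with real bounds in their place.\<close>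

lemma smooth_fun_differentiable: "smooth_fun v \<Longrightarrow> v differentiable (at x)"
  by (erule smooth_fun.cases) auto

lemma smooth_fun_pd: "smooth_fun v \<Longrightarrow> smooth_fun (pd i v)"
  by (erule smooth_fun.cases) auto

lemma smooth_fun_continuous_on: "smooth_fun v \<Longrightarrow> continuous_on S v"
  by (meson continuous_at_imp_continuous_on differentiable_imp_continuous_within
      smooth_fun_differentiable)

lemma smooth_fun_has_derivative: "smooth_fun v \<Longrightarrow> (v has_derivative frechet_derivative v (at x)) (at x)"
  by (simp add: smooth_fun_differentiable frechet_derivative_works[symmetric])

lemma pd_eqI: "(v has_derivative D) (at x) \<Longrightarrow> pd i v x = D (axis i 1)"
  unfolding pd_def by (metis frechet_derivative_at)

text \<open>The standard smooth function that is flat at 0. The polynomial in 1/t is a parameter so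
  that the family is closed under differentiation.\<close>

definition flat :: "real poly \<Rightarrow> real \<Rightarrow> real" where
  "flat q t = (if 0 < t then poly q (1/t) * exp (-(1/t)) else 0)"

lemma poly_over_exp_tendsto: "((\<lambda>s. poly q s * exp (- s)) \<longlongrightarrow> (0::real)) at_top"
proof -
  have "((\<lambda>s. \<Sum>i\<le>degree q. coeff q i * (s ^ i / exp s)) \<longlongrightarrow> (\<Sum>i\<le>degree q. coeff q i * 0)) at_top"
    by (intro tendsto_sum tendsto_mult tendsto_const tendsto_power_div_exp_0)
  moreover have "(\<lambda>s. \<Sum>i\<le>degree q. coeff q i * (s ^ i / exp s)) = (\<lambda>s. poly q s * exp (- s))"
    by (auto simp: poly_altdef sum_distrib_right exp_minus divide_inverse mult.assoc)
  ultimately show ?thesis by simp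
qed

lemma flat_tendsto_right: "(flat q \<longlongrightarrow> 0) (at_right 0)"
proof -
  have "((\<lambda>t. poly q (1/t) * exp (-(1/t))) \<longlongrightarrow> 0) (at_right (0::real))"
    using filterlim_compose[OF poly_over_exp_tendsto[of q] filterlim_inverse_at_top_right]
    by (simp add: inverse_eq_divide)
  then show ?thesis
    by (rule Lim_transform_eventually)
       (auto simp: flat_def eventually_at_right_field intro: exI[of _ 1])
qed

text \<open>For t > 0 this is the product and chain rule: 1/t contributes the factor 1/t^2, encoded
  by \<open>[:0,0,1:]\<close>, and exp(-1/t) turns q into q minus its derivative. Only t = 0 needs a
  limit.\<close>

lemma flat_has_field_derivative:
  "(flat q has_field_derivative flat ([:0,0,1:] * (q - pderiv q)) t) (at t)"
proof -
  consider "t > 0" | "t < 0" | "t = 0" by linarith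
  then show ?thesis
  proof cases
    case 1
    have "((\<lambda>t. poly q (1/t) * exp (-(1/t))) has_field_derivative
          flat ([:0,0,1:] * (q - pderiv q)) t) (at t)"
      using 1 by (auto intro!: derivative_eq_intros DERIV_chain2[where f="poly q"]
          simp: flat_def field_simps power2_eq_square)
    then show ?thesis
      by (rule has_field_derivative_transform_within_open[of _ _ _ "{0<..}"])
         (use 1 in \<open>auto simp: flat_def\<close>)
  next
    case 2
    have "((\<lambda>t. 0) has_field_derivative flat ([:0,0,1:] * (q - pderiv q)) t) (at t)"
      using 2 by (auto simp: flat_def)
    then show ?thesis
      by (rule has_field_derivative_transform_within_open[of _ _ _ "{..<0}"])
         (use 2 in \<open>auto simp: flat_def\<close>)
  next
    case 3
    \<comment> \<open>For h > 0, dividing by h multiplies the polynomial by its variable, so the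
      difference quotient at 0 is again a member of the family and tends to 0.\<close>
    have "((\<lambda>h. flat q h / h) \<longlongrightarrow> 0) (at_right 0)"
      by (rule Lim_transform_eventually[OF flat_tendsto_right[of "[:0,1:] * q"]])
         (auto simp: flat_def eventually_at_right_field intro!: exI[of _ 1])
    moreover have "((\<lambda>h. flat q h / h) \<longlongrightarrow> 0) (at_left 0)"
      by (rule Lim_transform_eventually[OF tendsto_const])
         (auto simp: flat_def eventually_at_left_field intro!: exI[of _ "-1"])
    ultimately have "((\<lambda>h. flat q h / h) \<longlongrightarrow> 0) (at 0)"
      using filterlim_split_at by blast
    then show ?thesis
      using 3 by (simp add: DERIV_def flat_def)
  qed
qed

text \<open>Every member is differentiable with partial derivatives again in the class, so the class is
  a witness for the coinductive predicate; this gives all closure properties at once.\<close>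
inductive smooth_alg :: "(pt \<Rightarrow> real) \<Rightarrow> bool" where
  "smooth_fun v \<Longrightarrow> smooth_alg v"
| "smooth_alg (\<lambda>_. c)"
| "smooth_alg (\<lambda>x. x $ i)"
| "smooth_alg v \<Longrightarrow> smooth_alg w \<Longrightarrow> smooth_alg (\<lambda>x. v x + w x)"
| "smooth_alg v \<Longrightarrow> smooth_alg w \<Longrightarrow> smooth_alg (\<lambda>x. v x * w x)"
| "smooth_alg (\<lambda>x. flat q (a * x $ i + b))"

lemma pd_const: "pd i (\<lambda>_. c) = (\<lambda>_. 0)"
  by (rule ext, subst pd_eqI[OF has_derivative_const], simp)

lemma pd_coord: "pd i (\<lambda>x. x $ j) = (\<lambda>_. if i = j then 1 else 0)"
  by (rule ext, subst pd_eqI[OF bounded_linear_imp_has_derivative[OF bounded_linear_vec_nth]])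
     (simp add: axis_def)

lemma pd_add:
  assumes "v differentiable (at x)" "w differentiable (at x)"
  shows "pd i (\<lambda>x. v x + w x) x = pd i v x + pd i w x"
  using pd_eqI[OF has_derivative_add[OF assms[unfolded frechet_derivative_works]]]
  by (simp add: pd_def)

lemma pd_mult:
  assumes "v differentiable (at x)" "w differentiable (at x)"
  shows "pd i (\<lambda>x. v x * w x) x = v x * pd i w x + pd i v x * w x"
  using pd_eqI[OF has_derivative_mult[OF assms[unfolded frechet_derivative_works]]]
  by (simp add: pd_def)

lemma flat_coord_has_derivative:
  "((\<lambda>x. flat q (a * x $ i + b)) has_derivative
     (\<lambda>h. flat ([:0,0,1:] * (q - pderiv q)) (a * x $ i + b) * (a * h $ i))) (at (x :: pt))"
proof -
  have "((\<lambda>x :: pt. a * x $ i + b) has_derivative (\<lambda>h. a * h $ i)) (at x)"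
    by (auto intro!: derivative_eq_intros bounded_linear.has_derivative[OF bounded_linear_vec_nth])
  from has_derivative_compose[OF this flat_has_field_derivative[unfolded has_field_derivative_def]]
  show ?thesis by simp
qed

lemma smooth_alg_step:
  "smooth_alg v \<Longrightarrow> (\<forall>x. v differentiable (at x)) \<and> (\<forall>i. smooth_alg (pd i v))"
proof (induction rule: smooth_alg.induct)
  case (1 v)
  then show ?case
    by (auto intro: smooth_alg.intros smooth_fun_pd smooth_fun_differentiable)
next
  case (2 c)
  show ?case by (auto simp: pd_const intro: smooth_alg.intros)
next
  case (3 i)
  show ?case
    by (auto simp: pd_coord intro: smooth_alg.intros
        bounded_linear_imp_differentiable[OF bounded_linear_vec_nth])
next
  case (4 v w)
  moreover have "pd i (\<lambda>x. v x + w x) = (\<lambda>x. pd i v x + pd i w x)" for i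
    using 4 by (auto simp: pd_add)
  ultimately show ?case by (auto intro: smooth_alg.intros)
next
  case (5 v w)
  moreover have "pd i (\<lambda>x. v x * w x) = (\<lambda>x. v x * pd i w x + pd i v x * w x)" for i
    using 5 by (auto simp: pd_mult)
  ultimately show ?case
    using smooth_alg.intros(4,5) by (simp add: 5)
next
  case (6 q a i b)
  have "pd j (\<lambda>x. flat q (a * x $ i + b)) =
     (\<lambda>x. flat ([:0,0,1:] * (q - pderiv q)) (a * x $ i + b) * (a * axis j 1 $ i))" for j
    by (rule ext, rule pd_eqI[OF flat_coord_has_derivative])
  then have "smooth_alg (pd j (\<lambda>x. flat q (a * x $ i + b)))" for j
    using smooth_alg.intros(5)[OF smooth_alg.intros(6) smooth_alg.intros(2)] by metis
  then show ?case
    using flat_coord_has_derivative unfolding differentiable_def by blast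
qed

lemma smooth_alg_imp_smooth_fun: "smooth_alg v \<Longrightarrow> smooth_fun v"
  by (coinduction arbitrary: v) (use smooth_alg_step in blast)

lemma smooth_fun_const: "smooth_fun (\<lambda>_. c)"
  and smooth_fun_coord: "smooth_fun (\<lambda>x. x $ i)"
  and smooth_fun_flat: "smooth_fun (\<lambda>x. flat q (a * x $ i + b))"
  by (auto intro: smooth_alg_imp_smooth_fun smooth_alg.intros)

lemma smooth_fun_add: "smooth_fun v \<Longrightarrow> smooth_fun w \<Longrightarrow> smooth_fun (\<lambda>x. v x + w x)"
  and smooth_fun_mult: "smooth_fun v \<Longrightarrow> smooth_fun w \<Longrightarrow> smooth_fun (\<lambda>x. v x * w x)"
  by (auto intro: smooth_alg_imp_smooth_fun smooth_alg.intros)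

lemma smooth_fun_lin: "smooth_fun v \<Longrightarrow> smooth_fun w \<Longrightarrow> smooth_fun (\<lambda>x. c * v x + d * w x)"
  by (intro smooth_fun_add smooth_fun_mult smooth_fun_const)

lemma pd_lin:
  assumes "smooth_fun v" "smooth_fun w"
  shows "pd i (\<lambda>x. c * v x + d * w x) = (\<lambda>x. c * pd i v x + d * pd i w x)"
proof
  fix x
  note D = smooth_fun_differentiable[OF assms(1), of x] smooth_fun_differentiable[OF assms(2), of x]
  have "pd i (\<lambda>x. c * v x + d * w x) x = pd i (\<lambda>x. c * v x) x + pd i (\<lambda>x. d * w x) x"
    using D by (intro pd_add derivative_intros) auto
  then show "pd i (\<lambda>x. c * v x + d * w x) x = c * pd i v x + d * pd i w x"
    using D by (simp add: pd_mult pd_const)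
qed

section \<open>Test functions\<close>

lemma pd_outside_supp:
  assumes "x \<notin> supp v"
  shows "pd i v x = 0" "v x = 0"
proof -
  show "v x = 0"
    using assms closure_subset[of "{x. v x \<noteq> 0}"] unfolding supp_def by blast
  have "((\<lambda>_. 0) has_derivative (\<lambda>_. 0)) (at x)" by simp
  then have "(v has_derivative (\<lambda>_. 0)) (at x)"
    by (rule has_derivative_transform_within_open[of _ _ _ _ "- supp v"])
       (use assms closure_subset[of "{x. v x \<noteq> 0}"] in \<open>auto simp: supp_def\<close>)
  then show "pd i v x = 0" by (simp add: pd_eqI)
qed

lemma supp_pd_subset: "supp (pd i v) \<subseteq> supp v"
  unfolding supp_def[of "pd i v"]
proof (rule closure_minimal)
  show "{x. pd i v x \<noteq> 0} \<subseteq> supp v"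
    using pd_outside_supp(1)[of _ v i] by blast
qed (simp add: supp_def)

lemma test_funI:
  assumes "smooth_fun v" "supp v \<subseteq> K" "compact K" "K \<subseteq> D"
  shows "v \<in> test_fun D"
proof -
  have "compact (K \<inter> supp v)"
    using assms(3) by (intro compact_Int_closed) (auto simp: supp_def)
  then show ?thesis
    using assms by (auto simp: test_fun_def Int_absorb1)
qed

lemma test_fun_mono: "D \<subseteq> E \<Longrightarrow> test_fun D \<subseteq> test_fun E"
  unfolding test_fun_def by auto

lemma test_fun_smooth: "v \<in> test_fun D \<Longrightarrow> smooth_fun v"
  unfolding test_fun_def by auto

lemma test_fun_pd: "v \<in> test_fun D \<Longrightarrow> pd i v \<in> test_fun D"
  using supp_pd_subset[of i v] smooth_fun_pd[of v i]
  by (intro test_funI[of _ "supp v"]) (auto simp: test_fun_def)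

lemma test_fun_mult:
  assumes "v \<in> test_fun D" "smooth_fun p" shows "(\<lambda>x. p x * v x) \<in> test_fun D"
proof -
  have "supp (\<lambda>x. p x * v x) \<subseteq> supp v"
    unfolding supp_def by (rule closure_mono) auto
  then show ?thesis
    using assms by (intro test_funI[of _ "supp v"] smooth_fun_mult) (auto simp: test_fun_def)
qed

lemma test_fun_outside: "v \<in> test_fun D \<Longrightarrow> x \<notin> D \<Longrightarrow> v x = 0"
  using pd_outside_supp(2) unfolding test_fun_def by blast

text \<open>Smooth functions supported in the closed box whose limit for large n is the indicator of
  the open box, since exp(-1/(n s)) tends to 1 for s > 0. The arguments have the affine shape
  required by \<open>smooth_fun_flat\<close>.\<close>

definition box_bump :: "pt \<Rightarrow> pt \<Rightarrow> nat \<Rightarrow> pt \<Rightarrow> real" where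
  "box_bump a b n x = (\<Prod>i\<in>UNIV. flat 1 (real n * x $ i + - (real n * a $ i)) *
                                  flat 1 (- real n * x $ i + real n * b $ i))"

lemma box_bump_test_fun:
  assumes "cbox a b \<subseteq> D"
  shows "box_bump a b n \<in> test_fun D"
proof -
  have "smooth_fun (box_bump a b n)"
  proof -
    have "smooth_fun (\<lambda>x. (\<Prod>i\<in>{1,2}. flat 1 (real n * x $ i + - (real n * a $ i)) *
        flat 1 (- real n * x $ i + real n * b $ i)))"
      using smooth_fun_mult[OF smooth_fun_mult[OF smooth_fun_flat smooth_fun_flat]
          smooth_fun_mult[OF smooth_fun_flat smooth_fun_flat],
          of 1 "real n" 1 "- (real n * a $ 1)" 1 "- real n" 1 "real n * b $ 1"
             1 "real n" 2 "- (real n * a $ 2)" 1 "- real n" 2 "real n * b $ 2"]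
      by simp
    then show ?thesis
      unfolding box_bump_def[abs_def] UNIV_2 .
  qed
  moreover have "supp (box_bump a b n) \<subseteq> cbox a b"
    unfolding supp_def
  proof (rule closure_minimal)
    show "{x. box_bump a b n x \<noteq> 0} \<subseteq> cbox a b"
    proof clarify
      fix x assume "box_bump a b n x \<noteq> 0"
      then have "0 < real n * (x $ i - a $ i) \<and> 0 < real n * (b $ i - x $ i)" for i
        unfolding box_bump_def by (auto simp: flat_def algebra_simps split: if_splits)
      then show "x \<in> cbox a b"
        by (simp add: mem_box_cart zero_less_mult_iff less_imp_le)
    qed
  qed auto
  ultimately show ?thesis
    using assms by (intro test_funI[of _ "cbox a b"]) auto
qed

lemma flat_1_bounds: "0 \<le> flat 1 t" "flat 1 t \<le> 1"
  by (auto simp: flat_def)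

lemma box_bump_bounds: "0 \<le> box_bump a b n x" "box_bump a b n x \<le> 1"
  unfolding box_bump_def
  by (auto intro!: prod_nonneg prod_le_1 mult_nonneg_nonneg mult_le_one flat_1_bounds)

lemma flat_1_scaled_tendsto:
  "(\<lambda>n. flat 1 (real n * t)) \<longlonglongrightarrow> (if 0 < t then 1 else 0)"
proof (cases "0 < t")
  case True
  have "(\<lambda>n. exp (-(1/t) * (1 / real n))) \<longlonglongrightarrow> exp (-(1/t) * 0)"
    by (intro tendsto_intros lim_1_over_n)
  moreover have "eventually (\<lambda>n. exp (-(1/t) * (1 / real n)) = flat 1 (real n * t)) sequentially"
    using eventually_gt_at_top[of 0] by eventually_elim (use True in \<open>simp add: flat_def field_simps\<close>)
  ultimately show ?thesis
    using True by (simp add: Lim_transform_eventually)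
next
  case False
  then have "flat 1 (real n * t) = 0" for n
    by (auto simp: flat_def zero_less_mult_iff)
  then show ?thesis using False by simp
qed

lemma box_bump_tendsto: "(\<lambda>n. box_bump a b n x) \<longlonglongrightarrow> indicator (box a b) x"
proof -
  have "(\<lambda>n. \<Prod>i\<in>UNIV. flat 1 (real n * (x $ i - a $ i)) * flat 1 (real n * (b $ i - x $ i)))
     \<longlonglongrightarrow> (\<Prod>i\<in>UNIV. (if 0 < x $ i - a $ i then 1 else 0) * (if 0 < b $ i - x $ i then 1 else 0))"
    by (intro tendsto_prod tendsto_mult flat_1_scaled_tendsto)
  moreover have "(\<Prod>i\<in>UNIV. (if 0 < x $ i - a $ i then 1 else 0) * (if 0 < b $ i - x $ i then 1 else 0))
     = (indicator (box a b) x :: real)"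
    by (auto simp: UNIV_2 indicator_def mem_box_cart forall_2)
  moreover have "(\<lambda>n. \<Prod>i\<in>UNIV. flat 1 (real n * (x $ i - a $ i)) * flat 1 (real n * (b $ i - x $ i)))
     = (\<lambda>n. box_bump a b n x)"
    by (simp add: box_bump_def algebra_simps)
  ultimately show ?thesis by simp
qed

section \<open>The fundamental lemma of the calculus of variations\<close>

lemma measurable_indicator_box_mult:
  "g \<in> borel_measurable lebesgue \<Longrightarrow>
     (\<lambda>x. indicator (box a b) x * g x :: real) \<in> borel_measurable lebesgue"
  by (intro borel_measurable_times borel_measurable_indicator) (auto intro: fmeasurableD)

text \<open>The bumps of a closed box inside \<open>D\<close> are test functions on \<open>D\<close>
  and are bounded by 1, so dominated convergence passes from them to the indicator of the open
  box.\<close>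

lemma integral_lebesgue_box_zero:
  fixes g :: "pt \<Rightarrow> real"
  assumes g: "integrable lebesgue g" and D: "cbox a b \<subseteq> D"
    and zero: "\<And>v. v \<in> test_fun D \<Longrightarrow> (LINT x|lebesgue. g x * v x) = 0"
  shows "(LINT x|lebesgue. indicator (box a b) x * g x) = 0"
proof -
  have [measurable]: "g \<in> borel_measurable lebesgue" using g by auto
  have [measurable]: "box_bump a b n \<in> borel_measurable lebesgue" for n
    using smooth_fun_continuous_on[OF test_fun_smooth[OF box_bump_test_fun[of a b UNIV n]]]
    by (intro measurable_completion) (simp add: borel_measurable_continuous_onI)
  have "(\<lambda>n. LINT x|lebesgue. g x * box_bump a b n x)
      \<longlonglongrightarrow> (LINT x|lebesgue. g x * indicator (box a b) x)"
  proof (rule integral_dominated_convergence[where w="\<lambda>x. \<bar>g x\<bar>"])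
    show "AE x in lebesgue. norm (g x * box_bump a b n x) \<le> \<bar>g x\<bar>" for n
      using box_bump_bounds by (auto simp: abs_mult intro!: mult_left_le)
    show "(\<lambda>x. g x * indicator (box a b) x) \<in> borel_measurable lebesgue"
      using measurable_indicator_box_mult[of g a b] by (simp add: mult.commute)
  qed (use g in \<open>auto intro!: tendsto_mult box_bump_tendsto\<close>)
  then have "(\<lambda>n. 0 :: real) \<longlonglongrightarrow> (LINT x|lebesgue. g x * indicator (box a b) x)"
    using zero[OF box_bump_test_fun[OF D]] by simp
  then show ?thesis
    by (simp add: LIMSEQ_const_iff mult.commute)
qed

text \<open>Sets on which \<open>k\<close> has integral zero form a Dynkin system.\<close>
lemma AE_zero_if_box_integrals_zero:
  fixes k :: "pt \<Rightarrow> real"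
  assumes k: "integrable lborel k"
    and box: "\<And>c d. (LINT x|lborel. indicator (box c d) x * k x) = 0"
  shows "AE x in lborel. k x = 0"
proof -
  have [measurable]: "k \<in> borel_measurable borel" using k by auto
  have int: "integrable lborel (\<lambda>x. indicator A x * k x)" if "A \<in> sets borel" for A
    using integrable_mult_indicator[of A lborel k] that k by simp
  have UN: "(LINT x|lborel. indicator (\<Union>i::nat. A i) x * k x) = 0"
    if dis: "disjoint_family A" and A: "range A \<subseteq> sets borel"
      and z: "\<And>i. (LINT x|lborel. indicator (A i) x * k x) = 0" for A
  proof -
    have "set_lebesgue_integral lborel (\<Union>i. A i) k = (\<Sum>i. set_lebesgue_integral lborel (A i) k)"
      using A dis k
      by (intro lebesgue_integral_countable_add)
         (auto simp: disjoint_family_on_def set_integrable_def intro!: int sets.countable_UN)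
    then show ?thesis using z by (simp add: set_lebesgue_integral_def)
  qed
  \<comment> \<open>The complement step of the Dynkin induction needs the integral over the whole
    plane, obtained by exhausting the plane with boxes.\<close>
  have tot: "(LINT x|lborel. k x) = 0"
  proof -
    let ?B = "\<lambda>n::nat. box (- (real n *\<^sub>R One)) (real n *\<^sub>R One) :: pt set"
    have "(\<lambda>n. LINT x|lborel. indicator (?B n) x * k x) \<longlonglongrightarrow> (LINT x|lborel. k x)"
    proof (rule integral_dominated_convergence[where w="\<lambda>x. \<bar>k x\<bar>"])
      show "AE x in lborel. (\<lambda>n. indicator (?B n) x * k x) \<longlonglongrightarrow> k x"
      proof (intro AE_I2)
        fix x :: pt
        obtain N where "x \<in> ?B N" using UN_box_eq_UNIV by blast
        moreover have "?B N \<subseteq> ?B n" if "N \<le> n" for n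
          using that by (intro subset_box_imp) auto
        ultimately have "x \<in> ?B n" if "N \<le> n" for n
          using that by (meson subsetD)
        then have "k x = indicator (?B n) x * k x" if "N \<le> n" for n
          unfolding indicator_simps(1)[OF \<open>N \<le> n \<Longrightarrow> x \<in> ?B n\<close>[OF that]] by simp
        then have "eventually (\<lambda>n. k x = indicator (?B n) x * k x) sequentially"
          unfolding eventually_sequentially by blast
        then show "(\<lambda>n. indicator (?B n) x * k x) \<longlonglongrightarrow> k x"
          by (rule Lim_transform_eventually[OF tendsto_const])
      qed
    qed (use k in \<open>auto simp: indicator_def\<close>)
    then show ?thesis using box by (simp add: LIMSEQ_const_iff)
  qed
  have "(LINT x|lborel. indicator A x * k x) = 0" if "A \<in> sets borel" for A
  proof -
    let ?G = "range (\<lambda>(a, b). box a b :: pt set)"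
    have G: "sets (borel :: pt measure) = sigma_sets UNIV ?G"
      by (simp add: borel_eq_box)
    have "Int_stable ?G" by (auto simp: Int_stable_def box_Int_box)
    then show ?thesis
    proof (rule sigma_sets_induct_disjoint[where \<Omega>=UNIV and A=A])
      show "A \<in> sigma_sets UNIV ?G" using that G by simp
      show "(LINT x|lborel. indicator B x * k x) = 0" if "B \<in> ?G" for B
        using that box by auto
      show "(LINT x|lborel. indicator (UNIV - B) x * k x) = 0"
        if "B \<in> sigma_sets UNIV ?G" "(LINT x|lborel. indicator B x * k x) = 0" for B
      proof -
        have "(\<lambda>x. indicator (UNIV - B) x * k x) = (\<lambda>x. k x - indicator B x * k x)"
          by (auto simp: indicator_def)
        then show ?thesis
          using that tot k int[of B] G by simp
      qed
      show "(LINT x|lborel. indicator (\<Union>i::nat. B i) x * k x) = 0"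
        if "disjoint_family B" "range B \<subseteq> sigma_sets UNIV ?G"
          "\<And>i. (LINT x|lborel. indicator (B i) x * k x) = 0" for B
        using UN[of B] that G by simp
    qed auto
  qed
  then show ?thesis
    by (intro density_unique_real[OF k]) (auto simp: set_lebesgue_integral_def)
qed

text \<open>Test functions control only boxes inside \<open>D\<close>, whereas the Dynkin argument
  asks for all boxes of the plane. So \<open>g\<close> is cut off to a closed box inside
  \<open>D\<close>: any box meets it in a box that is again inside \<open>D\<close>. Countably many
  closed boxes then cover \<open>D\<close>.\<close>

lemma fundamental_lemma:
  fixes g :: "pt \<Rightarrow> real"
  assumes D: "open D" and g: "integrable (lebesgue_on D) g"
    and zero: "\<And>v. v \<in> test_fun D \<Longrightarrow> (LINT x|lebesgue_on D. g x * v x) = 0"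
  shows "AE x in lebesgue_on D. g x = 0"
proof -
  have Ds: "D \<in> sets lebesgue" using D by auto
  define g0 where "g0 x = (if x \<in> D then g x else 0)" for x
  have g0: "integrable lebesgue g0"
    unfolding g0_def using g Lebesgue_Measure.integrable_restrict_UNIV[OF Ds] by auto
  have zero0: "(LINT x|lebesgue. g0 x * v x) = 0" if "v \<in> test_fun D" for v
  proof -
    have "(\<lambda>x. g0 x * v x) = (\<lambda>x. if x \<in> D then g x * v x else 0)" by (auto simp: g0_def)
    then show ?thesis
      using zero[OF that] Lebesgue_Measure.integral_restrict_UNIV[OF Ds, of "\<lambda>x. g x * v x"] by simp
  qed
  have cb: "AE x in lebesgue. x \<in> cbox a b \<longrightarrow> g0 x = 0" if ab: "cbox a b \<subseteq> D" for a b
  proof -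
    define k where "k x = indicator (cbox a b) x * g0 x" for x
    have k: "integrable lebesgue k"
      unfolding k_def using integrable_mult_indicator[OF _ g0, of "cbox a b"] by simp
    \<comment> \<open>The Dynkin argument works with Borel sets and \<open>lborel\<close>; a Borel
      version of \<open>k\<close> provides the passage from the completed measure.\<close>
    then obtain k' where k'[measurable]: "k' \<in> borel_measurable lborel" and kk': "AE x in lborel. k x = k' x"
      using completion_ex_borel_measurable_real[of k lborel] by auto
    have kk'': "AE x in lebesgue. k x = k' x" using AE_completion[OF kk'] .
    have mk: "k' \<in> borel_measurable lebesgue" using k' by (rule measurable_completion)
    have "integrable lebesgue k'"
      using k kk'' mk integrable_cong_AE[of k lebesgue k'] by auto
    then have intk': "integrable lborel k'" using integrable_completion[of k' lborel] k' by auto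
    have "AE x in lborel. k' x = 0"
    proof (rule AE_zero_if_box_integrals_zero[OF intk'])
      fix c d :: pt
      let ?p = "\<Sum>i\<in>Basis. max (c\<bullet>i) (a\<bullet>i) *\<^sub>R i" and ?q = "\<Sum>i\<in>Basis. min (d\<bullet>i) (b\<bullet>i) *\<^sub>R i"
      have pq: "box c d \<inter> box a b = box ?p ?q" by (rule box_Int_box)
      have z: "(LINT x|lebesgue. indicator (box ?p ?q) x * g0 x) = 0"
      proof (cases "box ?p ?q = {}")
        case False
        \<comment> \<open>Test functions require the closed box to lie in \<open>D\<close>. If the
          open box is nonempty, the closed one is its closure and so remains inside
          \<open>cbox a b\<close>.\<close>
        then have "cbox ?p ?q = closure (box ?p ?q)" by (simp add: closure_box)
        also have "\<dots> \<subseteq> closure (box a b)" using pq by (intro closure_mono) blast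
        also have "\<dots> \<subseteq> cbox a b" by (intro closure_minimal box_subset_cbox closed_cbox)
        finally show ?thesis using integral_lebesgue_box_zero[OF g0 _ zero0] ab by blast
      qed simp
      \<comment> \<open>The faces are negligible, so the closed box used in the cut-off
        \<open>k\<close> may be exchanged for the open one, whose intersection with
        \<open>box c d\<close> is a box.\<close>
      have "AE x in lebesgue. x \<notin> cbox a b - box a b"
        by (rule AE_not_in) (use negligible_frontier_interval negligible_iff_null_sets in blast)
      then have ae: "AE x in lebesgue. indicator (box ?p ?q) x * g0 x = indicator (box c d) x * k' x"
        using kk''
      proof eventually_elim
        case (elim x)
        have "k' x = indicator (cbox a b) x * g0 x" using elim by (simp add: k_def)
        moreover have "(indicator (box a b) x :: real) = indicator (cbox a b) x"
          using elim box_subset_cbox[of a b] by (auto simp: indicator_def)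
        ultimately show ?case by (simp add: pq[symmetric] indicator_inter_arith)
      qed
      have "(LINT x|lborel. indicator (box c d) x * k' x) = (LINT x|lebesgue. indicator (box c d) x * k' x)"
        by (rule integral_completion[symmetric]) measurable
      also have "\<dots> = (LINT x|lebesgue. indicator (box ?p ?q) x * g0 x)"
        using ae mk g0 by (intro integral_cong_AE measurable_indicator_box_mult) auto
      finally show "(LINT x|lborel. indicator (box c d) x * k' x) = 0" using z by simp
    qed
    then have "AE x in lebesgue. k' x = 0" by (rule AE_completion)
    with kk'' show ?thesis by eventually_elim (auto simp: k_def)
  qed
  obtain \<D> where \<D>: "countable \<D>" "\<And>X. X \<in> \<D> \<Longrightarrow> \<exists>a b. X = cbox a b" "\<Union>\<D> = D"
    using open_countable_Union_open_cbox[OF D] by metis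
  have "AE x in lebesgue. \<forall>X\<in>\<D>. x \<in> X \<longrightarrow> g0 x = 0"
    unfolding AE_ball_countable[OF \<D>(1)]
    using cb \<D>(2,3) by (metis Union_upper)
  then have "AE x in lebesgue. x \<in> D \<longrightarrow> g x = 0"
    by eventually_elim (use \<D>(3) in \<open>auto simp: g0_def split: if_splits\<close>)
  then show ?thesis
    by (subst AE_restrict_space_iff) (use Ds in auto)
qed

section \<open>Integration by parts against test functions\<close>

lemma test_fun_bounded:
  assumes "v \<in> test_fun D" obtains M where "0 \<le> M" "\<And>x. \<bar>v x\<bar> \<le> M"
proof -
  have "compact (v ` supp v)"
    using assms smooth_fun_continuous_on by (intro compact_continuous_image) (auto simp: test_fun_def)
  then obtain M where M: "\<And>x. x \<in> supp v \<Longrightarrow> \<bar>v x\<bar> \<le> M"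
    using compact_imp_bounded by (force simp: bounded_iff)
  have "\<bar>v x\<bar> \<le> max M 0" for x
    using M[of x] pd_outside_supp(2)[of x v] by (cases "x \<in> supp v") auto
  then show ?thesis using that[of "max M 0"] by auto
qed

lemma pd_has_derivative_line:
  assumes "smooth_fun w"
  shows "((\<lambda>t. w (x + t *\<^sub>R axis i 1)) has_field_derivative pd i w (x + t *\<^sub>R axis i 1)) (at t)"
proof -
  let ?y = "x + t *\<^sub>R axis i 1"
  have "((\<lambda>t. x + t *\<^sub>R axis i 1) has_derivative (\<lambda>h. h *\<^sub>R axis i 1)) (at t)"
    by (auto intro!: derivative_eq_intros)
  from has_derivative_compose[OF this smooth_fun_has_derivative[OF assms]]
  have "((\<lambda>t. w (x + t *\<^sub>R axis i 1)) has_derivative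
      (\<lambda>h. frechet_derivative w (at ?y) (h *\<^sub>R axis i 1))) (at t)" .
  moreover have "(\<lambda>h. frechet_derivative w (at ?y) (h *\<^sub>R axis i 1)) = (*) (pd i w ?y)"
    using linear_frechet_derivative[OF smooth_fun_differentiable[OF assms, of ?y]]
    by (auto simp: pd_def linear_scale)
  ultimately show ?thesis by (simp add: has_field_derivative_def)
qed

text \<open>By translation invariance every difference quotient has integral zero; pass to the limit.\<close>
lemma integral_pd_zero:
  assumes w: "w \<in> test_fun D"
  shows "(LINT x|lborel. pd i w x) = 0"
proof -
  let ?e = "axis i 1 :: pt"
  have sm: "smooth_fun w" using w by (rule test_fun_smooth)
  have [measurable]: "w \<in> borel_measurable borel" "pd i w \<in> borel_measurable borel"
    using sm smooth_fun_pd smooth_fun_continuous_on by (auto intro!: borel_measurable_continuous_onI)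
  obtain M where M: "0 \<le> M" "\<And>x. \<bar>pd i w x\<bar> \<le> M" using test_fun_bounded[OF test_fun_pd[OF w]] by metis
  have "bounded (supp w)" using w by (auto simp: test_fun_def intro: compact_imp_bounded)
  then obtain R where R: "\<And>x. x \<in> supp w \<Longrightarrow> norm x \<le> R" by (auto simp: bounded_iff)
  have wz: "w x = 0" if "norm x > R" for x using that R[of x] pd_outside_supp(2)[of x w] by force
  have intw: "integrable lborel w"
  proof -
    obtain Mw where Mw: "\<And>x. \<bar>w x\<bar> \<le> Mw" using test_fun_bounded[OF w] by metis
    show ?thesis
    proof (rule Bochner_Integration.integrable_bound[of _ "\<lambda>x. Mw * indicator (cball 0 R) x"])
      show "AE x in lborel. norm (w x) \<le> norm (Mw * indicator (cball 0 R) x)"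
      proof (intro AE_I2)
        fix x
        show "norm (w x) \<le> norm (Mw * indicator (cball 0 R) x)"
          using Mw[of x] wz[of x] by (cases "norm x \<le> R") auto
      qed
    qed (auto intro!: integrable_mult_right integrable_real_indicator emeasure_lborel_cball_finite)
  qed
  define q where "q n x = (w (x + (1 / real (Suc n)) *\<^sub>R ?e) - w x) * real (Suc n)" for n x
  have qz: "(LINT x|lborel. q n x) = 0" for n
  proof -
    let ?c = "(1 / real (Suc n)) *\<^sub>R ?e"
    have i2: "integrable lborel (\<lambda>x. w (?c + x))"
      using integrable_distr[of "(+) ?c" lborel borel w] intw lborel_distr_plus[of ?c] by simp
    have "(LINT x|lborel. w (?c + x)) = (LINT x|lborel. w x)"
      using integral_distr[of "(+) ?c" lborel borel w] lborel_distr_plus[of ?c] by simp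
    then show ?thesis
      unfolding q_def using i2 intw by (simp add: add.commute)
  qed
  \<comment> \<open>The mean value theorem bounds the quotient by the supremum of the derivative.
    The steps have length at most 1, so outside the ball of radius R + 1 both evaluation points miss
    the support.\<close>
  have qb: "\<bar>q n x\<bar> \<le> M * indicator (cball 0 (R+1)) x" for n x
  proof (cases "norm x \<le> R + 1")
    case True
    have "\<exists>z. 0 < z \<and> z < 1 / real (Suc n) \<and> w (x + (1 / real (Suc n)) *\<^sub>R ?e) - w (x + 0 *\<^sub>R ?e)
        = (1 / real (Suc n) - 0) * pd i w (x + z *\<^sub>R ?e)"
      by (rule MVT2) (use pd_has_derivative_line[OF sm] in auto)
    then obtain z where "w (x + (1 / real (Suc n)) *\<^sub>R ?e) - w x = (1 / real (Suc n)) * pd i w (x + z *\<^sub>R ?e)"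
      by auto
    then have "q n x = pd i w (x + z *\<^sub>R ?e)" by (simp add: q_def)
    then show ?thesis using M True by simp
  next
    case False
    have "norm x - 1 / real (Suc n) \<le> norm (x + (1 / real (Suc n)) *\<^sub>R ?e)"
      using norm_triangle_ineq2[of x "- ((1 / real (Suc n)) *\<^sub>R ?e)"] by (simp add: norm_axis_1)
    moreover have "1 / real (Suc n) \<le> 1" by simp
    ultimately have "norm (x + (1 / real (Suc n)) *\<^sub>R ?e) > R"
      using False by linarith
    moreover have "norm x > R" using False by simp
    ultimately show ?thesis using wz M(1) by (simp add: q_def)
  qed
  have ql: "(\<lambda>n. q n x) \<longlonglongrightarrow> pd i w x" for x
  proof -
    have "((\<lambda>h. (w (x + h *\<^sub>R ?e) - w x) / h) \<longlongrightarrow> pd i w x) (at 0)"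
      using pd_has_derivative_line[OF sm, of x i 0] by (simp add: DERIV_def)
    moreover have "filterlim (\<lambda>n. 1 / real (Suc n)) (at 0) sequentially"
      using LIMSEQ_Suc[OF lim_1_over_n] by (auto simp: filterlim_at simp del: of_nat_Suc)
    ultimately have "(\<lambda>n. (w (x + (1 / real (Suc n)) *\<^sub>R ?e) - w x) / (1 / real (Suc n))) \<longlonglongrightarrow> pd i w x"
      by (rule filterlim_compose)
    then show ?thesis by (simp add: q_def)
  qed
  have "(\<lambda>n. LINT x|lborel. q n x) \<longlonglongrightarrow> (LINT x|lborel. pd i w x)"
  proof (rule integral_dominated_convergence[where w="\<lambda>x. M * indicator (cball 0 (R+1)) x"])
    show "integrable lborel (\<lambda>x. M * indicator (cball 0 (R + 1)) x :: real)"
      by (auto intro!: integrable_mult_right integrable_real_indicator emeasure_lborel_cball_finite)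
  qed (use ql qb in \<open>auto simp: q_def\<close>)
  then show ?thesis using qz by (simp add: LIMSEQ_const_iff)
qed

text \<open>Moves a continuous integrand that vanishes off \<open>D\<close> to
  \<open>lborel\<close>, where translation invariance has given
  \<open>integral_pd_zero\<close>.\<close>

lemma integral_lebesgue_on_test:
  assumes D: "open D" and v: "continuous_on UNIV v" "\<And>x. x \<notin> D \<Longrightarrow> v x = (0::real)"
  shows "(LINT x|lebesgue_on D. v x) = (LINT x|lborel. v (x :: pt))"
proof -
  have "(LINT x|lebesgue_on D. v x) = (LINT x|lebesgue. (if x \<in> D then v x else 0))"
    by (rule Lebesgue_Measure.integral_restrict_UNIV[symmetric]) (use D in auto)
  also have "(\<lambda>x. if x \<in> D then v x else 0) = v" using v by auto
  also have "(LINT x|lebesgue. v x) = (LINT x|lborel. v x)"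
    by (rule integral_completion) (use v in \<open>simp add: borel_measurable_continuous_onI\<close>)
  finally show ?thesis .
qed

section \<open>Square integrable functions\<close>

text \<open>Stated for an arbitrary measure so that functions on an element and functions on a
  parametrised edge share the same lemmas.\<close>

definition sqint :: "'a measure \<Rightarrow> ('a \<Rightarrow> real) \<Rightarrow> bool" where
  "sqint M u \<longleftrightarrow> u \<in> borel_measurable M \<and> integrable M (\<lambda>x. (u x)\<^sup>2)"

lemma L2_iff_sqint: "u \<in> L2 D \<longleftrightarrow> sqint (lebesgue_on D) u"
  by (simp add: L2_def sqint_def)

lemma edge_L2_iff_sqint: "g \<in> edge_L2 a b \<longleftrightarrow> sqint (lebesgue_on {0..1}) (\<lambda>t. g (linepath a b t))"
  by (simp add: edge_L2_def sqint_def)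

lemma sq_lin_le: "(c * s + d * t)\<^sup>2 \<le> 2 * c\<^sup>2 * s\<^sup>2 + 2 * d\<^sup>2 * (t :: real)\<^sup>2"
proof -
  have "0 \<le> (c * s - d * t)\<^sup>2" by simp
  then show ?thesis by (simp add: power2_eq_square algebra_simps)
qed

lemma sqint_lin:
  assumes "sqint M u" "sqint M v" shows "sqint M (\<lambda>x. c * u x + d * v x)"
proof -
  have [measurable]: "u \<in> borel_measurable M" "v \<in> borel_measurable M"
    using assms by (auto simp: sqint_def)
  have "integrable M (\<lambda>x. 2 * c\<^sup>2 * (u x)\<^sup>2 + 2 * d\<^sup>2 * (v x)\<^sup>2)"
    using assms by (auto simp: sqint_def)
  then have "integrable M (\<lambda>x. (c * u x + d * v x)\<^sup>2)"
    by (rule Bochner_Integration.integrable_bound) (auto simp: sq_lin_le)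
  then show ?thesis by (simp add: sqint_def)
qed

lemma sqint_mult_integrable:
  assumes "sqint M u" "sqint M v" shows "integrable M (\<lambda>x. u x * v x)"
proof -
  have [measurable]: "u \<in> borel_measurable M" "v \<in> borel_measurable M"
    using assms by (auto simp: sqint_def)
  have "integrable M (\<lambda>x. (u x)\<^sup>2 + (v x)\<^sup>2)"
    using assms by (auto simp: sqint_def)
  then show ?thesis
  proof (rule Bochner_Integration.integrable_bound)
    show "AE x in M. norm (u x * v x) \<le> norm ((u x)\<^sup>2 + (v x)\<^sup>2)"
    proof (intro AE_I2)
      fix x
      have "2 * (\<bar>u x\<bar> * \<bar>v x\<bar>) \<le> \<bar>u x\<bar>\<^sup>2 + \<bar>v x\<bar>\<^sup>2"
        using zero_le_power2[of "\<bar>u x\<bar> - \<bar>v x\<bar>"] by (simp add: power2_diff)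
      moreover have "0 \<le> \<bar>u x\<bar> * \<bar>v x\<bar>" by simp
      ultimately have "\<bar>u x\<bar> * \<bar>v x\<bar> \<le> (u x)\<^sup>2 + (v x)\<^sup>2"
        unfolding power2_abs by linarith
      then show "norm (u x * v x) \<le> norm ((u x)\<^sup>2 + (v x)\<^sup>2)"
        by (simp add: abs_mult)
    qed
  qed measurable
qed

lemma sqint_bounded:
  assumes "finite_measure M" "u \<in> borel_measurable M" "\<And>x. x \<in> space M \<Longrightarrow> \<bar>u x\<bar> \<le> B"
  shows "sqint M u"
proof -
  have "integrable M (\<lambda>x. (u x)\<^sup>2)"
  proof (rule finite_measure.integrable_const_bound[OF assms(1), of _ "B\<^sup>2"])
    show "AE x in M. norm ((u x)\<^sup>2) \<le> B\<^sup>2"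
      using assms(3) by (intro AE_I2) (metis abs_power2 power2_abs power_mono abs_ge_zero real_norm_def)
  qed (use assms(2) in measurable)
  then show ?thesis using assms(2) by (simp add: sqint_def)
qed

text \<open>The elementary bound \<open>sq_lin_le\<close> takes the place of the triangle inequality
  for the L2 norm.\<close>

lemma integral_sq_lin_tendsto:
  assumes "\<And>n. sqint M (p n)" "\<And>n. sqint M (q n)"
    and "(\<lambda>n. LINT x|M. (p n x)\<^sup>2) \<longlonglongrightarrow> 0" "(\<lambda>n. LINT x|M. (q n x)\<^sup>2) \<longlonglongrightarrow> 0"
  shows "(\<lambda>n. LINT x|M. (c * p n x + d * q n x)\<^sup>2) \<longlonglongrightarrow> 0"
proof (rule tendsto_sandwich[OF _ _ tendsto_const])
  have le: "(LINT x|M. (c * p n x + d * q n x)\<^sup>2)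
      \<le> (LINT x|M. 2 * c\<^sup>2 * (p n x)\<^sup>2 + 2 * d\<^sup>2 * (q n x)\<^sup>2)" for n
    using sqint_lin[OF assms(1,2)[of n], of c d] assms(1,2)[of n]
    by (intro integral_mono) (auto simp: sqint_def sq_lin_le)
  have "(LINT x|M. (c * p n x + d * q n x)\<^sup>2)
      \<le> 2 * c\<^sup>2 * (LINT x|M. (p n x)\<^sup>2) + 2 * d\<^sup>2 * (LINT x|M. (q n x)\<^sup>2)" for n
    using le[of n] assms(1,2)[of n] by (simp add: sqint_def)
  then show "eventually (\<lambda>n. (LINT x|M. (c * p n x + d * q n x)\<^sup>2)
      \<le> 2 * c\<^sup>2 * (LINT x|M. (p n x)\<^sup>2) + 2 * d\<^sup>2 * (LINT x|M. (q n x)\<^sup>2)) sequentially"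
    by simp
  show "(\<lambda>n. 2 * c\<^sup>2 * (LINT x|M. (p n x)\<^sup>2) + 2 * d\<^sup>2 * (LINT x|M. (q n x)\<^sup>2)) \<longlonglongrightarrow> 0"
    using tendsto_add[OF tendsto_mult_left[OF assms(3), of "2 * c\<^sup>2"]
        tendsto_mult_left[OF assms(4), of "2 * d\<^sup>2"]] by simp
qed auto

lemma L2norm_tendsto_0_iff:
  "(\<lambda>n. L2norm D (u n)) \<longlonglongrightarrow> 0 \<longleftrightarrow> (\<lambda>n. LINT x|lebesgue_on D. (u n x)\<^sup>2) \<longlonglongrightarrow> 0"
proof
  assume "(\<lambda>n. L2norm D (u n)) \<longlonglongrightarrow> 0"
  from tendsto_power[OF this, of 2]
  show "(\<lambda>n. LINT x|lebesgue_on D. (u n x)\<^sup>2) \<longlonglongrightarrow> 0"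
    by (simp add: L2norm_def)
next
  assume "(\<lambda>n. LINT x|lebesgue_on D. (u n x)\<^sup>2) \<longlonglongrightarrow> 0"
  from tendsto_real_sqrt[OF this] show "(\<lambda>n. L2norm D (u n)) \<longlonglongrightarrow> 0"
    by (simp add: L2norm_def)
qed

text \<open>The geometric setting common to the domain and the elements: openness serves the
  fundamental lemma, boundedness puts smooth functions into \<open>L2\<close>.\<close>

definition bdd_open :: "pt set \<Rightarrow> bool" where
  "bdd_open D \<longleftrightarrow> open D \<and> bounded D"

lemma bdd_open_lmeasurable: "bdd_open D \<Longrightarrow> D \<in> lmeasurable"
  by (simp add: bdd_open_def lmeasurable_open)

lemma bdd_open_sets: "bdd_open D \<Longrightarrow> D \<in> sets lebesgue"
  by (auto simp: bdd_open_def)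

lemma L2_continuous:
  assumes "bdd_open D" "continuous_on (closure D) u" shows "u \<in> L2 D"
proof -
  have "compact (u ` closure D)"
    using assms by (intro compact_continuous_image) (auto simp: bdd_open_def)
  then obtain B where "\<And>x. x \<in> closure D \<Longrightarrow> \<bar>u x\<bar> \<le> B"
    using compact_imp_bounded by (force simp: bounded_iff)
  moreover have "u \<in> borel_measurable (lebesgue_on D)"
    using assms closure_subset
    by (intro continuous_imp_measurable_on_sets_lebesgue bdd_open_sets) (auto intro: continuous_on_subset)
  ultimately show ?thesis
    unfolding L2_iff_sqint using closure_subset assms
    by (intro sqint_bounded[of _ _ B] finite_measure_lebesgue_on bdd_open_lmeasurable) auto
qed

lemma L2_smooth: "bdd_open D \<Longrightarrow> smooth_fun u \<Longrightarrow> u \<in> L2 D"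
  by (simp add: L2_continuous smooth_fun_continuous_on)

lemma L2_lin: "u \<in> L2 D \<Longrightarrow> v \<in> L2 D \<Longrightarrow> (\<lambda>x. c * u x + d * v x) \<in> L2 D"
  by (simp add: L2_iff_sqint sqint_lin)

lemma L2_measurable: "u \<in> L2 D \<Longrightarrow> u \<in> borel_measurable (lebesgue_on D)"
  by (simp add: L2_def)

lemma L2_mult_integrable: "u \<in> L2 D \<Longrightarrow> v \<in> L2 D \<Longrightarrow> integrable (lebesgue_on D) (\<lambda>x. u x * v x)"
  by (simp add: L2_iff_sqint sqint_mult_integrable)

lemma L2_integrable:
  assumes "bdd_open D" "u \<in> L2 D" shows "integrable (lebesgue_on D) u"
  using L2_mult_integrable[OF assms(2) L2_smooth[OF assms(1) smooth_fun_const[of 1]]] by simp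

lemma L2_integral_lin:
  assumes "u \<in> L2 D" "v \<in> L2 D" "w \<in> L2 D"
  shows "(LINT x|lebesgue_on D. (c * u x + d * v x) * w x)
     = c * (LINT x|lebesgue_on D. u x * w x) + d * (LINT x|lebesgue_on D. v x * w x)"
proof -
  have "(LINT x|lebesgue_on D. (c * u x + d * v x) * w x)
      = (LINT x|lebesgue_on D. c * (u x * w x) + d * (v x * w x))"
    by (simp add: algebra_simps)
  also have "\<dots> = c * (LINT x|lebesgue_on D. u x * w x) + d * (LINT x|lebesgue_on D. v x * w x)"
    using L2_mult_integrable[OF assms(1,3)] L2_mult_integrable[OF assms(2,3)] by simp
  finally show ?thesis .
qed

lemma integral_mult_cong_AE:
  assumes "AE x in lebesgue_on D. u x = u' x" "u \<in> L2 D" "u' \<in> L2 D" "v \<in> L2 D"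
  shows "(LINT x|lebesgue_on D. u x * v x) = (LINT x|lebesgue_on D. u' x * v x)"
  using assms(1) L2_measurable[OF assms(2)] L2_measurable[OF assms(3)] L2_measurable[OF assms(4)]
  by (intro integral_cong_AE) auto

lemma test_fun_L2: "bdd_open D \<Longrightarrow> v \<in> test_fun E \<Longrightarrow> v \<in> L2 D"
  using L2_smooth test_fun_smooth by blast

section \<open>Weak derivatives\<close>

lemma weak_partial_lin:
  assumes D: "bdd_open D" and L: "u \<in> L2 D" "u' \<in> L2 D" "g \<in> L2 D" "g' \<in> L2 D"
    and w: "weak_partial D i u g" "weak_partial D i u' g'"
  shows "weak_partial D i (\<lambda>x. c * u x + d * u' x) (\<lambda>x. c * g x + d * g' x)"
  unfolding weak_partial_def
proof
  fix v assume v: "v \<in> test_fun D"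
  note v2 = test_fun_L2[OF D v] test_fun_L2[OF D test_fun_pd[OF v, of i]]
  show "(LINT x|lebesgue_on D. (c * u x + d * u' x) * pd i v x)
      = - (LINT x|lebesgue_on D. (c * g x + d * g' x) * v x)"
    using v w unfolding L2_integral_lin[OF L(1,2) v2(2)] L2_integral_lin[OF L(3,4) v2(1)]
    by (simp add: weak_partial_def)
qed

lemma weak_partial_cong_AE:
  assumes "bdd_open D" "u \<in> L2 D" "u' \<in> L2 D" "AE x in lebesgue_on D. u x = u' x"
  shows "weak_partial D i u = weak_partial D i u'"
proof -
  have "(LINT x|lebesgue_on D. u x * pd i v x) = (LINT x|lebesgue_on D. u' x * pd i v x)"
    if "v \<in> test_fun D" for v
    using integral_mult_cong_AE[OF assms(4,2,3) test_fun_L2[OF assms(1) test_fun_pd[OF that]]] .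
  then show ?thesis by (auto simp: weak_partial_def)
qed

text \<open>A weak derivative sees its function only under integrals, so both functions define the
  same predicate and \<open>SOME\<close> returns the same value. The conclusion is therefore an
  equality of functions, which permits rewriting under a further derivative.\<close>

lemma wd_cong_AE:
  "bdd_open D \<Longrightarrow> u \<in> L2 D \<Longrightarrow> u' \<in> L2 D \<Longrightarrow> AE x in lebesgue_on D. u x = u' x \<Longrightarrow> wd D i u = wd D i u'"
  using weak_partial_cong_AE[of D u u' i] unfolding wd_def by simp

lemma H1_L2: "u \<in> H1 D \<Longrightarrow> u \<in> L2 D"
  by (simp add: H1_def)

lemma wd_works:
  assumes "u \<in> H1 D" shows "wd D i u \<in> L2 D" "weak_partial D i u (wd D i u)"
proof -
  have "\<exists>g. g \<in> L2 D \<and> weak_partial D i u g" using assms by (auto simp: H1_def)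
  from someI_ex[OF this] show "wd D i u \<in> L2 D" "weak_partial D i u (wd D i u)"
    by (auto simp: wd_def)
qed

lemma weak_partial_unique:
  assumes D: "bdd_open D" and L: "g \<in> L2 D" "g' \<in> L2 D"
    and w: "weak_partial D i u g" "weak_partial D i u g'"
  shows "AE x in lebesgue_on D. g x = g' x"
proof -
  have L': "(\<lambda>x. 1 * g x + (-1) * g' x) \<in> L2 D" using L by (rule L2_lin)
  have "AE x in lebesgue_on D. 1 * g x + (-1) * g' x = 0"
  proof (rule fundamental_lemma)
    fix v assume v: "v \<in> test_fun D"
    show "(LINT x|lebesgue_on D. (1 * g x + (-1) * g' x) * v x) = 0"
      using w v unfolding L2_integral_lin[OF L test_fun_L2[OF D v]] by (simp add: weak_partial_def)
  qed (use D L' L2_integrable in \<open>auto simp: bdd_open_def\<close>)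
  then show ?thesis by eventually_elim simp
qed

lemma wd_unique:
  assumes "bdd_open D" "u \<in> L2 D" "g \<in> L2 D" "weak_partial D i u g"
  shows "AE x in lebesgue_on D. wd D i u x = g x"
proof -
  have "\<exists>g. g \<in> L2 D \<and> weak_partial D i u g" using assms by blast
  from someI_ex[OF this] show ?thesis
    using weak_partial_unique[OF assms(1) _ assms(3) _ assms(4)] unfolding wd_def by blast
qed

lemma H1_lin:
  assumes "bdd_open D" "u \<in> H1 D" "v \<in> H1 D" shows "(\<lambda>x. c * u x + d * v x) \<in> H1 D"
proof -
  have "\<exists>g\<in>L2 D. weak_partial D i (\<lambda>x. c * u x + d * v x) g" for i
    using weak_partial_lin[OF assms(1) H1_L2[OF assms(2)] H1_L2[OF assms(3)] wd_works(1)[OF assms(2)]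
        wd_works(1)[OF assms(3)] wd_works(2)[OF assms(2)] wd_works(2)[OF assms(3)]]
      L2_lin[OF wd_works(1)[OF assms(2)] wd_works(1)[OF assms(3)]] by blast
  then show ?thesis
    using L2_lin[OF H1_L2[OF assms(2)] H1_L2[OF assms(3)]] by (simp add: H1_def)
qed

lemma wd_lin:
  assumes "bdd_open D" "u \<in> H1 D" "v \<in> H1 D"
  shows "AE x in lebesgue_on D. wd D i (\<lambda>x. c * u x + d * v x) x = c * wd D i u x + d * wd D i v x"
  using weak_partial_lin[OF assms(1) H1_L2[OF assms(2)] H1_L2[OF assms(3)] wd_works(1)[OF assms(2)]
      wd_works(1)[OF assms(3)] wd_works(2)[OF assms(2)] wd_works(2)[OF assms(3)]]
  by (intro wd_unique L2_lin assms H1_L2 wd_works(1)) auto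

lemma H1_cong_AE:
  assumes "bdd_open D" "u \<in> H1 D" "u' \<in> L2 D" "AE x in lebesgue_on D. u x = u' x"
  shows "u' \<in> H1 D"
proof -
  have "\<exists>g\<in>L2 D. weak_partial D i u' g" for i
    using wd_works[OF assms(2), of i] weak_partial_cong_AE[OF assms(1) H1_L2[OF assms(2)] assms(3,4), of i]
    by metis
  then show ?thesis using assms(3) by (simp add: H1_def)
qed

lemma H2_H1: "u \<in> H2 D \<Longrightarrow> u \<in> H1 D" and H2_wd: "u \<in> H2 D \<Longrightarrow> wd D i u \<in> H1 D"
  by (auto simp: H2_def)

lemma H2_L2: "u \<in> H2 D \<Longrightarrow> u \<in> L2 D" and H2_wd_L2: "u \<in> H2 D \<Longrightarrow> wd D i u \<in> L2 D"
  and H2_hess_L2: "u \<in> H2 D \<Longrightarrow> hess D i j u \<in> L2 D"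
  unfolding H2_def hess_def by (simp_all add: H1_L2 wd_works(1))

lemma wd_lin_L2:
  assumes "bdd_open D" "u \<in> H1 D" "v \<in> H1 D"
  shows "wd D i (\<lambda>x. c * u x + d * v x) \<in> L2 D" "(\<lambda>x. c * wd D i u x + d * wd D i v x) \<in> L2 D"
  using H1_lin[OF assms] assms(2,3) by (simp_all add: L2_lin wd_works(1))

lemma H2_lin:
  assumes D: "bdd_open D" and u: "u \<in> H2 D" "v \<in> H2 D"
  shows "(\<lambda>x. c * u x + d * v x) \<in> H2 D"
proof -
  have "wd D i (\<lambda>x. c * u x + d * v x) \<in> H1 D" for i
  proof (rule H1_cong_AE[OF D])
    show "(\<lambda>x. c * wd D i u x + d * wd D i v x) \<in> H1 D"
      using u by (intro H1_lin D H2_wd)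
    show "AE x in lebesgue_on D. c * wd D i u x + d * wd D i v x = wd D i (\<lambda>x. c * u x + d * v x) x"
      using wd_lin[OF D H2_H1[OF u(1)] H2_H1[OF u(2)], of i c d] by eventually_elim simp
  qed (rule wd_lin_L2(1)[OF D H2_H1[OF u(1)] H2_H1[OF u(2)]])
  then show ?thesis using H1_lin[OF D H2_H1[OF u(1)] H2_H1[OF u(2)]] by (simp add: H2_def)
qed

text \<open>The inner derivative is linear only almost everywhere; \<open>wd_cong_AE\<close> turns
  this into an equality below the outer derivative, which is then expanded by
  \<open>wd_lin\<close>.\<close>

lemma hess_lin:
  assumes D: "bdd_open D" and u: "u \<in> H2 D" "v \<in> H2 D"
  shows "AE x in lebesgue_on D. hess D i j (\<lambda>x. c * u x + d * v x) x = c * hess D i j u x + d * hess D i j v x"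
proof -
  have "hess D i j (\<lambda>x. c * u x + d * v x) = wd D i (\<lambda>x. c * wd D j u x + d * wd D j v x)"
    unfolding hess_def
    using wd_lin_L2[OF D H2_H1[OF u(1)] H2_H1[OF u(2)]] wd_lin[OF D H2_H1[OF u(1)] H2_H1[OF u(2)]]
    by (intro wd_cong_AE[OF D])
  then show ?thesis
    using wd_lin[OF D H2_wd[OF u(1)] H2_wd[OF u(2)]] by (simp add: hess_def)
qed

lemma lap_lin:
  assumes D: "bdd_open D" and u: "u \<in> H2 D" "v \<in> H2 D"
  shows "AE x in lebesgue_on D. lap D (\<lambda>x. c * u x + d * v x) x = c * lap D u x + d * lap D v x"
  using hess_lin[OF D u, of 1 1 c d] hess_lin[OF D u, of 2 2 c d]
  by eventually_elim (simp add: lap_def sum_2 algebra_simps)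

lemma lap_L2: "u \<in> H2 D \<Longrightarrow> lap D u \<in> L2 D"
  using L2_lin[OF H2_hess_L2[of u D 1 1] H2_hess_L2[of u D 2 2], of 1 1]
  by (simp add: lap_def[abs_def] sum_2)

section \<open>The Hessian form\<close>

lemma hess_form_eq:
  assumes "u \<in> H2 D" "v \<in> H2 D"
  shows "hess_form D u v = (\<Sum>i\<in>UNIV. \<Sum>j\<in>UNIV. LINT x|lebesgue_on D. hess D i j u x * hess D i j v x)"
  unfolding hess_form_def using assms
  by (simp add: L2_mult_integrable H2_hess_L2)

lemma hess_form_sym: "hess_form D u v = hess_form D v u"
  by (simp add: hess_form_def mult.commute)

lemma hess_form_lin:
  assumes D: "bdd_open D" and u: "u \<in> H2 D" "v \<in> H2 D" "w \<in> H2 D"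
  shows "hess_form D (\<lambda>x. c * u x + d * v x) w = c * hess_form D u w + d * hess_form D v w"
proof -
  have "(LINT x|lebesgue_on D. hess D i j (\<lambda>x. c * u x + d * v x) x * hess D i j w x)
     = c * (LINT x|lebesgue_on D. hess D i j u x * hess D i j w x)
       + d * (LINT x|lebesgue_on D. hess D i j v x * hess D i j w x)" for i j
    using L2_integral_lin[OF H2_hess_L2 H2_hess_L2 H2_hess_L2, OF u]
      integral_mult_cong_AE[OF hess_lin[OF D u(1,2)] H2_hess_L2[OF H2_lin[OF D u(1,2)]]
        L2_lin[OF H2_hess_L2 H2_hess_L2, OF u(1,2)] H2_hess_L2[OF u(3)]]
    by simp
  then show ?thesis
    unfolding hess_form_eq[OF H2_lin[OF D u(1,2)] u(3)] hess_form_eq[OF u(1,3)] hess_form_eq[OF u(2,3)]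
    by (simp add: sum.distrib sum_distrib_left)
qed

lemma hess_form_nonneg: "0 \<le> hess_form D u u"
  unfolding hess_form_def by (intro integral_nonneg_AE AE_I2 sum_nonneg) auto

section \<open>Smooth functions are weakly differentiable\<close>

text \<open>The product p v is itself a test function, so its partial derivative has integral zero;
  the product rule splits this into the two sides.\<close>

lemma weak_partial_smooth:
  assumes D: "bdd_open D" and p: "smooth_fun p"
  shows "weak_partial D i p (pd i p)"
  unfolding weak_partial_def
proof
  fix v assume v: "v \<in> test_fun D"
  have oD: "open D" using D by (simp add: bdd_open_def)
  let ?w = "\<lambda>x. p x * v x"
  have w: "?w \<in> test_fun D" using test_fun_mult[OF v p] .
  have pdw: "pd i ?w = (\<lambda>x. p x * pd i v x + pd i p x * v x)"
    using p test_fun_smooth[OF v] by (auto simp: pd_mult smooth_fun_differentiable)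
  have "0 = (LINT x|lborel. pd i ?w x)" using integral_pd_zero[OF w] by simp
  also have "\<dots> = (LINT x|lebesgue_on D. pd i ?w x)"
    using test_fun_outside[OF test_fun_pd[OF w]] smooth_fun_continuous_on[OF test_fun_smooth[OF test_fun_pd[OF w]]]
    by (intro integral_lebesgue_on_test[OF oD, symmetric]) auto
  also have "\<dots> = (LINT x|lebesgue_on D. p x * pd i v x) + (LINT x|lebesgue_on D. pd i p x * v x)"
    unfolding pdw using D p v
    by (intro Bochner_Integration.integral_add L2_mult_integrable L2_smooth)
       (auto intro: smooth_fun_pd test_fun_smooth)
  finally show "(LINT x|lebesgue_on D. p x * pd i v x) = - (LINT x|lebesgue_on D. pd i p x * v x)"
    by simp
qed

lemma H1_smooth:
  assumes "bdd_open D" "smooth_fun p" shows "p \<in> H1 D"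
  unfolding H1_def
  using weak_partial_smooth[OF assms] L2_smooth[OF assms] L2_smooth[OF assms(1) smooth_fun_pd[OF assms(2)]]
  by blast

lemma wd_smooth:
  assumes "bdd_open D" "smooth_fun p" shows "AE x in lebesgue_on D. wd D i p x = pd i p x"
  using assms by (intro wd_unique weak_partial_smooth L2_smooth smooth_fun_pd)

lemma H2_smooth:
  assumes "bdd_open D" "smooth_fun p" shows "p \<in> H2 D"
proof -
  have "wd D i p \<in> H1 D" for i
  proof (rule H1_cong_AE[OF assms(1)])
    show "pd i p \<in> H1 D" using assms by (intro H1_smooth smooth_fun_pd)
    show "AE x in lebesgue_on D. pd i p x = wd D i p x"
      using wd_smooth[OF assms, of i] by eventually_elim simp
  qed (intro wd_works(1) H1_smooth assms)
  then show ?thesis using H1_smooth[OF assms] by (simp add: H2_def)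
qed

lemma hess_smooth:
  assumes "bdd_open D" "smooth_fun p" shows "AE x in lebesgue_on D. hess D i j p x = pd i (pd j p) x"
proof -
  have "hess D i j p = wd D i (pd j p)"
    unfolding hess_def using assms
    by (intro wd_cong_AE wd_smooth L2_smooth smooth_fun_pd H2_wd_L2 H2_smooth)
  then show ?thesis using wd_smooth[OF assms(1) smooth_fun_pd[OF assms(2)]] by simp
qed

section \<open>Restriction to subdomains\<close>

lemma L2_restrict:
  assumes "u \<in> L2 D" "E \<subseteq> D" "bdd_open D" "bdd_open E" shows "u \<in> L2 E"
proof -
  have *: "restrict_space (lebesgue_on D) E = lebesgue_on E"
    using assms by (subst restrict_restrict_space) (auto simp: bdd_open_sets Int_absorb1)
  have "integrable (lebesgue_on D) (\<lambda>x. indicator E x *\<^sub>R (u x)\<^sup>2)"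
    using assms(1) bdd_open_sets[OF assms(4)] assms(2) bdd_open_sets[OF assms(3)]
    by (intro integrable_mult_indicator) (auto simp: L2_def sets_restrict_space_iff)
  then have "integrable (restrict_space (lebesgue_on D) E) (\<lambda>x. (u x)\<^sup>2)"
    using assms(2) bdd_open_sets[OF assms(4)] bdd_open_sets[OF assms(3)]
    by (subst integrable_restrict_space) (auto simp: sets_restrict_space_iff Int_absorb2 Int_absorb1)
  moreover have "u \<in> borel_measurable (restrict_space (lebesgue_on D) E)"
    by (rule measurable_restrict_space1[OF L2_measurable[OF assms(1)]])
  ultimately show ?thesis unfolding * by (simp add: L2_def)
qed

lemma integral_restrict_test:
  assumes "E \<subseteq> D" "bdd_open D" "bdd_open E" "v \<in> test_fun E"
  shows "(LINT x|lebesgue_on D. u x * v x) = (LINT x|lebesgue_on E. u x * (v x :: real))"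
proof -
  have "(LINT x|lebesgue_on D. u x * v x) = (LINT x|lebesgue. (if x \<in> D then u x * v x else 0))"
    by (rule Lebesgue_Measure.integral_restrict_UNIV[symmetric]) (use assms bdd_open_sets in auto)
  also have "(\<lambda>x. if x \<in> D then u x * v x else 0) = (\<lambda>x. if x \<in> E then u x * v x else 0)"
  proof
    fix x
    show "(if x \<in> D then u x * v x else 0) = (if x \<in> E then u x * v x else 0)"
      using assms(1) test_fun_outside[OF assms(4), of x] by (cases "x \<in> E") auto
  qed
  also have "(LINT x|lebesgue. (if x \<in> E then u x * v x else 0)) = (LINT x|lebesgue_on E. u x * v x)"
    by (rule Lebesgue_Measure.integral_restrict_UNIV) (use assms bdd_open_sets in auto)
  finally show ?thesis .
qed

text \<open>A test function on \<open>E\<close> is also one on \<open>D\<close> and vanishes outside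
  \<open>E\<close>. This is how the exact solution becomes an H2 function on each element.\<close>

lemma weak_partial_restrict:
  assumes "E \<subseteq> D" "bdd_open D" "bdd_open E" "weak_partial D i u g"
  shows "weak_partial E i u g"
  unfolding weak_partial_def
proof
  fix v assume v: "v \<in> test_fun E"
  then have "v \<in> test_fun D" using test_fun_mono[OF assms(1)] by blast
  then have "(LINT x|lebesgue_on D. u x * pd i v x) = - (LINT x|lebesgue_on D. g x * v x)"
    using assms(4) by (simp add: weak_partial_def)
  then show "(LINT x|lebesgue_on E. u x * pd i v x) = - (LINT x|lebesgue_on E. g x * v x)"
    unfolding integral_restrict_test[OF assms(1-3) v] integral_restrict_test[OF assms(1-3) test_fun_pd[OF v]] .
qed

lemma H1_restrict:
  assumes "E \<subseteq> D" "bdd_open D" "bdd_open E" "u \<in> H1 D" shows "u \<in> H1 E"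
  unfolding H1_def
proof (intro CollectI conjI allI)
  show "u \<in> L2 E" using L2_restrict[OF H1_L2[OF assms(4)] assms(1-3)] .
  show "\<exists>g\<in>L2 E. weak_partial E i u g" for i
    using L2_restrict[OF wd_works(1)[OF assms(4), of i] assms(1-3)]
      weak_partial_restrict[OF assms(1-3) wd_works(2)[OF assms(4), of i]] by blast
qed

lemma wd_restrict:
  assumes "E \<subseteq> D" "bdd_open D" "bdd_open E" "u \<in> H1 D"
  shows "AE x in lebesgue_on E. wd E i u x = wd D i u x"
  using assms(4)
  by (intro wd_unique[OF assms(3)] weak_partial_restrict[OF assms(1-3)] L2_restrict[OF _ assms(1-3)]
      H1_L2 wd_works)

lemma H2_restrict:
  assumes "E \<subseteq> D" "bdd_open D" "bdd_open E" "u \<in> H2 D" shows "u \<in> H2 E"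
proof -
  have u: "u \<in> H1 D" using assms(4) by (rule H2_H1)
  have "wd E i u \<in> H1 E" for i
  proof (rule H1_cong_AE[OF assms(3)])
    show "wd D i u \<in> H1 E" using H1_restrict[OF assms(1-3) H2_wd[OF assms(4)]] .
    show "AE x in lebesgue_on E. wd D i u x = wd E i u x"
      using wd_restrict[OF assms(1-3) u, of i] by eventually_elim simp
  qed (intro wd_works(1) H1_restrict[OF assms(1-3) u])
  then show ?thesis using H1_restrict[OF assms(1-3) u] by (simp add: H2_def)
qed

lemma hess_restrict:
  assumes "E \<subseteq> D" "bdd_open D" "bdd_open E" "u \<in> H2 D"
  shows "AE x in lebesgue_on E. hess E i j u x = hess D i j u x"
proof -
  have "hess E i j u = wd E i (wd D j u)"
    unfolding hess_def using assms(4)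
    by (intro wd_cong_AE[OF assms(3)] wd_restrict[OF assms(1-3)] H2_H1 H2_wd_L2 H2_restrict[OF assms(1-3)]
        L2_restrict[OF _ assms(1-3)])
  then show ?thesis using wd_restrict[OF assms(1-3) H2_wd[OF assms(4)]] by (simp add: hess_def)
qed

section \<open>Polynomials\<close>

lemma polys_lin:
  assumes "p \<in> polys m" "q \<in> polys m" shows "(\<lambda>x. c * p x + d * q x) \<in> polys m"
proof -
  obtain s t where "p = (\<lambda>x. \<Sum>i\<le>m. \<Sum>j\<le>m - i. s i j * (x $ 1) ^ i * (x $ 2) ^ j)"
    "q = (\<lambda>x. \<Sum>i\<le>m. \<Sum>j\<le>m - i. t i j * (x $ 1) ^ i * (x $ 2) ^ j)"
    using assms by (auto simp: polys_def)
  then have "(\<lambda>x. c * p x + d * q x) =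
      (\<lambda>x. \<Sum>i\<le>m. \<Sum>j\<le>m - i. (c * s i j + d * t i j) * (x $ 1) ^ i * (x $ 2) ^ j)"
    by (simp add: sum_distrib_left sum.distrib algebra_simps)
  then show ?thesis unfolding polys_def by (intro CollectI exI)
qed

text \<open>Normal form for polynomials of degree at most two: second derivatives can be read off
  from the coefficients, and affine functions become vectors with three entries.\<close>

definition quad :: "real \<Rightarrow> real \<Rightarrow> real \<Rightarrow> real \<Rightarrow> real \<Rightarrow> real \<Rightarrow> pt \<Rightarrow> real" where
  "quad c b1 b2 a11 a12 a22 x =
     c + b1 * x $ 1 + b2 * x $ 2 + a11 * (x $ 1)\<^sup>2 + a12 * x $ 1 * x $ 2 + a22 * (x $ 2)\<^sup>2"

lemma polys_0_iff: "p \<in> polys 0 \<longleftrightarrow> (\<exists>c. p = (\<lambda>_. c))"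
proof
  assume "\<exists>c. p = (\<lambda>_. c)"
  then obtain c where "p = (\<lambda>x :: pt. \<Sum>i\<le>0::nat. \<Sum>j\<le>0 - i. (\<lambda>i j. c) i j * (x $ 1) ^ i * (x $ 2) ^ j)"
    by auto
  then show "p \<in> polys 0" unfolding polys_def by (intro CollectI exI)
qed (auto simp: polys_def)

lemma polys_1_iff: "p \<in> polys 1 \<longleftrightarrow> (\<exists>c b1 b2. p = quad c b1 b2 0 0 0)"
proof
  assume "\<exists>c b1 b2. p = quad c b1 b2 0 0 0"
  then obtain c b1 b2 where "p = quad c b1 b2 0 0 0" by blast
  then have "p = (\<lambda>x. \<Sum>i\<le>1. \<Sum>j\<le>1 - i. (\<lambda>i j. if i = 0 then (if j = 0 then c else b2) else b1) i j
      * (x $ 1) ^ i * (x $ 2) ^ j)"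
    by (auto simp: quad_def)
  then show "p \<in> polys 1" unfolding polys_def by (intro CollectI exI)
next
  assume "p \<in> polys 1"
  then obtain t where "p = (\<lambda>x. \<Sum>i\<le>1. \<Sum>j\<le>1 - i. t i j * (x $ 1) ^ i * (x $ 2) ^ j)"
    by (auto simp: polys_def)
  then have "p = quad (t 0 0) (t 1 0) (t 0 1) 0 0 0" by (auto simp: quad_def)
  then show "\<exists>c b1 b2. p = quad c b1 b2 0 0 0" by blast
qed

lemma polys_2_iff: "p \<in> polys 2 \<longleftrightarrow> (\<exists>c b1 b2 a11 a12 a22. p = quad c b1 b2 a11 a12 a22)"
proof
  assume "\<exists>c b1 b2 a11 a12 a22. p = quad c b1 b2 a11 a12 a22"
  then obtain c b1 b2 a11 a12 a22 where "p = quad c b1 b2 a11 a12 a22" by blast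
  then have "p = (\<lambda>x. \<Sum>i\<le>2. \<Sum>j\<le>2 - i. (\<lambda>i j. if i = 0 then (if j = 0 then c else if j = 1 then b2 else a22)
      else if i = 1 then (if j = 0 then b1 else a12) else a11) i j * (x $ 1) ^ i * (x $ 2) ^ j)"
    by (auto simp: quad_def eval_nat_numeral)
  then show "p \<in> polys 2" unfolding polys_def by (intro CollectI exI)
next
  assume "p \<in> polys 2"
  then obtain t where "p = (\<lambda>x. \<Sum>i\<le>2. \<Sum>j\<le>2 - i. t i j * (x $ 1) ^ i * (x $ 2) ^ j)"
    by (auto simp: polys_def)
  then have "p = quad (t 0 0) (t 1 0) (t 0 1) (t 2 0) (t 1 1) (t 0 2)"
    by (auto simp: quad_def eval_nat_numeral)
  then show "\<exists>c b1 b2 a11 a12 a22. p = quad c b1 b2 a11 a12 a22" by blast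
qed

text \<open>Keeps the simplifier from rewriting \<open>polys 1\<close> to
  \<open>polys (Suc 0)\<close>, on which the lemmas about affine functions would no longer
  match.\<close>

declare One_nat_def [simp del]

lemma quad_in_polys_1: "quad c b1 b2 0 0 0 \<in> polys 1"
  and quad_in_polys_2: "quad c b1 b2 a11 a12 a22 \<in> polys 2"
  unfolding polys_1_iff polys_2_iff by blast+

lemma polys_1_subset_2: "polys 1 \<subseteq> polys 2" and polys_0_subset_2: "polys 0 \<subseteq> polys 2"
  and polys_0_subset_1: "polys 0 \<subseteq> polys 1"
proof -
  have "(\<lambda>_. c) = quad c 0 0 0 0 0" for c by (auto simp: quad_def)
  then show "polys 1 \<subseteq> polys 2" "polys 0 \<subseteq> polys 2" "polys 0 \<subseteq> polys 1"
    using quad_in_polys_1 quad_in_polys_2 by (auto simp: polys_0_iff polys_1_iff)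
qed

lemma polys_le_1: "m \<le> 1 \<Longrightarrow> polys m \<subseteq> polys 1" "m \<le> 1 \<Longrightarrow> polys m \<subseteq> polys 2"
proof -
  assume "m \<le> 1"
  then have "m = 0 \<or> m = 1" by linarith
  then show "polys m \<subseteq> polys 1" "polys m \<subseteq> polys 2"
    using polys_0_subset_1 polys_0_subset_2 polys_1_subset_2 by auto
qed

lemma smooth_fun_quad: "smooth_fun (quad c b1 b2 a11 a12 a22)"
  unfolding quad_def[abs_def] power2_eq_square
  by (intro smooth_fun_add smooth_fun_mult smooth_fun_const smooth_fun_coord)

lemma smooth_fun_polys: "p \<in> polys 2 \<Longrightarrow> smooth_fun p"
  by (auto simp: polys_2_iff smooth_fun_quad)

lemma pd_quad:
  "pd 1 (quad c b1 b2 a11 a12 a22) = quad b1 (2 * a11) a12 0 0 0"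
  "pd 2 (quad c b1 b2 a11 a12 a22) = quad b2 a12 (2 * a22) 0 0 0"
proof -
  have D: "(quad c b1 b2 a11 a12 a22 has_derivative (\<lambda>h. b1 * h $ 1 + b2 * h $ 2 + a11 * (2 * x $ 1 * h $ 1)
      + a12 * (x $ 1 * h $ 2 + h $ 1 * x $ 2) + a22 * (2 * x $ 2 * h $ 2))) (at x)" for x
    unfolding quad_def[abs_def]
    by (auto intro!: derivative_eq_intros bounded_linear.has_derivative[OF bounded_linear_vec_nth]
        simp: algebra_simps)
  show "pd 1 (quad c b1 b2 a11 a12 a22) = quad b1 (2 * a11) a12 0 0 0"
    "pd 2 (quad c b1 b2 a11 a12 a22) = quad b2 a12 (2 * a22) 0 0 0"
    by (rule ext, subst pd_eqI[OF D], simp add: axis_def quad_def algebra_simps)+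
qed

lemma pd_polys_2: "p \<in> polys 2 \<Longrightarrow> pd i p \<in> polys 1"
  using exhaust_2[of i] by (auto simp: polys_2_iff pd_quad intro: quad_in_polys_1)

lemma quad_zero_on_open:
  assumes "open D" "D \<noteq> {}" "\<And>x. x \<in> D \<Longrightarrow> quad c b1 b2 0 0 0 x = 0"
  shows "c = 0 \<and> b1 = 0 \<and> b2 = 0"
proof -
  obtain z where z: "z \<in> D" using assms by blast
  then obtain e where e: "0 < e" "cball z e \<subseteq> D" using assms(1) open_contains_cball by blast
  have "z + e *\<^sub>R axis i 1 \<in> D" for i :: 2
    using e by (auto simp: dist_norm norm_axis_1 intro!: subsetD[OF e(2)])
  then have "quad c b1 b2 0 0 0 (z + e *\<^sub>R axis i 1) = 0" for i :: 2 using assms(3) by blast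
  from this[of 1] this[of 2] assms(3)[OF z]
  have z0: "c + b1 * z $ 1 + b2 * z $ 2 = 0"
    and z12: "c + b1 * (z $ 1 + e) + b2 * z $ 2 = 0" "c + b1 * z $ 1 + b2 * (z $ 2 + e) = 0"
    by (auto simp: quad_def axis_def)
  have "b1 * e = 0" "b2 * e = 0"
    using z0 z12 unfolding distrib_left by linarith+
  with e(1) z0 show ?thesis by simp
qed

lemma AE_zero_continuous:
  fixes u :: "pt \<Rightarrow> real"
  assumes D: "open D" and u: "continuous_on UNIV u" and ae: "AE x in lebesgue_on D. u x = 0" and x: "x \<in> D"
  shows "u x = 0"
proof (rule ccontr)
  assume "u x \<noteq> 0"
  have "AE x in lebesgue. x \<in> D \<longrightarrow> u x = 0"
    using ae D by (subst (asm) AE_restrict_space_iff) auto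
  then have "negligible (D \<inter> {x. u x \<noteq> 0})"
    unfolding eventually_ae_filter_negligible by (auto elim!: negligible_subset)
  moreover have "open (D \<inter> {x. u x \<noteq> 0})"
    using D u by (intro open_Int open_Collect_neq) auto
  ultimately show False using open_not_negligible \<open>u x \<noteq> 0\<close> x by blast
qed

section \<open>Nondegenerate forms on affine functions\<close>

lemma polys_1_lin_expand:
  assumes lin: "\<And>c d p q. p \<in> polys 1 \<Longrightarrow> q \<in> polys 1 \<Longrightarrow> l (\<lambda>x. c * p x + d * q x) = c * l p + d * l q"
  shows "l (quad c b1 b2 0 0 0)
    = c * l (quad 1 0 0 0 0 0) + b1 * l (quad 0 1 0 0 0 0) + b2 * (l (quad 0 0 1 0 0 0) :: real)"
proof -
  have "quad c b1 b2 0 0 0 = (\<lambda>x. 1 * quad c b1 0 0 0 0 x + b2 * quad 0 0 1 0 0 0 x)"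
    "quad c b1 0 0 0 0 = (\<lambda>x. c * quad 1 0 0 0 0 0 x + b1 * quad 0 1 0 0 0 0 x)"
    by (auto simp: quad_def)
  then show ?thesis
    using lin[OF quad_in_polys_1 quad_in_polys_1, of 1 c b1 0 b2 0 0 1]
      lin[OF quad_in_polys_1 quad_in_polys_1, of c 1 0 0 b1 0 1 0] by simp
qed

text \<open>The Gram map of the form on coefficient vectors is injective, hence surjective.\<close>
lemma polys_1_representation:
  assumes lin1: "\<And>c d p q r. p \<in> polys 1 \<Longrightarrow> q \<in> polys 1 \<Longrightarrow> r \<in> polys 1 \<Longrightarrow>
      b (\<lambda>x. c * p x + d * q x) r = c * b p r + d * b q r"
    and sym: "\<And>p q. p \<in> polys 1 \<Longrightarrow> q \<in> polys 1 \<Longrightarrow> b p q = (b q p :: real)"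
    and def: "\<And>p. p \<in> polys 1 \<Longrightarrow> b p p = 0 \<Longrightarrow> p = (\<lambda>_. 0)"
    and linl: "\<And>c d p q. p \<in> polys 1 \<Longrightarrow> q \<in> polys 1 \<Longrightarrow> l (\<lambda>x. c * p x + d * q x) = c * l p + d * l q"
  shows "\<exists>p\<in>polys 1. \<forall>q\<in>polys 1. b p q = l q"
proof -
  define A :: "real^3 \<Rightarrow> pt \<Rightarrow> real" where "A w = quad (w $ 1) (w $ 2) (w $ 3) 0 0 0" for w
  define e :: "3 \<Rightarrow> pt \<Rightarrow> real" where
    "e k = (if k = 1 then quad 1 0 0 0 0 0 else if k = 2 then quad 0 1 0 0 0 0 else quad 0 0 1 0 0 0)" for k
  define G :: "real^3 \<Rightarrow> real^3" where "G w = (\<chi> k. b (A w) (e k))" for w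
  have A: "A w \<in> polys 1" for w by (simp add: A_def quad_in_polys_1)
  have e: "e k \<in> polys 1" for k by (simp add: e_def quad_in_polys_1)
  have Alin: "A (c *\<^sub>R v + d *\<^sub>R w) = (\<lambda>x. c * A v x + d * A w x)" for c d v w
    by (auto simp: A_def quad_def algebra_simps)
  have expand: "m q = (\<Sum>k\<in>UNIV. w $ k * m (e k))"
    if "\<And>c d p q. p \<in> polys 1 \<Longrightarrow> q \<in> polys 1 \<Longrightarrow> m (\<lambda>x. c * p x + d * q x) = c * m p + d * (m q :: real)"
      and "q = A w" for m q w
  proof -
    have "m (quad (w $ 1) (w $ 2) (w $ 3) 0 0 0)
        = w $ 1 * m (e 1) + w $ 2 * m (e 2) + w $ 3 * m (e 3)"
      unfolding e_def by (subst polys_1_lin_expand[of m]) (auto simp: that(1))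
    then show ?thesis unfolding that(2) A_def sum_3 .
  qed
  have lin2: "b r (\<lambda>x. c * p x + d * q x) = c * b r p + d * b r q"
    if "p \<in> polys 1" "q \<in> polys 1" "r \<in> polys 1" for c d p q r
    using that lin1[OF that] sym[OF that(3)] polys_lin[OF that(1,2)] by simp
  have G: "linear G"
  proof (rule linearI)
    show "G (v + w) = G v + G w" for v w
      using Alin[of 1 v 1 w] lin1[OF A[of v] A[of w] e, of 1 1] by (simp add: G_def vec_eq_iff)
    show "G (c *\<^sub>R w) = c *\<^sub>R G w" for c w
      using Alin[of c w 0 w] lin1[OF A[of w] A[of w] e, of c 0] by (simp add: G_def vec_eq_iff)
  qed
  have "inj G"
    unfolding linear_injective_0[OF G]
  proof (intro allI impI)
    fix w assume "G w = 0"
    then have "b (A w) (e k) = 0" for k by (simp add: G_def vec_eq_iff)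
    then have "b (A w) (A w) = 0" using expand[of "b (A w)" "A w" w] lin2[OF _ _ A] by simp
    then have "A w = (\<lambda>_. 0)" by (intro def A)
    then have "quad (w $ 1) (w $ 2) (w $ 3) 0 0 0 x = 0" for x by (metis A_def)
    then show "w = 0" using quad_zero_on_open[of UNIV "w $ 1" "w $ 2" "w $ 3"] by (simp add: vec_eq_iff forall_3)
  qed
  then have "surj G" using linear_injective_imp_surjective[OF G] by simp
  then obtain w where w: "G w = (\<chi> k. l (e k))" using surjD[of G] by metis
  have "b (A w) q = l q" if q: "q \<in> polys 1" for q
  proof -
    obtain c b1 b2 where "q = quad c b1 b2 0 0 0" using q polys_1_iff by blast
    then have "q = A (vector [c, b1, b2])" by (simp add: A_def)
    then have "b (A w) q = (\<Sum>k\<in>UNIV. (vector [c, b1, b2] :: real^3) $ k * b (A w) (e k))"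
      by (rule expand[rotated]) (rule lin2[OF _ _ A])
    moreover have "l q = (\<Sum>k\<in>UNIV. (vector [c, b1, b2] :: real^3) $ k * l (e k))"
      by (rule expand[rotated]) (fact \<open>q = A (vector [c, b1, b2])\<close>, rule linl)
    moreover have "b (A w) (e k) = l (e k)" for k using w by (simp add: G_def vec_eq_iff)
    ultimately show ?thesis by simp
  qed
  then show ?thesis using A by blast
qed

section \<open>The projections onto polynomials\<close>

lemma polys_L2: "bdd_open D \<Longrightarrow> p \<in> polys 2 \<Longrightarrow> p \<in> L2 D"
  by (simp add: L2_smooth smooth_fun_polys)

text \<open>The property by which \<open>L2proj\<close> selects. Linearity and uniqueness are proved
  for this relation and transferred to the selected function by \<open>theI'\<close>;
  \<open>is_PiD\<close> serves \<open>PiD\<close> in the same way.\<close>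

definition is_L2proj :: "pt set \<Rightarrow> nat \<Rightarrow> (pt \<Rightarrow> real) \<Rightarrow> (pt \<Rightarrow> real) \<Rightarrow> bool" where
  "is_L2proj D m u p \<longleftrightarrow> p \<in> polys m \<and> (\<forall>q\<in>polys m. (LINT x|lebesgue_on D. (p x - u x) * q x) = 0)"

lemma polys_1_L2_definite:
  assumes D: "bdd_open D" "D \<noteq> {}" and p: "p \<in> polys 1" and z: "(LINT x|lebesgue_on D. p x * p x) = 0"
  shows "p = (\<lambda>_. 0)"
proof -
  have p2: "p \<in> polys 2" using p polys_1_subset_2 by blast
  have "AE x in lebesgue_on D. p x * p x = 0"
    using z L2_mult_integrable[OF polys_L2[OF D(1) p2] polys_L2[OF D(1) p2]]
    by (subst (asm) integral_nonneg_eq_0_iff_AE) auto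
  then have ae: "AE x in lebesgue_on D. p x = 0" by eventually_elim simp
  obtain c b1 b2 where q: "p = quad c b1 b2 0 0 0" using p polys_1_iff by blast
  have "p x = 0" if "x \<in> D" for x
    using AE_zero_continuous[OF _ smooth_fun_continuous_on[OF smooth_fun_polys[OF p2]] ae that] D
    by (simp add: bdd_open_def)
  then have "c = 0 \<and> b1 = 0 \<and> b2 = 0"
    using quad_zero_on_open[of D c b1 b2] q D by (auto simp: bdd_open_def)
  then show ?thesis by (auto simp: q quad_def)
qed

lemma is_L2proj_lin:
  assumes D: "bdd_open D" and m: "m \<le> 1" and L: "u \<in> L2 D" "v \<in> L2 D" and p: "is_L2proj D m u p" "is_L2proj D m v q"
  shows "is_L2proj D m (\<lambda>x. c * u x + d * v x) (\<lambda>x. c * p x + d * q x)"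
proof -
  have m2: "polys m \<subseteq> polys 2" using m by (rule polys_le_1)
  then have pq: "p \<in> L2 D" "q \<in> L2 D"
    using p polys_L2[OF D] unfolding is_L2proj_def by blast+
  have L2: "(\<lambda>x. p x - u x) \<in> L2 D" "(\<lambda>x. q x - v x) \<in> L2 D"
    using L2_lin[OF pq(1) L(1), of 1 "-1"] L2_lin[OF pq(2) L(2), of 1 "-1"] by simp_all
  have "(\<lambda>x. c * p x + d * q x) \<in> polys m"
    using p polys_lin unfolding is_L2proj_def by blast
  moreover have "(LINT x|lebesgue_on D. (c * p x + d * q x - (c * u x + d * v x)) * r x) = 0" if r: "r \<in> polys m" for r
  proof -
    have "(\<lambda>x. (c * p x + d * q x - (c * u x + d * v x)) * r x) = (\<lambda>x. (c * (p x - u x) + d * (q x - v x)) * r x)"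
      by (simp add: algebra_simps)
    then show ?thesis
      using L2_integral_lin[OF L2, of r c d] r p m2 polys_L2[OF D] unfolding is_L2proj_def by auto
  qed
  ultimately show ?thesis by (simp add: is_L2proj_def)
qed

lemma is_L2proj_unique:
  assumes D: "bdd_open D" "D \<noteq> {}" and m: "m \<le> 1" and L: "u \<in> L2 D" and p: "is_L2proj D m u p" "is_L2proj D m u q"
  shows "p = q"
proof -
  \<comment> \<open>By linearity p - q is a projection of u - u; testing it with itself gives a
    vanishing L2 norm.\<close>
  have "is_L2proj D m (\<lambda>x. 1 * u x + (-1) * u x) (\<lambda>x. 1 * p x + (-1) * q x)"
    by (intro is_L2proj_lin D m L p)
  then have r: "(\<lambda>x. p x - q x) \<in> polys m" "(LINT x|lebesgue_on D. (p x - q x) * (p x - q x)) = 0"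
    unfolding is_L2proj_def by auto
  have "polys m \<subseteq> polys 1" using m by (rule polys_le_1)
  then have "(\<lambda>x. p x - q x) = (\<lambda>_. 0)"
    using polys_1_L2_definite[OF D, of "\<lambda>x. p x - q x"] r by blast
  then show ?thesis by (simp add: fun_eq_iff)
qed

lemma is_L2proj_exists:
  assumes D: "bdd_open D" "D \<noteq> {}" and m: "m \<le> 1" and L: "u \<in> L2 D"
  shows "\<exists>p. is_L2proj D m u p"
proof (cases m)
  case 0
  have fin: "finite_measure (lebesgue_on D)" by (intro finite_measure_lebesgue_on bdd_open_lmeasurable D)
  have i: "integrable (lebesgue_on D) u" by (intro L2_integrable D L)
  let ?K = "measure (lebesgue_on D) (space (lebesgue_on D))"
  \<comment> \<open>If the measure were zero, the constant 1 would have vanishing L2 norm, against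
    \<open>polys_1_L2_definite\<close>. The projection of degree 0 is then the mean value.\<close>
  have K: "?K \<noteq> 0"
  proof
    assume K0: "?K = 0"
    have "(LINT x|lebesgue_on D. (quad 1 0 0 0 0 0 x) * quad 1 0 0 0 0 0 x) = 0"
      using K0 by (simp add: quad_def)
    then have "quad 1 0 0 0 0 0 = (\<lambda>_. 0)"
      by (intro polys_1_L2_definite[OF D] quad_in_polys_1)
    then show False by (auto simp: quad_def fun_eq_iff)
  qed
  let ?c = "(LINT x|lebesgue_on D. u x) / ?K"
  have "(LINT x|lebesgue_on D. (?c - u x) * r x) = 0" if "r \<in> polys 0" for r
  proof -
    obtain d where r: "r = (\<lambda>_. d)" using \<open>r \<in> polys 0\<close> polys_0_iff by blast
    have "(LINT x|lebesgue_on D. (?c - u x) * r x) = (LINT x|lebesgue_on D. ?c - u x) * d"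
      using i finite_measure.integrable_const[OF fin] by (simp add: r)
    also have "(LINT x|lebesgue_on D. ?c - u x) = 0"
      using Bochner_Integration.integral_diff[OF finite_measure.integrable_const[OF fin] i, of ?c] K
      by simp
    finally show ?thesis by simp
  qed
  then have "is_L2proj D 0 u (\<lambda>_. ?c)" by (auto simp: is_L2proj_def polys_0_iff)
  then show ?thesis using 0 by blast
next
  case (Suc n)
  then have m1: "m = 1" using m by linarith
  have P: "p \<in> L2 D" if "p \<in> polys 1" for p using that polys_L2[OF D(1)] polys_1_subset_2 by blast
  \<comment> \<open>Representation for the L2 inner product on affine functions and the functional
    that tests with \<open>u\<close>.\<close>
  have "\<exists>p\<in>polys 1. \<forall>q\<in>polys 1. (LINT x|lebesgue_on D. p x * q x) = (LINT x|lebesgue_on D. u x * q x)"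
  proof (rule polys_1_representation)
    show "(LINT x|lebesgue_on D. u x * (c * p x + d * q x))
        = c * (LINT x|lebesgue_on D. u x * p x) + d * (LINT x|lebesgue_on D. u x * q x)"
      if "p \<in> polys 1" "q \<in> polys 1" for c d p q
      using L2_integral_lin[OF P[OF that(1)] P[OF that(2)] L, of c d] by (simp add: mult.commute)
  qed (use polys_1_L2_definite[OF D] L2_integral_lin P in \<open>auto simp: mult.commute\<close>)
  then obtain p where p: "p \<in> polys 1"
    "\<And>q. q \<in> polys 1 \<Longrightarrow> (LINT x|lebesgue_on D. p x * q x) = (LINT x|lebesgue_on D. u x * q x)" by blast
  have "(LINT x|lebesgue_on D. (p x - u x) * q x) = 0" if "q \<in> polys 1" for q
    using L2_integral_lin[OF P[OF p(1)] L P[OF that], of 1 "-1"] p(2)[OF that] by simp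
  then show ?thesis using p(1) m1 by (auto simp: is_L2proj_def)
qed

lemma L2proj_works:
  assumes D: "bdd_open D" "D \<noteq> {}" and m: "m \<le> 1" and L: "u \<in> L2 D"
  shows "is_L2proj D m u (L2proj D m u)"
proof -
  have "\<exists>!p. is_L2proj D m u p"
    using is_L2proj_exists[OF assms] is_L2proj_unique[OF assms] by blast
  from theI'[OF this] show ?thesis
    unfolding L2proj_def is_L2proj_def .
qed

lemma L2proj_cong_AE:
  assumes D: "bdd_open D" and L: "u \<in> L2 D" "v \<in> L2 D" and m: "m \<le> 1"
    and ae: "AE x in lebesgue_on D. u x = v x"
  shows "L2proj D m u = L2proj D m v"
proof -
  have m2: "polys m \<subseteq> polys 2" using m by (rule polys_le_1)
  have "(LINT x|lebesgue_on D. (p x - u x) * q x) = (LINT x|lebesgue_on D. (p x - v x) * q x)"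
    if "p \<in> polys m" "q \<in> polys m" for p q
  proof (rule integral_mult_cong_AE)
    show "AE x in lebesgue_on D. p x - u x = p x - v x" using ae by eventually_elim simp
    have P: "p \<in> L2 D" using that m2 polys_L2[OF D] by blast
    show "(\<lambda>x. p x - u x) \<in> L2 D" "(\<lambda>x. p x - v x) \<in> L2 D"
      using L2_lin[OF P L(1), of 1 "-1"] L2_lin[OF P L(2), of 1 "-1"] by simp_all
    show "q \<in> L2 D" using that m2 polys_L2[OF D] by blast
  qed
  then have "is_L2proj D m u = is_L2proj D m v" by (auto simp: is_L2proj_def fun_eq_iff)
  then show ?thesis unfolding L2proj_def is_L2proj_def[symmetric] by simp
qed

text \<open>The combination is asked for only almost everywhere because \<open>lap\<close>,
  \<open>curl\<close> and \<open>grad\<close> of a combination are known no better.\<close>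

lemma L2proj_lin:
  assumes D: "bdd_open D" "D \<noteq> {}" and m: "m \<le> 1" and L: "u \<in> L2 D" "v \<in> L2 D"
    and w: "w \<in> L2 D" "AE x in lebesgue_on D. w x = c * u x + d * v x"
  shows "L2proj D m w = (\<lambda>x. c * L2proj D m u x + d * L2proj D m v x)"
proof -
  have "L2proj D m w = L2proj D m (\<lambda>x. c * u x + d * v x)"
    by (intro L2proj_cong_AE D w L2_lin L m)
  then show ?thesis
    using is_L2proj_unique[OF D m L2_lin[OF L] L2proj_works[OF D m L2_lin[OF L]]
        is_L2proj_lin[OF D(1) m L L2proj_works[OF D m L(1)] L2proj_works[OF D m L(2)]]] by simp
qed

lemma L2proj_polys_2: "bdd_open D \<Longrightarrow> D \<noteq> {} \<Longrightarrow> m \<le> 1 \<Longrightarrow> u \<in> L2 D \<Longrightarrow> L2proj D m u \<in> polys 2"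
  using L2proj_works[of D m u] polys_le_1(2)[of m] by (auto simp: is_L2proj_def)

section \<open>Element regions and the projection onto quadratic polynomials\<close>

lemma finite_edges: "finite (edges P)"
  by (simp add: edges_def)

lemma edges_vertices: "(a, b) \<in> edges P \<Longrightarrow> a \<in> set P \<and> b \<in> set P"
  unfolding edges_def by (auto dest: set_zip_leftD set_zip_rightD)

lemma compact_boundary: "compact (\<Union>(a,b)\<in>edges P. closed_segment a b)"
  by (intro compact_UN finite_edges) auto

lemma bdd_open_region: "bdd_open (region P)"
  unfolding bdd_open_def region_def
  using compact_boundary[of P] by (simp add: open_inside bounded_inside compact_imp_closed compact_imp_bounded)

text \<open>The zero set of an affine function is convex, so it contains every edge once it contains
  the vertices. The complement of a convex set containing the boundary lies outside, hence the zero
  set contains the region; being open and nonempty, the region forces all coefficients to vanish.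
  This makes the vertex sum definite on affine functions.\<close>

lemma polys_1_zero_on_vertices:
  assumes ne: "region P \<noteq> {}" and p: "p \<in> polys 1" and z: "\<And>v. v \<in> set P \<Longrightarrow> p v = 0"
  shows "p = (\<lambda>_. 0)"
proof -
  obtain c b1 b2 where q: "p = quad c b1 b2 0 0 0" using p polys_1_iff by blast
  define L where "L = {x :: pt. vector [b1, b2] \<bullet> x = - c}"
  have L: "x \<in> L \<longleftrightarrow> p x = 0" for x
    unfolding L_def q quad_def by (auto simp: inner_vec_def sum_2)
  have "convex L" unfolding L_def by (rule convex_hyperplane)
  have "closed_segment a b \<subseteq> L" if "(a, b) \<in> edges P" for a b
    using edges_vertices[OF that] z L by (intro closed_segment_subset \<open>convex L\<close>) auto
  then have sub: "(\<Union>(a,b)\<in>edges P. closed_segment a b) \<subseteq> L" by fast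
  have "region P \<subseteq> L"
    using outside_subset_convex[OF \<open>convex L\<close> sub] inside_Int_outside[of "\<Union>(a,b)\<in>edges P. closed_segment a b"]
    unfolding region_def by blast
  then have "quad c b1 b2 0 0 0 x = 0" if "x \<in> region P" for x using that L q by auto
  then have "c = 0 \<and> b1 = 0 \<and> b2 = 0"
    using quad_zero_on_open[of "region P" c b1 b2] ne bdd_open_region by (auto simp: bdd_open_def)
  then show ?thesis by (auto simp: q quad_def)
qed

lemma hess_quad:
  assumes "bdd_open D"
  shows "AE x in lebesgue_on D. hess D 1 1 (quad c b1 b2 a11 a12 a22) x = 2 * a11"
    "AE x in lebesgue_on D. hess D 1 2 (quad c b1 b2 a11 a12 a22) x = a12"
    "AE x in lebesgue_on D. hess D 2 1 (quad c b1 b2 a11 a12 a22) x = a12"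
    "AE x in lebesgue_on D. hess D 2 2 (quad c b1 b2 a11 a12 a22) x = 2 * a22"
  using hess_smooth[OF assms smooth_fun_quad[of c b1 b2 a11 a12 a22], of 1 1]
    hess_smooth[OF assms smooth_fun_quad[of c b1 b2 a11 a12 a22], of 1 2]
    hess_smooth[OF assms smooth_fun_quad[of c b1 b2 a11 a12 a22], of 2 1]
    hess_smooth[OF assms smooth_fun_quad[of c b1 b2 a11 a12 a22], of 2 2]
  by (simp_all add: pd_quad quad_def)

lemma polys_2_H2: "bdd_open D \<Longrightarrow> p \<in> polys 2 \<Longrightarrow> p \<in> H2 D"
  by (simp add: H2_smooth smooth_fun_polys)

text \<open>The Hessian of a quadratic polynomial is constant and leaves the integral, so the form
  sees only the means of the second derivatives of \<open>u\<close>. The quadratic part of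
  \<open>PiD\<close> is determined by these means.\<close>

lemma hess_form_quad:
  assumes D: "bdd_open D" and u: "u \<in> H2 D"
  shows "hess_form D u (quad c b1 b2 a11 a12 a22) =
     2 * a11 * (LINT x|lebesgue_on D. hess D 1 1 u x)
     + a12 * ((LINT x|lebesgue_on D. hess D 1 2 u x) + (LINT x|lebesgue_on D. hess D 2 1 u x))
     + 2 * a22 * (LINT x|lebesgue_on D. hess D 2 2 u x)"
proof -
  let ?q = "quad c b1 b2 a11 a12 a22"
  have q: "?q \<in> H2 D" by (intro polys_2_H2 D quad_in_polys_2)
  have "(LINT x|lebesgue_on D. hess D i j u x * hess D i j ?q x) = k * (LINT x|lebesgue_on D. hess D i j u x)"
    if "AE x in lebesgue_on D. hess D i j ?q x = k" for i j k
    using integral_mult_cong_AE[OF that H2_hess_L2[OF q] L2_smooth[OF D smooth_fun_const] H2_hess_L2[OF u, of i j]]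
    by (simp add: mult.commute)
  note this[OF hess_quad(1)[OF D]] this[OF hess_quad(2)[OF D]] this[OF hess_quad(3)[OF D]] this[OF hess_quad(4)[OF D]]
  then show ?thesis
    unfolding hess_form_eq[OF u q] sum_2 by (simp add: algebra_simps)
qed

lemma integral_hess_quad:
  assumes D: "bdd_open D"
  shows "(LINT x|lebesgue_on D. hess D 1 1 (quad c b1 b2 a11 a12 a22) x) = 2 * a11 * measure lebesgue D"
    "(LINT x|lebesgue_on D. hess D 1 2 (quad c b1 b2 a11 a12 a22) x) = a12 * measure lebesgue D"
    "(LINT x|lebesgue_on D. hess D 2 1 (quad c b1 b2 a11 a12 a22) x) = a12 * measure lebesgue D"
    "(LINT x|lebesgue_on D. hess D 2 2 (quad c b1 b2 a11 a12 a22) x) = 2 * a22 * measure lebesgue D"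
proof -
  let ?q = "quad c b1 b2 a11 a12 a22"
  let ?M = "lebesgue_on D"
  have q: "?q \<in> H2 D" by (intro polys_2_H2 D quad_in_polys_2)
  have "(LINT x|?M. hess D i j ?q x) = k * measure lebesgue D"
    if "AE x in ?M. hess D i j ?q x = k" for i j k
  proof -
    have "(LINT x|?M. hess D i j ?q x) = (LINT x|?M. k)"
      using that L2_measurable[OF H2_hess_L2[OF q]] by (intro integral_cong_AE) auto
    then show ?thesis using bdd_open_sets[OF D] by (simp add: measure_restrict_space)
  qed
  note this[OF hess_quad(1)[OF D]] this[OF hess_quad(2)[OF D]] this[OF hess_quad(3)[OF D]] this[OF hess_quad(4)[OF D]]
  then show "(LINT x|?M. hess D 1 1 ?q x) = 2 * a11 * measure lebesgue D"
    "(LINT x|?M. hess D 1 2 ?q x) = a12 * measure lebesgue D"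
    "(LINT x|?M. hess D 2 1 ?q x) = a12 * measure lebesgue D"
    "(LINT x|?M. hess D 2 2 ?q x) = 2 * a22 * measure lebesgue D" by auto
qed

lemma measure_open_pos:
  assumes "bdd_open D" "D \<noteq> {}" shows "0 < measure lebesgue D"
  using assms open_not_negligible[of D] negligible_iff_measure0[OF bdd_open_lmeasurable[OF assms(1)]]
  by (auto simp: bdd_open_def zero_less_measure_iff)

definition is_PiD :: "polygon \<Rightarrow> (pt \<Rightarrow> real) \<Rightarrow> (pt \<Rightarrow> real) \<Rightarrow> bool" where
  "is_PiD P u p \<longleftrightarrow> p \<in> polys 2 \<and>
      (\<forall>r\<in>polys 2. hess_form (region P) p r = hess_form (region P) u r) \<and>
      (\<forall>r\<in>polys 1. (\<Sum>v\<in>set P. p v * r v) = (\<Sum>v\<in>set P. u v * r v))"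

lemma sum_mult_lin:
  "(\<Sum>w\<in>A. (c * s w + d * t w) * r w) = c * (\<Sum>w\<in>A. s w * r w) + d * (\<Sum>w\<in>A. t w * r w :: real)"
  by (simp add: sum_distrib_left sum.distrib algebra_simps)

lemma is_PiD_lin:
  assumes u: "u \<in> H2 (region P)" "v \<in> H2 (region P)" and p: "is_PiD P u p" "is_PiD P v q"
  shows "is_PiD P (\<lambda>x. c * u x + d * v x) (\<lambda>x. c * p x + d * q x)"
proof -
  note D = bdd_open_region[of P]
  have pq: "p \<in> polys 2" "q \<in> polys 2" using p by (auto simp: is_PiD_def)
  have "hess_form (region P) (\<lambda>x. c * p x + d * q x) r = hess_form (region P) (\<lambda>x. c * u x + d * v x) r"
    if r: "r \<in> polys 2" for r
    using p r hess_form_lin[OF D u polys_2_H2[OF D r]]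
      hess_form_lin[OF D polys_2_H2[OF D pq(1)] polys_2_H2[OF D pq(2)] polys_2_H2[OF D r]]
    by (simp add: is_PiD_def)
  moreover have "(\<Sum>w\<in>set P. (c * p w + d * q w) * r w) = (\<Sum>w\<in>set P. (c * u w + d * v w) * r w)"
    if r: "r \<in> polys 1" for r
    using p r by (simp add: is_PiD_def sum_mult_lin)
  ultimately show ?thesis using polys_lin[OF pq] by (simp add: is_PiD_def)
qed

text \<open>The difference r is a projection of zero. Its Hessian energy is the measure times a
  positive definite expression in the quadratic coefficients, so r is affine; tested with itself at
  the vertices it vanishes there, hence everywhere.\<close>

lemma is_PiD_unique:
  assumes ne: "region P \<noteq> {}" and u: "u \<in> H2 (region P)" and p: "is_PiD P u p" "is_PiD P u q"
  shows "p = q"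
proof -
  note D = bdd_open_region[of P]
  let ?D = "region P"
  define r where "r = (\<lambda>x. 1 * p x + (-1) * q x)"
  have r0: "is_PiD P (\<lambda>x. 1 * u x + (-1) * u x) r"
    unfolding r_def by (intro is_PiD_lin u p)
  have r2: "r \<in> polys 2" using r0 by (simp add: is_PiD_def)
  then obtain c b1 b2 a11 a12 a22 where rq: "r = quad c b1 b2 a11 a12 a22" using polys_2_iff by blast
  have "hess_form ?D r r = hess_form ?D (\<lambda>x. 1 * u x + (-1) * u x) r"
    using r0 r2 by (simp only: is_PiD_def)
  also have "\<dots> = 0"
    unfolding hess_form_lin[OF D u u polys_2_H2[OF D r2]] by simp
  finally have "2 * a11 * (2 * a11 * measure lebesgue ?D)
     + a12 * (a12 * measure lebesgue ?D + a12 * measure lebesgue ?D)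
     + 2 * a22 * (2 * a22 * measure lebesgue ?D) = 0"
    using hess_form_quad[OF D polys_2_H2[OF D r2], of c b1 b2 a11 a12 a22]
    unfolding rq integral_hess_quad[OF D] by simp
  then have "measure lebesgue ?D * (4 * a11\<^sup>2 + 2 * a12\<^sup>2 + 4 * a22\<^sup>2) = 0"
    by (simp add: algebra_simps power2_eq_square)
  then have "4 * a11\<^sup>2 + 2 * a12\<^sup>2 + 4 * a22\<^sup>2 = 0" using measure_open_pos[OF D ne] by simp
  then have "a11\<^sup>2 = 0 \<and> a12\<^sup>2 = 0 \<and> a22\<^sup>2 = 0"
    using zero_le_power2[of a11] zero_le_power2[of a12] zero_le_power2[of a22] by linarith
  then have r1: "r \<in> polys 1" by (simp add: rq quad_in_polys_1)
  then have "(\<Sum>v\<in>set P. r v * r v) = 0" using r0 by (simp add: is_PiD_def)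
  then have "r v = 0" if "v \<in> set P" for v
    using that by (simp add: sum_nonneg_eq_0_iff)
  then have "r = (\<lambda>_. 0)" by (rule polys_1_zero_on_vertices[OF ne r1])
  then show ?thesis by (simp add: r_def fun_eq_iff)
qed

lemma is_PiD_exists:
  assumes ne: "region P \<noteq> {}" and u: "u \<in> H2 (region P)"
  shows "\<exists>p. is_PiD P u p"
proof -
  note D = bdd_open_region[of P]
  let ?D = "region P"
  let ?K = "measure lebesgue ?D"
  let ?I = "\<lambda>i j. (LINT x|lebesgue_on ?D. hess ?D i j u x)"
  have K: "?K \<noteq> 0" using measure_open_pos[OF D ne] by simp
  \<comment> \<open>Comparison of \<open>hess_form_quad\<close> with
    \<open>integral_hess_quad\<close> dictates these coefficients; the mixed one takes the average
    of the two mixed means.\<close>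
  define q where "q = quad 0 0 0 (?I 1 1 / (2 * ?K)) ((?I 1 2 + ?I 2 1) / (2 * ?K)) (?I 2 2 / (2 * ?K))"
  \<comment> \<open>An affine correction leaves the Hessian of \<open>q\<close> alone and is free to
    match the vertex conditions. Definiteness of the vertex sum supplies it by
    \<open>polys_1_representation\<close>.\<close>
  have "\<exists>l\<in>polys 1. \<forall>r\<in>polys 1. (\<Sum>v\<in>set P. l v * r v) = (\<Sum>v\<in>set P. (u v - q v) * r v)"
  proof (rule polys_1_representation)
    show "p = (\<lambda>_. 0)" if "p \<in> polys 1" "(\<Sum>v\<in>set P. p v * p v) = 0" for p
      using that(2) by (intro polys_1_zero_on_vertices[OF ne that(1)]) (simp add: sum_nonneg_eq_0_iff)
  qed (use sum_mult_lin[where A="set P"] in \<open>simp_all add: mult.commute\<close>)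
  then obtain l where l: "l \<in> polys 1"
    "\<And>r. r \<in> polys 1 \<Longrightarrow> (\<Sum>v\<in>set P. l v * r v) = (\<Sum>v\<in>set P. (u v - q v) * r v)" by blast
  obtain c b1 b2 where lq: "l = quad c b1 b2 0 0 0" using l(1) polys_1_iff by blast
  define p where "p = quad c b1 b2 (?I 1 1 / (2 * ?K)) ((?I 1 2 + ?I 2 1) / (2 * ?K)) (?I 2 2 / (2 * ?K))"
  have plq: "p x = l x + q x" for x by (simp add: p_def q_def lq quad_def)
  have p2: "p \<in> polys 2" by (simp add: p_def quad_in_polys_2)
  have "hess_form ?D p r = hess_form ?D u r" if r: "r \<in> polys 2" for r
  proof -
    obtain c' b1' b2' a11 a12 a22 where rq: "r = quad c' b1' b2' a11 a12 a22" using r polys_2_iff by blast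
    show ?thesis
      unfolding rq hess_form_quad[OF D polys_2_H2[OF D p2]] hess_form_quad[OF D u]
      unfolding p_def integral_hess_quad[OF D] using K by (simp add: field_simps)
  qed
  moreover have "(\<Sum>v\<in>set P. p v * r v) = (\<Sum>v\<in>set P. u v * r v)" if r: "r \<in> polys 1" for r
    using l(2)[OF r] by (simp add: plq algebra_simps sum.distrib sum_subtractf)
  ultimately show ?thesis using p2 by (auto simp: is_PiD_def)
qed

lemma PiD_works:
  assumes "region P \<noteq> {}" "u \<in> H2 (region P)" shows "is_PiD P u (PiD P u)"
proof -
  have "\<exists>!p. is_PiD P u p" using is_PiD_exists[OF assms] is_PiD_unique[OF assms] by blast
  from theI'[OF this] show ?thesis unfolding PiD_def is_PiD_def .
qed

lemma PiD_eqI: "region P \<noteq> {} \<Longrightarrow> u \<in> H2 (region P) \<Longrightarrow> is_PiD P u p \<Longrightarrow> PiD P u = p"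
  using is_PiD_unique PiD_works by blast

lemma PiD_lin:
  assumes "region P \<noteq> {}" "u \<in> H2 (region P)" "v \<in> H2 (region P)"
  shows "PiD P (\<lambda>x. c * u x + d * v x) = (\<lambda>x. c * PiD P u x + d * PiD P v x)"
  using assms by (intro PiD_eqI H2_lin is_PiD_lin PiD_works bdd_open_region)

lemma PiD_polys: "region P \<noteq> {} \<Longrightarrow> p \<in> polys 2 \<Longrightarrow> PiD P p = p"
  by (intro PiD_eqI) (auto simp: is_PiD_def polys_2_H2 bdd_open_region)

section \<open>Traces\<close>

lemma sqint_edge_continuous:
  assumes "continuous_on UNIV u" shows "sqint (lebesgue_on {0..1}) (\<lambda>t. u (linepath a b t))"
proof -
  have c: "continuous_on {0..1} (\<lambda>t. u (linepath a b t))"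
    using continuous_on_compose2[OF assms continuous_on_linepath] by simp
  then have "compact ((\<lambda>t. u (linepath a b t)) ` {0..1})" by (intro compact_continuous_image) auto
  then obtain B where "\<And>t. t \<in> {0..1} \<Longrightarrow> \<bar>u (linepath a b t)\<bar> \<le> B"
    using compact_imp_bounded by (force simp: bounded_iff)
  moreover have "(\<lambda>t. u (linepath a b t)) \<in> borel_measurable (lebesgue_on {0..1})"
    using c by (intro continuous_imp_measurable_on_sets_lebesgue) auto
  ultimately show ?thesis
    by (intro sqint_bounded[of _ _ B] finite_measure_lebesgue_on) auto
qed

lemma edge_L2_continuous: "continuous_on UNIV u \<Longrightarrow> u \<in> edge_L2 a b"
  by (simp add: edge_L2_iff_sqint sqint_edge_continuous)

lemma edge_L2_lin: "f \<in> edge_L2 a b \<Longrightarrow> g \<in> edge_L2 a b \<Longrightarrow> (\<lambda>x. c * f x + d * g x) \<in> edge_L2 a b"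
  by (simp add: edge_L2_iff_sqint sqint_lin)

lemma edge_int_mult_lin:
  assumes "f \<in> edge_L2 a b" "g \<in> edge_L2 a b" "r \<in> edge_L2 a b"
  shows "edge_int a b (\<lambda>x. (c * f x + d * g x) * r x)
    = c * edge_int a b (\<lambda>x. f x * r x) + d * edge_int a b (\<lambda>x. g x * r x)"
proof -
  have "(LINT t|lebesgue_on {0..1}. (c * f (linepath a b t) + d * g (linepath a b t)) * r (linepath a b t))
     = (LINT t|lebesgue_on {0..1}. c * (f (linepath a b t) * r (linepath a b t)) + d * (g (linepath a b t) * r (linepath a b t)))"
    by (simp add: algebra_simps)
  also have "\<dots> = c * (LINT t|lebesgue_on {0..1}. f (linepath a b t) * r (linepath a b t))
     + d * (LINT t|lebesgue_on {0..1}. g (linepath a b t) * r (linepath a b t))"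
    using sqint_mult_integrable[OF assms(1,3)[unfolded edge_L2_iff_sqint]]
      sqint_mult_integrable[OF assms(2,3)[unfolded edge_L2_iff_sqint]] by simp
  finally show ?thesis by (simp add: edge_int_def algebra_simps)
qed

lemma edge_int_lin:
  assumes "f \<in> edge_L2 a b" "g \<in> edge_L2 a b"
  shows "edge_int a b (\<lambda>x. c * f x + d * g x) = c * edge_int a b f + d * edge_int a b g"
  using edge_int_mult_lin[OF assms edge_L2_continuous[of "\<lambda>_. 1"]] by simp

section \<open>Traces of H1 functions under linear combinations\<close>

lemma L2norm_cong_AE:
  assumes "u \<in> L2 D" "v \<in> L2 D" "AE x in lebesgue_on D. u x = v x"
  shows "L2norm D u = L2norm D v"
proof -
  have "(LINT x|lebesgue_on D. (u x)\<^sup>2) = (LINT x|lebesgue_on D. (v x)\<^sup>2)"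
    using assms(3) L2_measurable[OF assms(1)] L2_measurable[OF assms(2)]
    by (intro integral_cong_AE) auto
  then show ?thesis by (simp add: L2norm_def)
qed

lemma L2_diff: "u \<in> L2 D \<Longrightarrow> v \<in> L2 D \<Longrightarrow> (\<lambda>x. u x - v x) \<in> L2 D"
  using L2_lin[of u D v 1 "-1"] by simp

lemma L2norm_lin_tendsto:
  assumes p: "\<And>n. p n \<in> L2 D" "\<And>n. q n \<in> L2 D" "u \<in> L2 D" "v \<in> L2 D"
    and "(\<lambda>n. L2norm D (\<lambda>x. p n x - u x)) \<longlonglongrightarrow> 0" "(\<lambda>n. L2norm D (\<lambda>x. q n x - v x)) \<longlonglongrightarrow> 0"
    and w: "w \<in> L2 D" "AE x in lebesgue_on D. w x = c * u x + d * v x"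
  shows "(\<lambda>n. L2norm D (\<lambda>x. (c * p n x + d * q n x) - w x)) \<longlonglongrightarrow> 0"
proof -
  have "L2norm D (\<lambda>x. (c * p n x + d * q n x) - w x)
      = L2norm D (\<lambda>x. c * (p n x - u x) + d * (q n x - v x))" for n
  proof (rule L2norm_cong_AE)
    show "AE x in lebesgue_on D. (c * p n x + d * q n x) - w x = c * (p n x - u x) + d * (q n x - v x)"
      using w(2) by eventually_elim (simp add: algebra_simps)
  qed (intro L2_diff L2_lin p w)+
  moreover have "(\<lambda>n. L2norm D (\<lambda>x. c * (p n x - u x) + d * (q n x - v x))) \<longlonglongrightarrow> 0"
    using assms(5,6) L2_diff p unfolding L2norm_tendsto_0_iff L2_iff_sqint
    by (intro integral_sq_lin_tendsto) auto
  ultimately show ?thesis by simp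
qed

text \<open>Combine the two approximating sequences. The function \<open>w\<close> is allowed to
  differ from the combination on a null set because the lemma is applied to components of
  \<open>curl\<close> and \<open>grad\<close>.\<close>

lemma trace_on_lin:
  assumes D: "bdd_open D" and t: "trace_on D a b u g" "trace_on D a b v k"
    and w: "w \<in> L2 D" "AE x in lebesgue_on D. w x = c * u x + d * v x"
  shows "trace_on D a b w (\<lambda>x. c * g x + d * k x)"
proof -
  have H: "u \<in> H1 D" "v \<in> H1 D" "g \<in> edge_L2 a b" "k \<in> edge_L2 a b"
    using t by (auto simp: trace_on_def)
  have lin: "(\<lambda>x. c * u x + d * v x) \<in> H1 D" by (intro H1_lin D H)
  have "AE x in lebesgue_on D. c * u x + d * v x = w x"
    using w(2) by eventually_elim simp
  then have w1: "w \<in> H1 D"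
    by (rule H1_cong_AE[OF D lin w(1)])
  \<comment> \<open>An equality of functions, by \<open>wd_cong_AE\<close>; the derivatives of
    \<open>w\<close> in the definition of the trace can thus be replaced by those of the
    combination.\<close>
  have wdw: "wd D i w = wd D i (\<lambda>x. c * u x + d * v x)" for i
    by (intro wd_cong_AE D w H1_L2[OF lin])
  obtain U where U: "\<And>n. smooth_fun (U n)"
    "(\<lambda>n. L2norm D (\<lambda>x. U n x - u x)) \<longlonglongrightarrow> 0"
    "\<And>i. (\<lambda>n. L2norm D (\<lambda>x. pd i (U n) x - wd D i u x)) \<longlonglongrightarrow> 0"
    "(\<lambda>n. edge_int a b (\<lambda>x. (U n x - g x)\<^sup>2)) \<longlonglongrightarrow> 0"
    using t(1) by (auto simp: trace_on_def)
  obtain V where V: "\<And>n. smooth_fun (V n)"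
    "(\<lambda>n. L2norm D (\<lambda>x. V n x - v x)) \<longlonglongrightarrow> 0"
    "\<And>i. (\<lambda>n. L2norm D (\<lambda>x. pd i (V n) x - wd D i v x)) \<longlonglongrightarrow> 0"
    "(\<lambda>n. edge_int a b (\<lambda>x. (V n x - k x)\<^sup>2)) \<longlonglongrightarrow> 0"
    using t(2) by (auto simp: trace_on_def)
  define W where "W n x = c * U n x + d * V n x" for n x
  have "smooth_fun (W n)" for n
    unfolding W_def[abs_def] by (intro smooth_fun_lin U V)
  moreover have "(\<lambda>n. L2norm D (\<lambda>x. W n x - w x)) \<longlonglongrightarrow> 0"
    unfolding W_def
    by (intro L2norm_lin_tendsto[OF _ _ H1_L2[OF H(1)] H1_L2[OF H(2)] U(2) V(2) w] L2_smooth D U V)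
  moreover have "(\<lambda>n. L2norm D (\<lambda>x. pd i (W n) x - wd D i w x)) \<longlonglongrightarrow> 0" for i
  proof -
    have "pd i (W n) = (\<lambda>x. c * pd i (U n) x + d * pd i (V n) x)" for n
      unfolding W_def[abs_def] by (rule pd_lin[OF U(1) V(1)])
    then show ?thesis
      unfolding wdw
      using L2norm_lin_tendsto[OF L2_smooth[OF D smooth_fun_pd[OF U(1)]] L2_smooth[OF D smooth_fun_pd[OF V(1)]]
          wd_works(1)[OF H(1)] wd_works(1)[OF H(2)] U(3) V(3) wd_works(1)[OF lin] wd_lin[OF D H(1,2)], of i]
      by simp
  qed
  moreover have "(\<lambda>n. edge_int a b (\<lambda>x. (W n x - (c * g x + d * k x))\<^sup>2)) \<longlonglongrightarrow> 0"
  \<comment> \<open>\<open>edge_int\<close> carries the factor \<open>dist a b\<close>: for a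
    degenerate segment everything is zero, otherwise the length can be divided out to reach the
    integrals over the parameter.\<close>
  proof (cases "a = b")
    case False
    let ?M = "lebesgue_on {0..1::real}"
    have conv: "(\<lambda>n. LINT t|?M. (f n (linepath a b t))\<^sup>2) \<longlonglongrightarrow> 0"
      if "(\<lambda>n. edge_int a b (\<lambda>x. (f n x)\<^sup>2)) \<longlonglongrightarrow> 0" for f :: "nat \<Rightarrow> pt \<Rightarrow> real"
      using tendsto_mult_left[OF that, of "1 / dist a b"] False by (simp add: edge_int_def)
    have sq: "sqint ?M (\<lambda>t. U n (linepath a b t) - g (linepath a b t))"
      "sqint ?M (\<lambda>t. V n (linepath a b t) - k (linepath a b t))" for n
      using sqint_lin[OF sqint_edge_continuous[OF smooth_fun_continuous_on[OF U(1)]] H(3)[unfolded edge_L2_iff_sqint], where c=1 and d="-1"]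
        sqint_lin[OF sqint_edge_continuous[OF smooth_fun_continuous_on[OF V(1)]] H(4)[unfolded edge_L2_iff_sqint], where c=1 and d="-1"]
      by simp_all
    have "(\<lambda>n. LINT t|?M. (c * (U n (linepath a b t) - g (linepath a b t))
        + d * (V n (linepath a b t) - k (linepath a b t)))\<^sup>2) \<longlonglongrightarrow> 0"
      by (intro integral_sq_lin_tendsto sq conv[OF U(4)] conv[OF V(4)])
    from tendsto_mult_left[OF this, of "dist a b"] show ?thesis
      by (simp add: edge_int_def W_def algebra_simps)
  qed (simp add: edge_int_def)
  ultimately show ?thesis
    unfolding trace_on_def using w1 edge_L2_lin[OF H(3,4)] by blast
qed

text \<open>The special case 1 u + 0 u of \<open>trace_on_lin\<close>.\<close>

lemma trace_on_cong_AE: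
  assumes "bdd_open D" "trace_on D a b u g" "w \<in> L2 D" "AE x in lebesgue_on D. w x = u x"
  shows "trace_on D a b w g"
  using trace_on_lin[OF assms(1,2,2,3), of 1 0] assms(4) by simp

lemma trace_on_smooth:
  assumes D: "bdd_open D" and p: "smooth_fun p" shows "trace_on D a b p p"
  unfolding trace_on_def
proof (intro conjI exI[of _ "\<lambda>_. p"] allI)
  show "(\<lambda>n. L2norm D (\<lambda>x. pd i p x - wd D i p x)) \<longlonglongrightarrow> 0" for i
  proof -
    have "L2norm D (\<lambda>x. pd i p x - wd D i p x) = L2norm D (\<lambda>x. 0)"
    proof (rule L2norm_cong_AE)
      show "AE x in lebesgue_on D. pd i p x - wd D i p x = 0"
        using wd_smooth[OF D p, of i] by eventually_elim simp
      show "(\<lambda>x. pd i p x - wd D i p x) \<in> L2 D"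
        by (intro L2_diff L2_smooth wd_works H1_smooth D p smooth_fun_pd)
    qed (intro L2_smooth D smooth_fun_const)
    then show ?thesis by (simp add: L2norm_def)
  qed
qed (use H1_smooth[OF D p] p edge_L2_continuous smooth_fun_continuous_on in \<open>auto simp: L2norm_def edge_int_def\<close>)

section \<open>The distributional Laplacian and its weak trace\<close>

lemma weak_lap_lin:
  assumes D: "bdd_open D" and l: "weak_lap D u p" "weak_lap D v q"
    and w: "w \<in> L2 D" "AE x in lebesgue_on D. w x = c * u x + d * v x"
  shows "weak_lap D w (\<lambda>x. c * p x + d * q x)"
proof -
  have L: "u \<in> L2 D" "v \<in> L2 D" "p \<in> L2 D" "q \<in> L2 D" using l by (auto simp: weak_lap_def)
  have "(LINT x|lebesgue_on D. w x * (\<Sum>i\<in>UNIV. pd i (pd i f) x)) = (LINT x|lebesgue_on D. (c * p x + d * q x) * f x)"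
    if f: "f \<in> test_fun D" for f
  proof -
    have lf: "(\<lambda>x. \<Sum>i\<in>UNIV. pd i (pd i f) x) \<in> L2 D"
      unfolding sum_2 by (intro L2_smooth D smooth_fun_add smooth_fun_pd test_fun_smooth[OF f])
    show ?thesis
      using l f L2_integral_lin[OF L(1,2) lf] L2_integral_lin[OF L(3,4) test_fun_L2[OF D f]]
        integral_mult_cong_AE[OF w(2) w(1) L2_lin[OF L(1,2)] lf]
      by (simp add: weak_lap_def)
  qed
  then show ?thesis using w(1) L2_lin[OF L(3,4)] by (simp add: weak_lap_def)
qed

lemma weak_trace_on_lin:
  assumes D: "bdd_open D" and t: "weak_trace_on D a b u p g" "weak_trace_on D a b v q k"
    and w: "w \<in> L2 D" "AE x in lebesgue_on D. w x = c * u x + d * v x"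
  shows "weak_trace_on D a b w (\<lambda>x. c * p x + d * q x) (\<lambda>x. c * g x + d * k x)"
proof -
  have H: "weak_lap D u p" "weak_lap D v q" "g \<in> edge_L2 a b" "k \<in> edge_L2 a b"
    using t by (auto simp: weak_trace_on_def)
  have L: "u \<in> L2 D" "v \<in> L2 D" "p \<in> L2 D" "q \<in> L2 D" using H by (auto simp: weak_lap_def)
  let ?lap = "\<lambda>f x. \<Sum>i\<in>UNIV. pd i (pd i f) x"
  let ?ok = "\<lambda>e. smooth_fun e \<and> a \<notin> supp e \<and> b \<notin> supp e"
  obtain U where U: "\<And>n. smooth_fun (U n)"
    "(\<lambda>n. L2norm D (\<lambda>x. U n x - u x)) \<longlonglongrightarrow> 0"
    "(\<lambda>n. L2norm D (\<lambda>x. ?lap (U n) x - p x)) \<longlonglongrightarrow> 0"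
    "\<And>e. ?ok e \<Longrightarrow> (\<lambda>n. edge_int a b (\<lambda>x. U n x * e x)) \<longlonglongrightarrow> edge_int a b (\<lambda>x. g x * e x)"
    using t(1) unfolding weak_trace_on_def by blast
  obtain V where V: "\<And>n. smooth_fun (V n)"
    "(\<lambda>n. L2norm D (\<lambda>x. V n x - v x)) \<longlonglongrightarrow> 0"
    "(\<lambda>n. L2norm D (\<lambda>x. ?lap (V n) x - q x)) \<longlonglongrightarrow> 0"
    "\<And>e. ?ok e \<Longrightarrow> (\<lambda>n. edge_int a b (\<lambda>x. V n x * e x)) \<longlonglongrightarrow> edge_int a b (\<lambda>x. k x * e x)"
    using t(2) unfolding weak_trace_on_def by blast
  define W where "W n x = c * U n x + d * V n x" for n x
  have lapL2: "?lap f \<in> L2 D" if "smooth_fun f" for f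
    unfolding sum_2 by (intro L2_smooth D smooth_fun_add smooth_fun_pd that)
  have "smooth_fun (W n)" for n
    unfolding W_def[abs_def] by (intro smooth_fun_lin U V)
  moreover have "(\<lambda>n. L2norm D (\<lambda>x. W n x - w x)) \<longlonglongrightarrow> 0"
    unfolding W_def
    by (intro L2norm_lin_tendsto[OF _ _ L(1,2) U(2) V(2) w] L2_smooth D U V)
  moreover have "(\<lambda>n. L2norm D (\<lambda>x. ?lap (W n) x - (c * p x + d * q x))) \<longlonglongrightarrow> 0"
  proof -
    have "?lap (W n) x = c * ?lap (U n) x + d * ?lap (V n) x" for n x
      unfolding W_def[abs_def] pd_lin[OF U(1) V(1)] pd_lin[OF smooth_fun_pd[OF U(1)] smooth_fun_pd[OF V(1)]]
      by (simp add: sum.distrib sum_distrib_left)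
    then show ?thesis
      using L2norm_lin_tendsto[OF lapL2[OF U(1)] lapL2[OF V(1)] L(3,4) U(3) V(3) L2_lin[OF L(3,4)], of c d c d]
      by simp
  qed
  moreover have "(\<lambda>n. edge_int a b (\<lambda>x. W n x * e x)) \<longlonglongrightarrow> edge_int a b (\<lambda>x. (c * g x + d * k x) * e x)"
    if e: "?ok e" for e
  proof -
    have el: "f \<in> edge_L2 a b" if "smooth_fun f" for f
      using that by (intro edge_L2_continuous smooth_fun_continuous_on)
    have "e \<in> edge_L2 a b" using el e by blast
    then have "edge_int a b (\<lambda>x. (c * g x + d * k x) * e x) = c * edge_int a b (\<lambda>x. g x * e x) + d * edge_int a b (\<lambda>x. k x * e x)"
      "edge_int a b (\<lambda>x. W n x * e x) = c * edge_int a b (\<lambda>x. U n x * e x) + d * edge_int a b (\<lambda>x. V n x * e x)" for n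
      unfolding W_def using el[OF U(1)] el[OF V(1)] H by (simp_all add: edge_int_mult_lin)
    then show ?thesis using U(4)[OF e] V(4)[OF e] by (auto intro!: tendsto_intros)
  qed
  ultimately show ?thesis
    unfolding weak_trace_on_def using weak_lap_lin[OF D H(1,2) w] edge_L2_lin[OF H(3,4)] by blast
qed

text \<open>Covers the Laplacian of a quadratic polynomial, which equals a constant only almost
  everywhere, being built from chosen derivatives. A constant has weak derivative zero, so the
  Laplacian of any test function integrates to zero against it.\<close>

lemma weak_trace_on_const:
  assumes D: "bdd_open D" and w: "w \<in> L2 D" "AE x in lebesgue_on D. w x = c"
  shows "weak_lap D w (\<lambda>_. 0)" "weak_trace_on D a b w (\<lambda>_. 0) (\<lambda>_. c)"
proof -
  have cL: "(\<lambda>_. c) \<in> L2 D" for c by (intro L2_smooth D smooth_fun_const)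
  have "(LINT x|lebesgue_on D. c * (\<Sum>i\<in>UNIV. pd i (pd i f) x)) = 0" if f: "f \<in> test_fun D" for f
  proof -
    have "(LINT x|lebesgue_on D. 1 * pd i (pd i f) x) = 0" for i
      using weak_partial_smooth[OF D smooth_fun_const[of 1], of i] test_fun_pd[OF f, of i]
      by (simp add: weak_partial_def pd_const)
    moreover have "integrable (lebesgue_on D) (pd i (pd i f))" for i
      by (intro L2_integrable L2_smooth D smooth_fun_pd test_fun_smooth[OF f])
    ultimately show ?thesis by simp
  qed
  then have l: "weak_lap D (\<lambda>_. c) (\<lambda>_. 0)" using cL by (simp add: weak_lap_def)
  then show wl: "weak_lap D w (\<lambda>_. 0)"
    using weak_lap_lin[OF D l l w(1), of 1 0] w(2) by simp
  have "weak_trace_on D a b (\<lambda>_. c) (\<lambda>_. 0) (\<lambda>_. c)"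
    unfolding weak_trace_on_def
    by (intro conjI exI[of _ "\<lambda>n x. c"] l edge_L2_continuous)
       (auto simp: smooth_fun_const L2norm_def pd_const)
  then show "weak_trace_on D a b w (\<lambda>_. 0) (\<lambda>_. c)"
    using weak_trace_on_lin[OF D _ _ w(1), of a b "\<lambda>_. c" "\<lambda>_. 0" "\<lambda>_. c" "\<lambda>_. c" "\<lambda>_. 0" "\<lambda>_. c" 1 0] w(2) by simp
qed

section \<open>Linearity of the local spaces\<close>

lemma curl_nth: "curl D u x $ 1 = wd D 2 u x" "curl D u x $ 2 = - wd D 1 u x"
  by (simp_all add: curl_def)

lemma curl_inner: "curl D u x \<bullet> n = n $ 1 * wd D 2 u x + (- (n $ 2)) * wd D 1 u x"
  by (simp add: inner_vec_def sum_2 curl_nth)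

lemma grad_inner: "grad D u x \<bullet> n = n $ 1 * wd D 1 u x + n $ 2 * wd D 2 u x"
  by (simp add: inner_vec_def sum_2 grad_def)

lemma curl_L2: "u \<in> H2 D \<Longrightarrow> (\<lambda>x. curl D u x $ k) \<in> L2 D"
  and curl_H1: "bdd_open D \<Longrightarrow> u \<in> H2 D \<Longrightarrow> (\<lambda>x. curl D u x $ k) \<in> H1 D"
  using exhaust_2[of k] H2_wd[of u D 2] H1_lin[OF _ H2_wd[of u D 1] H2_wd[of u D 1], of "-1" 0]
    H2_wd_L2[of u D 2] L2_lin[OF H2_wd_L2[of u D 1] H2_wd_L2[of u D 1], of "-1" 0]
  by (auto simp: curl_nth)

lemma curl_inner_L2: "u \<in> H2 D \<Longrightarrow> (\<lambda>x. curl D u x \<bullet> n) \<in> L2 D"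
  and grad_inner_L2: "u \<in> H2 D \<Longrightarrow> (\<lambda>x. grad D u x \<bullet> n) \<in> L2 D"
  unfolding curl_inner grad_inner by (simp_all only: L2_lin H2_wd_L2)

lemma curl_lin:
  assumes "bdd_open D" "u \<in> H2 D" "v \<in> H2 D"
  shows "AE x in lebesgue_on D. curl D (\<lambda>x. c * u x + d * v x) x = c *\<^sub>R curl D u x + d *\<^sub>R curl D v x"
  using wd_lin[OF assms(1) assms(2,3)[THEN H2_H1], of 1 c d] wd_lin[OF assms(1) assms(2,3)[THEN H2_H1], of 2 c d]
  by eventually_elim (simp add: vec_eq_iff forall_2 curl_nth)

lemma grad_lin:
  assumes "bdd_open D" "u \<in> H2 D" "v \<in> H2 D"
  shows "AE x in lebesgue_on D. grad D (\<lambda>x. c * u x + d * v x) x = c *\<^sub>R grad D u x + d *\<^sub>R grad D v x"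
  using wd_lin[OF assms(1) assms(2,3)[THEN H2_H1], of 1 c d] wd_lin[OF assms(1) assms(2,3)[THEN H2_H1], of 2 c d]
  by eventually_elim (simp add: vec_eq_iff forall_2 grad_def)

lemma curl_inner_lin:
  assumes "bdd_open D" "u \<in> H2 D" "v \<in> H2 D"
  shows "AE x in lebesgue_on D. curl D (\<lambda>x. c * u x + d * v x) x \<bullet> n = c * (curl D u x \<bullet> n) + d * (curl D v x \<bullet> n)"
  using curl_lin[OF assms, of c d] by eventually_elim (simp add: inner_add_left)

lemma grad_inner_lin:
  assumes "bdd_open D" "u \<in> H2 D" "v \<in> H2 D"
  shows "AE x in lebesgue_on D. grad D (\<lambda>x. c * u x + d * v x) x \<bullet> n = c * (grad D u x \<bullet> n) + d * (grad D v x \<bullet> n)"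
  using grad_lin[OF assms, of c d] by eventually_elim (simp add: inner_add_left)

lemma polys_edge_L2: "p \<in> polys 2 \<Longrightarrow> p \<in> edge_L2 a b"
  by (intro edge_L2_continuous smooth_fun_continuous_on smooth_fun_polys)

lemma local_pre_H2: "u \<in> local_pre P \<Longrightarrow> u \<in> H2 (region P)"
  by (simp add: local_pre_def)

lemma local_pre_lin:
  assumes u: "u \<in> local_pre P" and v: "v \<in> local_pre P"
  shows "(\<lambda>x. c * u x + d * v x) \<in> local_pre P"
proof -
  note D = bdd_open_region[of P]
  let ?D = "region P"
  note H = u[THEN local_pre_H2] v[THEN local_pre_H2]
  have 1: "(\<lambda>x. c * u x + d * v x) \<in> H2 ?D" by (intro H2_lin D H)
  have 2: "continuous_on (closure ?D) (\<lambda>x. c * u x + d * v x)"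
    using u v by (auto simp: local_pre_def intro!: continuous_intros)
  have 3: "\<exists>q\<in>polys 2. \<forall>x\<in>closed_segment a b. c * u x + d * v x = q x" if ab: "(a, b) \<in> edges P" for a b
  proof -
    obtain p q where "p \<in> polys 2" "q \<in> polys 2" "\<forall>x\<in>closed_segment a b. u x = p x" "\<forall>x\<in>closed_segment a b. v x = q x"
      using u v ab unfolding local_pre_def by blast
    then show ?thesis
      by (intro bexI[of _ "\<lambda>x. c * p x + d * q x"] polys_lin) auto
  qed
  obtain p where p: "p \<in> polys 2" "weak_lap ?D (lap ?D u) p"
    "\<And>a b. (a, b) \<in> edges P \<Longrightarrow> \<exists>c\<in>polys 0. weak_trace_on ?D a b (lap ?D u) p c"
    using u unfolding local_pre_def by blast
  obtain q where q: "q \<in> polys 2" "weak_lap ?D (lap ?D v) q"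
    "\<And>a b. (a, b) \<in> edges P \<Longrightarrow> \<exists>c\<in>polys 0. weak_trace_on ?D a b (lap ?D v) q c"
    using v unfolding local_pre_def by blast
  note w = lap_L2[OF 1] lap_lin[OF D H, of c d]
  have 4: "\<exists>k\<in>polys 0. weak_trace_on ?D a b (lap ?D (\<lambda>x. c * u x + d * v x)) (\<lambda>x. c * p x + d * q x) k"
    if ab: "(a, b) \<in> edges P" for a b
    using p(3)[OF ab] q(3)[OF ab] weak_trace_on_lin[OF D _ _ w, of a b] polys_lin[of _ 0 _ c d] by blast
  show ?thesis
    unfolding local_pre_def
    using 1 2 3 4 polys_lin[OF p(1) q(1), of c d] weak_lap_lin[OF D p(2) q(2) w] by blast
qed

lemma polys_2_local_pre:
  assumes p: "p \<in> polys 2" shows "p \<in> local_pre P"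
proof -
  note D = bdd_open_region[of P]
  let ?D = "region P"
  obtain c b1 b2 a11 a12 a22 where q: "p = quad c b1 b2 a11 a12 a22" using p polys_2_iff by blast
  have lap: "AE x in lebesgue_on ?D. lap ?D p x = 2 * a11 + 2 * a22"
    using hess_quad(1)[OF D, of c b1 b2 a11 a12 a22] hess_quad(4)[OF D, of c b1 b2 a11 a12 a22]
    by eventually_elim (simp add: lap_def sum_2 q)
  have H: "p \<in> H2 ?D" by (intro polys_2_H2 D p)
  have z: "(\<lambda>_. 0) \<in> polys 2" using polys_0_subset_2 polys_0_iff by blast
  have k: "(\<lambda>_. 2 * a11 + 2 * a22) \<in> polys 0" using polys_0_iff by blast
  have "\<forall>(a, b)\<in>edges P. \<exists>c\<in>polys 0. weak_trace_on ?D a b (lap ?D p) (\<lambda>_. 0) c"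
    using weak_trace_on_const(2)[OF D lap_L2[OF H] lap] k by blast
  then show ?thesis
    unfolding local_pre_def
    using H smooth_fun_continuous_on[OF smooth_fun_polys[OF p]] p z weak_trace_on_const(1)[OF D lap_L2[OF H] lap]
    by blast
qed

lemma integral_grad_product_lin:
  assumes D: "bdd_open D"
    and f: "\<And>k. f k \<in> H1 D" "\<And>k. g k \<in> H1 D" "\<And>k. r k \<in> H1 D"
    and w: "\<And>k. w k \<in> L2 D" "\<And>k. AE x in lebesgue_on D. w k x = c * f k x + d * g k x"
  shows "(LINT x|lebesgue_on D. (\<Sum>k\<in>UNIV. \<Sum>i\<in>UNIV. wd D i (w k) x * wd D i (r k) x))
    = c * (LINT x|lebesgue_on D. (\<Sum>k\<in>UNIV. \<Sum>i\<in>UNIV. wd D i (f k) x * wd D i (r k) x))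
      + d * (LINT x|lebesgue_on D. (\<Sum>k\<in>(UNIV :: 2 set). \<Sum>i\<in>UNIV. wd D i (g k) x * wd D i (r k) x))"
proof -
  have lin: "(\<lambda>x. c * f k x + d * g k x) \<in> H1 D" for k by (intro H1_lin D f)
  have wdw: "wd D i (w k) = wd D i (\<lambda>x. c * f k x + d * g k x)" for i k
    by (intro wd_cong_AE D w H1_L2[OF lin])
  have L: "wd D i (w k) \<in> L2 D" "wd D i (f k) \<in> L2 D" "wd D i (g k) \<in> L2 D" "wd D i (r k) \<in> L2 D" for i k
    using wd_works(1)[OF lin[of k]] by (auto simp: wdw intro: wd_works f)
  have "(LINT x|lebesgue_on D. wd D i (w k) x * wd D i (r k) x)
      = c * (LINT x|lebesgue_on D. wd D i (f k) x * wd D i (r k) x)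
        + d * (LINT x|lebesgue_on D. wd D i (g k) x * wd D i (r k) x)" for i k
    using integral_mult_cong_AE[OF wd_lin[OF D f(1)[of k] f(2)[of k], of i c d]
        L(1)[of i k, unfolded wdw] L2_lin[OF L(2) L(3)] L(4)[of i k]]
      L2_integral_lin[OF L(2)[of i k] L(3)[of i k] L(4)[of i k], of c d]
    by (simp add: wdw)
  then show ?thesis
    by (simp add: L2_mult_integrable L sum.distrib sum_distrib_left)
qed

text \<open>In \<open>morley_local\<close> the projected curl is an existential witness, and so are
  the traces in its boundary condition; it is therefore enough that combinations of witnesses are
  witnesses.\<close>

lemma is_PiNabla_lin:
  assumes q: "is_PiNabla P v q" "is_PiNabla P v' q'"
    and v: "\<And>k. (\<lambda>x. v x $ k) \<in> H1 (region P)" "\<And>k. (\<lambda>x. v' x $ k) \<in> H1 (region P)"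
    and w: "\<And>k. (\<lambda>x. w x $ k) \<in> L2 (region P)" "AE x in lebesgue_on (region P). w x = c *\<^sub>R v x + d *\<^sub>R v' x"
  shows "is_PiNabla P w (\<lambda>x. c *\<^sub>R q x + d *\<^sub>R q' x)"
proof -
  note D = bdd_open_region[of P]
  let ?D = "region P"
  have poly: "(\<lambda>x. q x $ k) \<in> polys 1" "(\<lambda>x. q' x $ k) \<in> polys 1" for k
    using q by (auto simp: is_PiNabla_def polysv_def)
  have H: "p \<in> H1 ?D" if "p \<in> polys 1" for p
    using that polys_1_subset_2 by (intro H1_smooth D smooth_fun_polys) blast
  have H1d: "(\<lambda>x. f x - g x) \<in> H1 ?D" if "f \<in> H1 ?D" "g \<in> H1 ?D" for f g
    using H1_lin[OF D that, of 1 "-1"] by simp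
  let ?Q = "\<lambda>x. c *\<^sub>R q x + d *\<^sub>R q' x"
  have Q: "?Q \<in> polysv 1" using polys_lin[OF poly] by (simp add: polysv_def)
  have wk: "AE x in lebesgue_on ?D. w x $ k = c * v x $ k + d * v' x $ k" for k
    using w(2) by eventually_elim simp
  have "(LINT x|lebesgue_on ?D. (\<Sum>k\<in>UNIV. \<Sum>i\<in>UNIV.
          wd ?D i (\<lambda>y. ?Q y $ k - w y $ k) x * wd ?D i (\<lambda>y. r y $ k) x)) = 0"
    if r: "r \<in> polysv 1" for r
  proof -
    have r1: "(\<lambda>y. r y $ k) \<in> H1 ?D" for k using r H by (simp add: polysv_def)
    have "(\<lambda>y. ?Q y $ k) \<in> polys 1" for k using Q by (simp only: polysv_def mem_Collect_eq)
    then have "(\<lambda>y. ?Q y $ k - w y $ k) \<in> L2 ?D" for k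
      using L2_diff[OF H1_L2[OF H] w(1)] by blast
    moreover have "AE x in lebesgue_on ?D. ?Q x $ k - w x $ k
        = c * (q x $ k - v x $ k) + d * (q' x $ k - v' x $ k)" for k
      using wk[of k] by eventually_elim (simp add: algebra_simps)
    ultimately show ?thesis
      using q r integral_grad_product_lin[where f="\<lambda>k y. q y $ k - v y $ k" and g="\<lambda>k y. q' y $ k - v' y $ k"
          and w="\<lambda>k y. ?Q y $ k - w y $ k" and r="\<lambda>k y. r y $ k" and c=c and d=d,
          OF D H1d[OF H[OF poly(1)] v(1)] H1d[OF H[OF poly(2)] v(2)] r1]
      by (simp add: is_PiNabla_def)
  qed
  moreover have "\<exists>g. (\<forall>(a,b)\<in>edges P. trace_on ?D a b (\<lambda>x. w x $ k) (g a b)) \<and>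
          (\<Sum>(a,b)\<in>edges P. edge_int a b (\<lambda>x. ?Q x $ k - g a b x)) = 0" for k
  proof -
    obtain g where g: "\<And>a b. (a,b)\<in>edges P \<Longrightarrow> trace_on ?D a b (\<lambda>x. v x $ k) (g a b)"
      "(\<Sum>(a,b)\<in>edges P. edge_int a b (\<lambda>x. q x $ k - g a b x)) = 0"
      using q(1) unfolding is_PiNabla_def by blast
    obtain g' where g': "\<And>a b. (a,b)\<in>edges P \<Longrightarrow> trace_on ?D a b (\<lambda>x. v' x $ k) (g' a b)"
      "(\<Sum>(a,b)\<in>edges P. edge_int a b (\<lambda>x. q' x $ k - g' a b x)) = 0"
      using q(2) unfolding is_PiNabla_def by blast
    let ?G = "\<lambda>a b x. c * g a b x + d * g' a b x"
    have tr: "trace_on ?D a b (\<lambda>x. w x $ k) (?G a b)" if "(a,b) \<in> edges P" for a b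
      by (rule trace_on_lin[OF D g(1)[OF that] g'(1)[OF that] w(1) wk])
    have "edge_int a b (\<lambda>x. ?Q x $ k - ?G a b x)
        = c * edge_int a b (\<lambda>x. q x $ k - g a b x) + d * edge_int a b (\<lambda>x. q' x $ k - g' a b x)"
      if ab: "(a,b) \<in> edges P" for a b
    proof -
      have G: "g a b \<in> edge_L2 a b" "g' a b \<in> edge_L2 a b"
        using g(1)[OF ab] g'(1)[OF ab] by (auto simp: trace_on_def)
      have "(\<lambda>x. q x $ k) \<in> edge_L2 a b" "(\<lambda>x. q' x $ k) \<in> edge_L2 a b"
        using poly[of k] polys_1_subset_2 by (auto intro!: polys_edge_L2)
      then have "(\<lambda>x. q x $ k - g a b x) \<in> edge_L2 a b" "(\<lambda>x. q' x $ k - g' a b x) \<in> edge_L2 a b"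
        using edge_L2_lin[OF _ G(1), of _ 1 "-1"] edge_L2_lin[OF _ G(2), of _ 1 "-1"] by simp_all
      from edge_int_lin[OF this, of c d] show ?thesis by (simp add: algebra_simps)
    qed
    then have "(\<Sum>(a,b)\<in>edges P. edge_int a b (\<lambda>x. ?Q x $ k - ?G a b x)) =
        (\<Sum>(a,b)\<in>edges P. c * edge_int a b (\<lambda>x. q x $ k - g a b x) + d * edge_int a b (\<lambda>x. q' x $ k - g' a b x))"
      by (intro sum.cong) auto
    also have "\<dots> = c * (\<Sum>(a,b)\<in>edges P. edge_int a b (\<lambda>x. q x $ k - g a b x))
        + d * (\<Sum>(a,b)\<in>edges P. edge_int a b (\<lambda>x. q' x $ k - g' a b x))"
      by (simp add: sum.distrib sum_distrib_left case_prod_unfold)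
    finally have "(\<Sum>(a,b)\<in>edges P. edge_int a b (\<lambda>x. ?Q x $ k - ?G a b x)) = 0" using g(2) g'(2) by simp
    then show ?thesis using tr by (intro exI[of _ ?G]) auto
  qed
  ultimately show ?thesis using Q by (simp add: is_PiNabla_def)
qed

lemma morley_local_pre: "u \<in> morley_local P \<Longrightarrow> u \<in> local_pre P"
  by (simp add: morley_local_def)

lemma morley_local_H2: "u \<in> morley_local P \<Longrightarrow> u \<in> H2 (region P)"
  by (intro local_pre_H2 morley_local_pre)

text \<open>The edge condition of \<open>morley_local\<close> with the trace \<open>g\<close> made
  explicit, so that witnesses of two functions can be combined.\<close>

definition curl_trace_moments :: "polygon \<Rightarrow> (pt \<Rightarrow> real) \<Rightarrow> (pt \<Rightarrow> pt) \<Rightarrow> pt \<Rightarrow> pt \<Rightarrow> (pt \<Rightarrow> real) \<Rightarrow> bool" where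
  "curl_trace_moments P u q a b g \<longleftrightarrow>
     trace_on (region P) a b (\<lambda>x. curl (region P) u x \<bullet> edge_normal a b) g \<and>
     (\<forall>r\<in>polys 1. edge_int a b r = 0 \<longrightarrow> edge_int a b (\<lambda>x. (g x - q x \<bullet> edge_normal a b) * r x) = 0)"

lemma polysv_inner_edge_L2:
  assumes "q \<in> polysv 1" shows "(\<lambda>x. q x \<bullet> n) \<in> edge_L2 a b"
proof -
  have "(\<lambda>x. q x $ k) \<in> edge_L2 a b" for k
    using assms polys_1_subset_2 by (intro polys_edge_L2) (auto simp: polysv_def)
  from edge_L2_lin[OF this[of 1] this[of 2], of "n $ 1" "n $ 2"] show ?thesis
    by (simp add: inner_vec_def sum_2 mult.commute)
qed

lemma curl_trace_moments_lin:
  assumes u: "u \<in> H2 (region P)" "v \<in> H2 (region P)" and q: "q \<in> polysv 1" "q' \<in> polysv 1"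
    and g: "curl_trace_moments P u q a b g" "curl_trace_moments P v q' a b g'"
  shows "curl_trace_moments P (\<lambda>x. c * u x + d * v x) (\<lambda>x. c *\<^sub>R q x + d *\<^sub>R q' x) a b (\<lambda>x. c * g x + d * g' x)"
proof -
  note D = bdd_open_region[of P]
  let ?n = "edge_normal a b"
  have t: "trace_on (region P) a b (\<lambda>x. curl (region P) (\<lambda>x. c * u x + d * v x) x \<bullet> ?n) (\<lambda>x. c * g x + d * g' x)"
    using g unfolding curl_trace_moments_def
    by (intro trace_on_lin[OF D _ _ curl_inner_L2[OF H2_lin[OF D u]] curl_inner_lin[OF D u]]) auto
  have G: "g \<in> edge_L2 a b" "g' \<in> edge_L2 a b" using g by (auto simp: curl_trace_moments_def trace_on_def)
  have L: "(\<lambda>x. g x - q x \<bullet> ?n) \<in> edge_L2 a b" "(\<lambda>x. g' x - q' x \<bullet> ?n) \<in> edge_L2 a b"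
    using edge_L2_lin[OF G(1) polysv_inner_edge_L2[OF q(1)], of 1 "-1"]
      edge_L2_lin[OF G(2) polysv_inner_edge_L2[OF q(2)], of 1 "-1"] by simp_all
  have "edge_int a b (\<lambda>x. (c * g x + d * g' x - (c *\<^sub>R q x + d *\<^sub>R q' x) \<bullet> ?n) * r x) = 0"
    if r: "r \<in> polys 1" "edge_int a b r = 0" for r
  proof -
    have "r \<in> edge_L2 a b" using r polys_1_subset_2 by (intro polys_edge_L2) blast
    moreover have "(\<lambda>x. (c * g x + d * g' x - (c *\<^sub>R q x + d *\<^sub>R q' x) \<bullet> ?n) * r x)
        = (\<lambda>x. (c * (g x - q x \<bullet> ?n) + d * (g' x - q' x \<bullet> ?n)) * r x)"
      by (simp add: inner_add_left algebra_simps)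
    ultimately show ?thesis
      using g r edge_int_mult_lin[OF L, of r c d] by (simp add: curl_trace_moments_def)
  qed
  then show ?thesis using t by (simp add: curl_trace_moments_def)
qed

lemma morley_local_alt:
  "morley_local P = {u \<in> local_pre P.
     (\<exists>q. is_PiNabla P (curl (region P) u) q \<and> (\<forall>(a,b)\<in>edges P. \<exists>g. curl_trace_moments P u q a b g)) \<and>
     (\<forall>r\<in>polys 2. (LINT x|lebesgue_on (region P). (u x - PiD P u x) * r x) = 0)}"
  by (simp add: morley_local_def curl_trace_moments_def)

lemma morley_local_lin:
  assumes ne: "region P \<noteq> {}" and u: "u \<in> morley_local P" and v: "v \<in> morley_local P"
  shows "(\<lambda>x. c * u x + d * v x) \<in> morley_local P"
proof -
  note D = bdd_open_region[of P]
  let ?D = "region P"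
  note H = u[THEN morley_local_H2] v[THEN morley_local_H2]
  obtain q where q: "is_PiNabla P (curl ?D u) q" "\<And>a b. (a,b) \<in> edges P \<Longrightarrow> \<exists>g. curl_trace_moments P u q a b g"
    using u unfolding morley_local_alt by blast
  obtain q' where q': "is_PiNabla P (curl ?D v) q'" "\<And>a b. (a,b) \<in> edges P \<Longrightarrow> \<exists>g. curl_trace_moments P v q' a b g"
    using v unfolding morley_local_alt by blast
  have Q: "q \<in> polysv 1" "q' \<in> polysv 1" using q(1) q'(1) by (auto simp: is_PiNabla_def)
  have 1: "is_PiNabla P (curl ?D (\<lambda>x. c * u x + d * v x)) (\<lambda>x. c *\<^sub>R q x + d *\<^sub>R q' x)"
    using H by (intro is_PiNabla_lin[OF q(1) q'(1)] curl_H1 curl_L2 curl_lin H2_lin D)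
  have 2: "\<exists>g. curl_trace_moments P (\<lambda>x. c * u x + d * v x) (\<lambda>x. c *\<^sub>R q x + d *\<^sub>R q' x) a b g"
    if "(a,b) \<in> edges P" for a b
    using q(2)[OF that] q'(2)[OF that] curl_trace_moments_lin[OF H Q] by blast
  have 3: "(LINT x|lebesgue_on ?D. (c * u x + d * v x - PiD P (\<lambda>x. c * u x + d * v x) x) * r x) = 0"
    if r: "r \<in> polys 2" for r
  proof -
    have p: "PiD P u \<in> polys 2" "PiD P v \<in> polys 2"
      using PiD_works[OF ne H(1)] PiD_works[OF ne H(2)] by (auto simp: is_PiD_def)
    have L: "(\<lambda>x. u x - PiD P u x) \<in> L2 ?D" "(\<lambda>x. v x - PiD P v x) \<in> L2 ?D"
      using L2_diff[OF H2_L2[OF H(1)] polys_L2[OF D p(1)]] L2_diff[OF H2_L2[OF H(2)] polys_L2[OF D p(2)]] .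
    have "(\<lambda>x. (c * u x + d * v x - PiD P (\<lambda>x. c * u x + d * v x) x) * r x)
        = (\<lambda>x. (c * (u x - PiD P u x) + d * (v x - PiD P v x)) * r x)"
      unfolding PiD_lin[OF ne H] by (simp add: algebra_simps)
    then show ?thesis
      using L2_integral_lin[OF L polys_L2[OF D r], of c d] u v r by (simp add: morley_local_def)
  qed
  show ?thesis
    unfolding morley_local_alt
    using local_pre_lin[OF u[THEN morley_local_pre] v[THEN morley_local_pre], of c d] 1 2 3 by blast
qed

text \<open>The curl of a quadratic polynomial is affine, hence its own projection and its own
  trace, and \<open>PiD\<close> fixes the polynomial. Consequently u - \<open>PiD\<close> u stays in
  the local space, where the properties of the stabilization are assumed.\<close>

lemma polys_2_morley_local:
  assumes ne: "region P \<noteq> {}" and p: "p \<in> polys 2"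
  shows "p \<in> morley_local P"
proof -
  note D = bdd_open_region[of P]
  let ?D = "region P"
  note sm = smooth_fun_polys[OF p]
  let ?M = "lebesgue_on ?D"
  define q :: "pt \<Rightarrow> pt" where "q x = vector [pd 2 p x, - pd 1 p x]" for x
  have qk: "(\<lambda>x. q x $ k) \<in> polys 1" for k
    using exhaust_2[of k] pd_polys_2[OF p, of 2] polys_lin[OF pd_polys_2[OF p, of 1] pd_polys_2[OF p, of 1], of "-1" 0]
    by (auto simp: q_def)
  have qs: "smooth_fun (\<lambda>x. q x $ k)" for k
    using qk polys_1_subset_2 smooth_fun_polys by blast
  have qe: "AE x in ?M. curl ?D p x = q x"
    using wd_smooth[OF D sm, of 1] wd_smooth[OF D sm, of 2]
    by eventually_elim (simp add: vec_eq_iff forall_2 curl_nth q_def)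
  have qke: "AE x in ?M. curl ?D p x $ k = q x $ k" for k
    using qe by eventually_elim simp
  note H = polys_2_H2[OF D p]
  have "is_PiNabla P (curl ?D p) q"
    unfolding is_PiNabla_def
  proof (intro conjI ballI allI)
    show "q \<in> polysv 1" using qk by (simp add: polysv_def)
    fix r assume r: "r \<in> polysv 1"
    have L0: "(\<lambda>_. 0) \<in> L2 ?D" by (intro L2_smooth D smooth_fun_const)
    have "wd ?D i (\<lambda>y. q y $ k - curl ?D p y $ k) = wd ?D i (\<lambda>_. 0)" for i k
    proof (rule wd_cong_AE[OF D _ L0])
      show "(\<lambda>y. q y $ k - curl ?D p y $ k) \<in> L2 ?D"
        by (intro L2_diff L2_smooth D qs curl_L2 H)
      show "AE x in ?M. q x $ k - curl ?D p x $ k = 0"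
        using qke[of k] by eventually_elim simp
    qed
    moreover have z: "AE x in ?M. wd ?D i (\<lambda>_. 0) x = 0" for i
      using wd_smooth[OF D smooth_fun_const, of i 0] by (simp add: pd_const)
    have "AE x in ?M. (\<Sum>k\<in>UNIV. \<Sum>i\<in>UNIV.
        wd ?D i (\<lambda>_. 0) x * wd ?D i (\<lambda>y. r y $ k) x) = 0"
      using z[of 1] z[of 2] by eventually_elim (simp add: sum_2)
    ultimately show "(LINT x|?M. (\<Sum>k\<in>UNIV. \<Sum>i\<in>UNIV.
          wd ?D i (\<lambda>y. q y $ k - curl ?D p y $ k) x * wd ?D i (\<lambda>y. r y $ k) x)) = 0"
      by (simp add: integral_eq_zero_AE)
  next
    fix k
    have "trace_on ?D a b (\<lambda>x. curl ?D p x $ k) (\<lambda>x. q x $ k)" for a b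
      by (rule trace_on_cong_AE[OF D trace_on_smooth[OF D qs] curl_L2[OF H] qke])
    then show "\<exists>g. (\<forall>(a,b)\<in>edges P. trace_on ?D a b (\<lambda>x. curl ?D p x $ k) (g a b)) \<and>
          (\<Sum>(a,b)\<in>edges P. edge_int a b (\<lambda>x. q x $ k - g a b x)) = 0"
      by (intro exI[of _ "\<lambda>_ _ x. q x $ k"]) (simp add: edge_int_def case_prod_unfold)
  qed
  moreover have "curl_trace_moments P p q a b (\<lambda>x. q x \<bullet> edge_normal a b)" for a b
  proof -
    have "smooth_fun (\<lambda>x. q x \<bullet> edge_normal a b)"
      using smooth_fun_lin[OF qs[of 1] qs[of 2], of "edge_normal a b $ 1" "edge_normal a b $ 2"]
      by (simp add: inner_vec_def sum_2 mult.commute)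
    moreover have "AE x in ?M. curl ?D p x \<bullet> edge_normal a b = q x \<bullet> edge_normal a b"
      using qe by eventually_elim simp
    ultimately have "trace_on ?D a b (\<lambda>x. curl ?D p x \<bullet> edge_normal a b) (\<lambda>x. q x \<bullet> edge_normal a b)"
      by (intro trace_on_cong_AE[OF D trace_on_smooth[OF D] curl_inner_L2[OF H]])
    then show ?thesis by (simp add: curl_trace_moments_def edge_int_def)
  qed
  ultimately show ?thesis
    unfolding morley_local_alt using polys_2_local_pre[OF p, of P] PiD_polys[OF ne p] by auto
qed

section \<open>Linearity of the global spaces\<close>

lemma normal_trace_lin:
  assumes u: "u \<in> H2 (region P)" "v \<in> H2 (region P)"
    and t: "normal_trace P a b u g" "normal_trace P a b v k"
  shows "normal_trace P a b (\<lambda>x. c * u x + d * v x) (\<lambda>x. c * g x + d * k x)"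
  using t unfolding normal_trace_def
  by (intro trace_on_lin[OF bdd_open_region _ _ grad_inner_L2[OF H2_lin[OF bdd_open_region u]]
        grad_inner_lin[OF bdd_open_region u]])

lemma normal_trace_edge_L2: "normal_trace P a b u g \<Longrightarrow> g \<in> edge_L2 a b"
  by (simp add: normal_trace_def trace_on_def)

lemma morleyD:
  assumes u: "u \<in> morley D T"
  shows "P \<in> T \<Longrightarrow> u P \<in> morley_local P"
    and "P \<in> T \<Longrightarrow> Q \<in> T \<Longrightarrow> w \<in> set P \<inter> set Q \<inter> D \<Longrightarrow> u P w = u Q w"
    and "P \<in> T \<Longrightarrow> w \<in> set P \<inter> frontier D \<Longrightarrow> u P w = 0"
    and "P \<in> T \<Longrightarrow> Q \<in> T \<Longrightarrow> P \<noteq> Q \<Longrightarrow>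
      (a, b) \<in> (edges P \<union> (edges P)\<inverse>) \<inter> (edges Q \<union> (edges Q)\<inverse>) \<Longrightarrow>
      \<exists>g g'. normal_trace P a b (u P) g \<and> normal_trace Q a b (u Q) g' \<and> edge_int a b (\<lambda>x. g x - g' x) = 0"
    and "P \<in> T \<Longrightarrow> (a, b) \<in> edges P \<Longrightarrow> closed_segment a b \<subseteq> frontier D \<Longrightarrow>
      \<exists>g. normal_trace P a b (u P) g \<and> edge_int a b g = 0"
proof -
  note m = u[unfolded morley_def mem_Collect_eq]
  show "P \<in> T \<Longrightarrow> u P \<in> morley_local P"
    by (rule bspec[OF m[THEN conjunct1]])
  show "P \<in> T \<Longrightarrow> Q \<in> T \<Longrightarrow> w \<in> set P \<inter> set Q \<inter> D \<Longrightarrow> u P w = u Q w"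
    by (rule m[THEN conjunct2, THEN conjunct1, rule_format])
  show "P \<in> T \<Longrightarrow> w \<in> set P \<inter> frontier D \<Longrightarrow> u P w = 0"
    by (rule m[THEN conjunct2, THEN conjunct2, THEN conjunct1, rule_format])
  show "\<exists>g g'. normal_trace P a b (u P) g \<and> normal_trace Q a b (u Q) g' \<and> edge_int a b (\<lambda>x. g x - g' x) = 0"
    if "P \<in> T" "Q \<in> T" "P \<noteq> Q" "(a, b) \<in> (edges P \<union> (edges P)\<inverse>) \<inter> (edges Q \<union> (edges Q)\<inverse>)"
    using m[THEN conjunct2, THEN conjunct2, THEN conjunct2, THEN conjunct1, rule_format, OF that]
    by simp
  show "\<exists>g. normal_trace P a b (u P) g \<and> edge_int a b g = 0"
    if "P \<in> T" "(a, b) \<in> edges P" "closed_segment a b \<subseteq> frontier D"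
    using m[THEN conjunct2, THEN conjunct2, THEN conjunct2, THEN conjunct2, rule_format, OF that(1,2)] that(3)
    by simp
qed

text \<open>The normal traces on the two sides of an edge are witnesses that combine; being square
  integrable on the edge, their jumps have linear edge integrals, so the zero mean conditions
  survive.\<close>

lemma morley_lin:
  assumes ne: "\<And>P. P \<in> T \<Longrightarrow> region P \<noteq> {}" and u: "u \<in> morley D T" and v: "v \<in> morley D T"
  shows "(\<lambda>P x. c * u P x + d * v P x) \<in> morley D T"
proof -
  have H: "u P \<in> H2 (region P)" "v P \<in> H2 (region P)" if "P \<in> T" for P
    using morleyD(1)[OF u that] morleyD(1)[OF v that] by (auto intro: morley_local_H2)
  have 1: "\<forall>P\<in>T. (\<lambda>x. c * u P x + d * v P x) \<in> morley_local P"
    using morleyD(1)[OF u] morleyD(1)[OF v] ne by (auto intro!: morley_local_lin)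
  have 2: "\<forall>P\<in>T. \<forall>Q\<in>T. \<forall>w \<in> set P \<inter> set Q \<inter> D. c * u P w + d * v P w = c * u Q w + d * v Q w"
  proof (intro ballI)
    fix P Q w assume "P \<in> T" "Q \<in> T" "w \<in> set P \<inter> set Q \<inter> D"
    then show "c * u P w + d * v P w = c * u Q w + d * v Q w"
      using morleyD(2)[OF u, of P Q w] morleyD(2)[OF v, of P Q w] by simp
  qed
  have 3: "\<forall>P\<in>T. \<forall>w \<in> set P \<inter> frontier D. c * u P w + d * v P w = 0"
    using morleyD(3)[OF u] morleyD(3)[OF v] by simp
  have 4: "\<exists>g g'. normal_trace P a b (\<lambda>x. c * u P x + d * v P x) g \<and>
        normal_trace Q a b (\<lambda>x. c * u Q x + d * v Q x) g' \<and> edge_int a b (\<lambda>x. g x - g' x) = 0"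
    if PQ: "P \<in> T" "Q \<in> T" "P \<noteq> Q" "(a, b) \<in> (edges P \<union> (edges P)\<inverse>) \<inter> (edges Q \<union> (edges Q)\<inverse>)" for P Q a b
  proof -
    obtain g g' where g: "normal_trace P a b (u P) g" "normal_trace Q a b (u Q) g'" "edge_int a b (\<lambda>x. g x - g' x) = 0"
      using morleyD(4)[OF u PQ] by blast
    obtain k k' where k: "normal_trace P a b (v P) k" "normal_trace Q a b (v Q) k'" "edge_int a b (\<lambda>x. k x - k' x) = 0"
      using morleyD(4)[OF v PQ] by blast
    have "(\<lambda>x. g x - g' x) \<in> edge_L2 a b" "(\<lambda>x. k x - k' x) \<in> edge_L2 a b"
      using edge_L2_lin[OF normal_trace_edge_L2[OF g(1)] normal_trace_edge_L2[OF g(2)], of 1 "-1"]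
        edge_L2_lin[OF normal_trace_edge_L2[OF k(1)] normal_trace_edge_L2[OF k(2)], of 1 "-1"] by simp_all
    from edge_int_lin[OF this, of c d]
    have "edge_int a b (\<lambda>x. (c * g x + d * k x) - (c * g' x + d * k' x)) = 0"
      using g(3) k(3) by (simp add: algebra_simps)
    then show ?thesis
      using normal_trace_lin[OF H[OF PQ(1)] g(1) k(1), of c d] normal_trace_lin[OF H[OF PQ(2)] g(2) k(2), of c d]
      by blast
  qed
  have 5: "\<exists>g. normal_trace P a b (\<lambda>x. c * u P x + d * v P x) g \<and> edge_int a b g = 0"
    if P: "P \<in> T" "(a, b) \<in> edges P" "closed_segment a b \<subseteq> frontier D" for P a b
  proof -
    obtain g where g: "normal_trace P a b (u P) g" "edge_int a b g = 0"
      using morleyD(5)[OF u P] by blast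
    obtain k where k: "normal_trace P a b (v P) k" "edge_int a b k = 0"
      using morleyD(5)[OF v P] by blast
    show ?thesis
      using normal_trace_lin[OF H[OF P(1)] g(1) k(1), of c d]
        edge_int_lin[OF normal_trace_edge_L2[OF g(1)] normal_trace_edge_L2[OF k(1)], of c d] g(2) k(2)
      by auto
  qed
  show ?thesis
    unfolding morley_def mem_Collect_eq
    by (intro conjI 1 2 3 ballI impI) (use 4 5 in auto)
qed

lemma Phi_lin:
  assumes D: "bdd_open D" and u: "u \<in> Phi D" and v: "v \<in> Phi D"
  shows "(\<lambda>x. c * u x + d * v x) \<in> Phi D"
proof -
  have H: "u \<in> H2 D" "v \<in> H2 D" using u v by (auto simp: Phi_def)
  note L = H2_lin[OF D H, of c d]
  have "trace_on D a b (\<lambda>x. c * u x + d * v x) (\<lambda>x. 0) \<and>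
      trace_on D a b (\<lambda>x. grad D (\<lambda>x. c * u x + d * v x) x \<bullet> edge_normal a b) (\<lambda>x. 0)"
    if ab: "a \<noteq> b" "closed_segment a b \<subseteq> frontier D" for a b
  proof -
    have t: "trace_on D a b u (\<lambda>x. 0)" "trace_on D a b (\<lambda>x. grad D u x \<bullet> edge_normal a b) (\<lambda>x. 0)"
      "trace_on D a b v (\<lambda>x. 0)" "trace_on D a b (\<lambda>x. grad D v x \<bullet> edge_normal a b) (\<lambda>x. 0)"
      using u v ab by (auto simp: Phi_def)
    show ?thesis
      using trace_on_lin[OF D t(1) t(3) H2_L2[OF L], of c d]
        trace_on_lin[OF D t(2) t(4) grad_inner_L2[OF L] grad_inner_lin[OF D H]] by simp
  qed
  then show ?thesis using L by (simp add: Phi_def)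
qed

section \<open>Energy estimates on one element\<close>

text \<open>Only semidefiniteness on a two-dimensional span is assumed, so that the Hessian form,
  which vanishes on affine functions, and the stabilization are both covered.\<close>

lemma quadratic_form_Cauchy_Schwarz:
  assumes pos: "\<And>s t :: real. 0 \<le> s\<^sup>2 * A + 2 * s * t * B + t\<^sup>2 * C"
  shows "\<bar>B\<bar> \<le> sqrt A * sqrt C"
proof -
  have AC: "0 \<le> A" "0 \<le> C" using pos[of 1 0] pos[of 0 1] by auto
  have "B\<^sup>2 \<le> A * C"
  proof (cases "C = 0")
    case True
    have "B = 0"
    proof (rule ccontr)
      assume "B \<noteq> 0"
      \<comment> \<open>With C = 0 this choice gives the form the value A - (A + 1) = -1.\<close>
      then show False using pos[of 1 "- (A + 1) / (2 * B)"] AC True by (simp add: field_simps)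
    qed
    then show ?thesis using True by simp
  next
    case False
    \<comment> \<open>At s = C and t = -B the form equals C times the discriminant
      expression.\<close>
    have "0 \<le> C * (A * C - B\<^sup>2)"
      using pos[of C "- B"] by (simp add: power2_eq_square algebra_simps)
    then show ?thesis using False AC(2) by (simp add: zero_le_mult_iff)
  qed
  then have "sqrt (B\<^sup>2) \<le> sqrt (A * C)" by (rule real_sqrt_le_mono)
  then show ?thesis by (simp only: real_sqrt_abs real_sqrt_mult)
qed

lemma quadratic_form_upper:
  fixes a b c d h :: real
  assumes "\<bar>h\<bar> \<le> a * b"
  shows "c\<^sup>2 * (a * a) + 2 * c * d * h + d\<^sup>2 * (b * b) \<le> (\<bar>c\<bar> * a + \<bar>d\<bar> * b)\<^sup>2"
proof -
  have "c * d * h \<le> \<bar>c * d * h\<bar>" by simp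
  also have "\<dots> \<le> \<bar>c\<bar> * \<bar>d\<bar> * (a * b)"
    unfolding abs_mult by (intro mult_left_mono assms) auto
  finally have "c * d * h \<le> \<bar>c\<bar> * \<bar>d\<bar> * (a * b)" .
  moreover have "(\<bar>c\<bar> * a + \<bar>d\<bar> * b)\<^sup>2 = c\<^sup>2 * (a * a) + 2 * (\<bar>c\<bar> * \<bar>d\<bar> * (a * b)) + d\<^sup>2 * (b * b)"
    by (simp add: power2_sum power_mult_distrib power2_eq_square[of a] power2_eq_square[of b])
  ultimately show ?thesis by simp
qed

lemma hess_form_lin2:
  assumes D: "bdd_open D" and u: "u \<in> H2 D" "v \<in> H2 D"
  shows "hess_form D (\<lambda>x. s * u x + t * v x) (\<lambda>x. s * u x + t * v x)
    = s\<^sup>2 * hess_form D u u + 2 * s * t * hess_form D u v + t\<^sup>2 * hess_form D v v"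
proof -
  note w = H2_lin[OF D u, of s t]
  have "hess_form D u (\<lambda>x. s * u x + t * v x) = s * hess_form D u u + t * hess_form D u v"
    "hess_form D v (\<lambda>x. s * u x + t * v x) = s * hess_form D u v + t * hess_form D v v"
    using hess_form_lin[OF D u u(1), of s t] hess_form_lin[OF D u u(2), of s t]
    by (simp_all add: hess_form_sym)
  then show ?thesis
    unfolding hess_form_lin[OF D u w] by (simp add: power2_eq_square algebra_simps)
qed

lemma hess_form_Cauchy_Schwarz:
  assumes D: "bdd_open D" and u: "u \<in> H2 D" "v \<in> H2 D"
  shows "\<bar>hess_form D u v\<bar> \<le> H2semi D u * H2semi D v"
  unfolding H2semi_def
proof (rule quadratic_form_Cauchy_Schwarz)
  show "0 \<le> s\<^sup>2 * hess_form D u u + 2 * s * t * hess_form D u v + t\<^sup>2 * hess_form D v v" for s t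
    unfolding hess_form_lin2[OF D u, of s t, symmetric] by (rule hess_form_nonneg)
qed

lemma H2semi_nonneg: "0 \<le> H2semi D u"
  by (simp add: H2semi_def hess_form_nonneg)

lemma H2semi_square: "H2semi D u * H2semi D u = hess_form D u u"
  by (simp add: H2semi_def hess_form_nonneg)

lemma H2semi_lin_le:
  assumes D: "bdd_open D" and u: "u \<in> H2 D" "v \<in> H2 D"
  shows "H2semi D (\<lambda>x. c * u x + d * v x) \<le> \<bar>c\<bar> * H2semi D u + \<bar>d\<bar> * H2semi D v"
proof -
  have "hess_form D (\<lambda>x. c * u x + d * v x) (\<lambda>x. c * u x + d * v x)
      \<le> (\<bar>c\<bar> * H2semi D u + \<bar>d\<bar> * H2semi D v)\<^sup>2"
    unfolding hess_form_lin2[OF D u] unfolding H2semi_square[symmetric]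
    by (rule quadratic_form_upper[OF hess_form_Cauchy_Schwarz[OF D u]])
  then show ?thesis
    unfolding H2semi_def[of D "\<lambda>x. c * u x + d * v x"]
    by (intro real_le_lsqrt) (simp_all add: H2semi_nonneg)
qed

lemma H2semi_diff_le:
  assumes "bdd_open D" "u \<in> H2 D" "v \<in> H2 D"
  shows "H2semi D (\<lambda>x. u x - v x) \<le> H2semi D u + H2semi D v"
  using H2semi_lin_le[OF assms, of 1 "-1"] by simp

lemma H2_diff: "bdd_open D \<Longrightarrow> u \<in> H2 D \<Longrightarrow> v \<in> H2 D \<Longrightarrow> (\<lambda>x. u x - v x) \<in> H2 D"
  using H2_lin[of D u v 1 "-1"] by simp

lemma hess_form_diff:
  assumes "bdd_open D" "u \<in> H2 D" "v \<in> H2 D" "w \<in> H2 D"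
  shows "hess_form D (\<lambda>x. u x - v x) w = hess_form D u w - hess_form D v w"
  using hess_form_lin[OF assms, of 1 "-1"] by simp

lemma PiD_in_polys: "region P \<noteq> {} \<Longrightarrow> u \<in> H2 (region P) \<Longrightarrow> PiD P u \<in> polys 2"
  using PiD_works by (simp add: is_PiD_def)

lemma PiD_in_H2: "region P \<noteq> {} \<Longrightarrow> u \<in> H2 (region P) \<Longrightarrow> PiD P u \<in> H2 (region P)"
  by (simp add: PiD_in_polys polys_2_H2 bdd_open_region)

lemma hess_form_PiD:
  "region P \<noteq> {} \<Longrightarrow> u \<in> H2 (region P) \<Longrightarrow> r \<in> polys 2 \<Longrightarrow>
    hess_form (region P) (PiD P u) r = hess_form (region P) u r"
  using PiD_works by (simp add: is_PiD_def)

text \<open>The error w = u - \<open>PiD\<close> u is orthogonal to all quadratic polynomials in the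
  Hessian form, so its energy equals the form of u - r with w for every such r; then
  Cauchy-Schwarz.\<close>

lemma PiD_best_approximation:
  assumes ne: "region P \<noteq> {}" and u: "u \<in> H2 (region P)" and r: "r \<in> polys 2"
  shows "H2semi (region P) (\<lambda>x. u x - PiD P u x) \<le> H2semi (region P) (\<lambda>x. u x - r x)"
proof -
  note D = bdd_open_region[of P]
  let ?D = "region P"
  let ?w = "\<lambda>x. u x - PiD P u x"
  note p = PiD_in_polys[OF ne u] PiD_in_H2[OF ne u]
  have w: "?w \<in> H2 ?D" by (intro H2_diff D u p)
  have rr: "r \<in> H2 ?D" by (intro polys_2_H2 D r)
  have orth: "hess_form ?D s ?w = 0" if "s \<in> polys 2" for s
    using hess_form_diff[OF D u p(2) polys_2_H2[OF D that]] hess_form_PiD[OF ne u that]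
    by (simp add: hess_form_sym)
  have "H2semi ?D ?w * H2semi ?D ?w = hess_form ?D u ?w - hess_form ?D (PiD P u) ?w"
    unfolding H2semi_square by (rule hess_form_diff[OF D u p(2) w])
  also have "\<dots> = hess_form ?D (\<lambda>x. u x - r x) ?w"
    using orth[OF p(1)] orth[OF r] hess_form_diff[OF D u rr w] by simp
  also have "\<dots> \<le> H2semi ?D (\<lambda>x. u x - r x) * H2semi ?D ?w"
    using hess_form_Cauchy_Schwarz[OF D H2_diff[OF D u rr] w] by simp
  finally have le: "H2semi ?D ?w * H2semi ?D ?w
      \<le> H2semi ?D (\<lambda>x. u x - r x) * H2semi ?D ?w" .
  show ?thesis
  proof (cases "H2semi ?D ?w = 0")
    case True
    then show ?thesis using H2semi_nonneg[of "region P" "\<lambda>x. u x - r x"] by simp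
  next
    case False
    then have "0 < H2semi ?D ?w" using H2semi_nonneg[of "region P" ?w] by simp
    then show ?thesis by (rule mult_right_le_imp_le[OF le])
  qed
qed

section \<open>The stabilization on the kernel of the quadratic projection, and consistency on an
  element\<close>

lemma stabilization_lin:
  assumes ne: "region P \<noteq> {}" and P: "P \<in> T" and S: "stabilization c1 c2 T S"
    and m: "f \<in> morley_local P" "g \<in> morley_local P" "w \<in> morley_local P"
  shows "S P (\<lambda>x. s * f x + t * g x) w = s * S P f w + t * S P g w"
proof -
  have add: "S P (\<lambda>x. f x + g x) w = S P f w + S P g w"
    if "f \<in> morley_local P" "g \<in> morley_local P" "w \<in> morley_local P" for f g w
    using S P that unfolding stabilization_def by blast
  have scale: "S P (\<lambda>x. c * f x) w = c * S P f w" if "f \<in> morley_local P" "w \<in> morley_local P" for c f w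
    using S P that unfolding stabilization_def by blast
  have scaled: "(\<lambda>x. c * f x) \<in> morley_local P" if "f \<in> morley_local P" for c f
    using morley_local_lin[OF ne that that, of c 0] by simp
  show ?thesis
    using scale[OF m(1,3)] scale[OF m(2,3)] add[OF scaled[OF m(1)] scaled[OF m(2)] m(3)] by simp
qed

text \<open>Symmetry and positivity on the local space give Cauchy-Schwarz for \<open>S\<close>;
  membership in the kernel of \<open>PiD\<close> then allows both factors to be compared with the
  Hessian form.\<close>

lemma stabilization_Cauchy_Schwarz:
  assumes ne: "region P \<noteq> {}" and P: "P \<in> T" and S: "stabilization c1 c2 T S" and c2: "0 < c2"
    and u: "u \<in> morley_local P" "PiD P u = (\<lambda>x. 0)" and v: "v \<in> morley_local P" "PiD P v = (\<lambda>x. 0)"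
  shows "\<bar>S P u v\<bar> \<le> c2 * H2semi (region P) u * H2semi (region P) v"
proof -
  have sym: "S P f g = S P g f" if "f \<in> morley_local P" "g \<in> morley_local P" for f g
    using S P that unfolding stabilization_def by blast
  have cong: "S P f w = S P g w"
    if "f \<in> morley_local P" "g \<in> morley_local P" "w \<in> morley_local P" "\<forall>x\<in>closure (region P). f x = g x" for f g w
    using S P that unfolding stabilization_def by blast
  have pos: "0 < S P f f" if "f \<in> morley_local P" "\<exists>x\<in>closure (region P). f x \<noteq> 0" for f
    using S P that unfolding stabilization_def by blast
  have upper: "S P f f \<le> c2 * hess_form (region P) f f" if "f \<in> morley_local P" "PiD P f = (\<lambda>x. 0)" for f
    using S P that unfolding stabilization_def by blast
  note lin = stabilization_lin[where S=S, OF ne P S]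
  \<comment> \<open>Positivity is assumed only for functions that are nonzero on the closed element.
    A function vanishing there may be replaced by the zero combination, because \<open>S\<close>
    depends only on restrictions to the element.\<close>
  have nonneg: "0 \<le> S P f f" if f: "f \<in> morley_local P" for f
  proof (cases "\<exists>x\<in>closure (region P). f x \<noteq> 0")
    case False
    then have "S P f f = S P (\<lambda>x. 0 * f x + 0 * f x) f"
      using f by (intro cong morley_local_lin ne) auto
    then show ?thesis using lin[OF f f f, of 0 0] by simp
  qed (use pos[OF f] in auto)
  have "0 \<le> s\<^sup>2 * S P u u + 2 * s * t * S P u v + t\<^sup>2 * S P v v" for s t
  proof -
    let ?w = "\<lambda>x. s * u x + t * v x"
    have w: "?w \<in> morley_local P" by (rule morley_local_lin[OF ne u(1) v(1)])
    have "S P ?w ?w = s * S P ?w u + t * S P ?w v"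
      using lin[OF u(1) v(1) w, of s t] sym[OF w u(1)] sym[OF w v(1)] by simp
    also have "\<dots> = s * (s * S P u u + t * S P u v) + t * (s * S P u v + t * S P v v)"
      using lin[OF u(1) v(1) u(1), of s t] lin[OF u(1) v(1) v(1), of s t] sym[OF u(1) v(1)] by simp
    finally show ?thesis using nonneg[OF w] by (simp add: power2_eq_square algebra_simps)
  qed
  then have "\<bar>S P u v\<bar> \<le> sqrt (S P u u) * sqrt (S P v v)" by (rule quadratic_form_Cauchy_Schwarz)
  also have "\<dots> \<le> sqrt (c2 * hess_form (region P) u u) * sqrt (c2 * hess_form (region P) v v)"
    using upper[OF u] upper[OF v] nonneg[OF u(1)] nonneg[OF v(1)] hess_form_nonneg c2
    by (intro mult_mono) auto
  also have "\<dots> = c2 * H2semi (region P) u * H2semi (region P) v"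
    using c2 by (simp add: real_sqrt_mult H2semi_def)
  finally show ?thesis .
qed

text \<open>\<open>PiD\<close> is linear and fixes quadratic polynomials. These two facts make the
  remainder admissible in the kernel bounds of the stabilization.\<close>

lemma PiD_kernel:
  assumes ne: "region P \<noteq> {}" and u: "u \<in> morley_local P"
  shows "(\<lambda>x. u x - PiD P u x) \<in> morley_local P" "PiD P (\<lambda>x. u x - PiD P u x) = (\<lambda>x. 0)"
proof -
  note H = morley_local_H2[OF u]
  note p = PiD_in_polys[OF ne H]
  show "(\<lambda>x. u x - PiD P u x) \<in> morley_local P"
    using morley_local_lin[OF ne u polys_2_morley_local[OF ne p], of 1 "-1"] by simp
  show "PiD P (\<lambda>x. u x - PiD P u x) = (\<lambda>x. 0)"
    using PiD_lin[OF ne H PiD_in_H2[OF ne H], of 1 "-1"] PiD_polys[OF ne p] by simp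
qed

text \<open>Since \<open>PiD\<close> u is a polynomial, \<open>PiD\<close> v may be replaced by v in
  the Hessian form, leaving the form of \<psi> - \<open>PiD\<close> u with v. Best approximation and
  the triangle inequality bound u - \<open>PiD\<close> u by the two errors together, and \<psi> -
  \<open>PiD\<close> u by twice their sum. This is the origin of the 2; c2 comes from the
  stabilization.\<close>

lemma element_consistency:
  assumes ne: "region P \<noteq> {}" and P: "P \<in> T" and S: "stabilization c1 c2 T S" and c2: "0 < c2"
    and u: "u \<in> morley_local P" and v: "v \<in> morley_local P" and \<psi>: "\<psi> \<in> H2 (region P)" and r: "r \<in> polys 2"
  shows "\<bar>hess_form (region P) \<psi> v - (hess_form (region P) (PiD P u) (PiD P v)
        + S P (\<lambda>x. u x - PiD P u x) (\<lambda>x. v x - PiD P v x))\<bar>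
     \<le> (2 + c2) * (H2semi (region P) (\<lambda>x. \<psi> x - u x) + H2semi (region P) (\<lambda>x. \<psi> x - r x)) * H2semi (region P) v"
proof -
  note D = bdd_open_region[of P]
  let ?D = "region P"
  let ?n = "H2semi ?D"
  note Hu = morley_local_H2[OF u] and Hv = morley_local_H2[OF v]
  note pu = PiD_in_polys[OF ne Hu] and pv = PiD_in_polys[OF ne Hv]
  note Hpu = PiD_in_H2[OF ne Hu] and Hr = polys_2_H2[OF D r]
  let ?X = "?n (\<lambda>x. \<psi> x - u x)" and ?Y = "?n (\<lambda>x. \<psi> x - r x)"
  have "?n (\<lambda>x. u x - r x) = ?n (\<lambda>x. (\<psi> x - r x) - (\<psi> x - u x))" by simp
  also have "\<dots> \<le> ?Y + ?X" by (intro H2semi_diff_le H2_diff D \<psi> Hu Hr)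
  finally have up: "?n (\<lambda>x. u x - PiD P u x) \<le> ?X + ?Y"
    using PiD_best_approximation[OF ne Hu r] by simp
  have "?n (\<lambda>x. \<psi> x - PiD P u x) = ?n (\<lambda>x. 1 * (\<psi> x - u x) + 1 * (u x - PiD P u x))" by simp
  also have "\<dots> \<le> ?X + ?n (\<lambda>x. u x - PiD P u x)"
    using H2semi_lin_le[OF D H2_diff[OF D \<psi> Hu] H2_diff[OF D Hu Hpu], of 1 1] by simp
  finally have \<psi>p: "?n (\<lambda>x. \<psi> x - PiD P u x) \<le> 2 * (?X + ?Y)"
    using up H2semi_nonneg[of "region P" "\<lambda>x. \<psi> x - r x"] by simp
  \<comment> \<open>The zero polynomial as competitor in the best approximation shows that the
    remainder of v is no larger than v.\<close>
  have z: "(\<lambda>_. 0) \<in> polys 2" using polys_0_subset_2 polys_0_iff by blast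
  have vp: "?n (\<lambda>x. v x - PiD P v x) \<le> ?n v"
    using PiD_best_approximation[OF ne Hv z] by simp
  have "hess_form ?D (PiD P u) (PiD P v) = hess_form ?D (PiD P u) v"
    using hess_form_PiD[OF ne Hv pu] by (simp add: hess_form_sym)
  then have "hess_form ?D \<psi> v - hess_form ?D (PiD P u) (PiD P v)
      = hess_form ?D (\<lambda>x. \<psi> x - PiD P u x) v"
    using hess_form_diff[OF D \<psi> Hpu Hv] by simp
  moreover have "\<bar>hess_form ?D (\<lambda>x. \<psi> x - PiD P u x) v\<bar> \<le> 2 * (?X + ?Y) * ?n v"
    using hess_form_Cauchy_Schwarz[OF D H2_diff[OF D \<psi> Hpu] Hv] mult_right_mono[OF \<psi>p H2semi_nonneg[of "region P" v]]
    by linarith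
  moreover have "\<bar>S P (\<lambda>x. u x - PiD P u x) (\<lambda>x. v x - PiD P v x)\<bar> \<le> c2 * (?X + ?Y) * ?n v"
  proof -
    have "\<bar>S P (\<lambda>x. u x - PiD P u x) (\<lambda>x. v x - PiD P v x)\<bar>
        \<le> c2 * ?n (\<lambda>x. u x - PiD P u x) * ?n (\<lambda>x. v x - PiD P v x)"
      by (intro stabilization_Cauchy_Schwarz[OF ne P S c2] PiD_kernel ne u v)
    also have "\<dots> \<le> c2 * (?X + ?Y) * ?n v"
      using up vp c2 by (intro mult_mono) (auto simp: H2semi_nonneg)
    finally show ?thesis .
  qed
  ultimately show ?thesis by (simp add: algebra_simps)
qed

section \<open>The broken seminorm\<close>

text \<open>Gives access to the finite Minkowski and Cauchy-Schwarz inequalities for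
  \<open>L2_set\<close>.\<close>

lemma br_seminorm_L2_set: "br_seminorm T u = L2_set (\<lambda>P. H2semi (region P) (u P)) T"
  by (simp add: br_seminorm_def L2_set_def)

lemma br_seminorm_nonneg: "0 \<le> br_seminorm T u"
  by (simp add: br_seminorm_L2_set L2_set_nonneg)

lemma br_seminorm_diff_le:
  assumes "\<And>P. P \<in> T \<Longrightarrow> u P \<in> H2 (region P)" "\<And>P. P \<in> T \<Longrightarrow> v P \<in> H2 (region P)"
  shows "br_seminorm T (br_diff u v) \<le> br_seminorm T u + br_seminorm T v"
proof -
  have "br_seminorm T (br_diff u v) \<le> L2_set (\<lambda>P. H2semi (region P) (u P) + H2semi (region P) (v P)) T"
    unfolding br_seminorm_L2_set br_diff_def
    by (intro L2_set_mono H2semi_diff_le bdd_open_region assms H2semi_nonneg)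
  also have "\<dots> \<le> br_seminorm T u + br_seminorm T v"
    unfolding br_seminorm_L2_set by (rule L2_set_triangle_ineq)
  finally show ?thesis .
qed

lemma H2semi_zero:
  assumes D: "bdd_open D" and u: "u \<in> L2 D" "\<And>x. x \<in> D \<Longrightarrow> u x = 0"
  shows "H2semi D u = 0"
proof -
  have z: "(\<lambda>_. 0) \<in> H2 D" by (intro H2_smooth D smooth_fun_const)
  have "wd D j u = wd D j (\<lambda>_. 0)" for j
    using u by (intro wd_cong_AE D H2_L2[OF z] AE_I2) auto
  then have "hess_form D u u = hess_form D (\<lambda>_. 0) (\<lambda>_. 0)"
    by (simp add: hess_form_def hess_def)
  then show ?thesis
    using hess_form_lin[OF D z z z, of 0 0] by (simp add: H2semi_def)
qed

text \<open>Used in contrapositive form: a member of the space with nonzero seminorm belongs to the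
  index set of the suprema.\<close>

lemma br_seminorm_zero:
  assumes "\<And>P. P \<in> T \<Longrightarrow> u P \<in> H2 (region P)" "br_zero T u"
  shows "br_seminorm T u = 0"
proof -
  have "H2semi (region P) (u P) = 0" if P: "P \<in> T" for P
    using assms(2) P closure_subset[of "region P"]
    by (intro H2semi_zero bdd_open_region H2_L2 assms(1)) (auto simp: br_zero_def)
  then show ?thesis by (simp add: br_seminorm_def)
qed

text \<open>The Hessian chosen on an element agrees almost everywhere with the one chosen on
  \<open>D\<close>, and the elements are disjoint, so the elementwise energies add up to at most the
  energy on \<open>D\<close>. This replaces the broken seminorm of \<psi> by a number that does not
  depend on the mesh.\<close>

lemma br_seminorm_restrict_le:
  assumes D: "bdd_open D" and fin: "finite T" and sub: "\<And>P. P \<in> T \<Longrightarrow> region P \<subseteq> D"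
    and dis: "\<And>P Q. P \<in> T \<Longrightarrow> Q \<in> T \<Longrightarrow> P \<noteq> Q \<Longrightarrow> region P \<inter> region Q = {}"
    and u: "u \<in> H2 D"
  shows "br_seminorm T (\<lambda>_. u) \<le> H2semi D u"
proof -
  define g where "g x = (\<Sum>i\<in>UNIV. \<Sum>j\<in>UNIV. hess D i j u x * hess D i j u x)" for x
  have g0: "0 \<le> g x" for x unfolding g_def by (intro sum_nonneg) auto
  have gi: "integrable (lebesgue_on E) g" if "E \<subseteq> D" "bdd_open E" for E
    unfolding g_def using H2_hess_L2[OF u] L2_restrict[OF _ that(1) D that(2)]
    by (intro Bochner_Integration.integrable_sum L2_mult_integrable) auto
  have hP: "hess_form (region P) u u = (LINT x|lebesgue. (if x \<in> region P then g x else 0))" if P: "P \<in> T" for P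
  proof -
    note E = sub[OF P] D bdd_open_region[of P]
    have "AE x in lebesgue_on (region P). \<forall>i j. hess (region P) i j u x = hess D i j u x"
      using hess_restrict[OF E u] by (simp add: AE_all_countable)
    then have "AE x in lebesgue_on (region P).
        (\<Sum>i\<in>UNIV. \<Sum>j\<in>UNIV. hess (region P) i j u x * hess (region P) i j u x) = g x"
      by eventually_elim (simp add: g_def)
    moreover have "integrable (lebesgue_on (region P))
        (\<lambda>x. \<Sum>i\<in>UNIV. \<Sum>j\<in>UNIV. hess (region P) i j u x * hess (region P) i j u x)"
      using H2_hess_L2[OF H2_restrict[OF E u]]
      by (intro Bochner_Integration.integrable_sum L2_mult_integrable) auto
    ultimately have "hess_form (region P) u u = (LINT x|lebesgue_on (region P). g x)"
      unfolding hess_form_def using gi[OF E(1,3)] by (intro integral_cong_AE) auto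
    then show ?thesis
      using Lebesgue_Measure.integral_restrict_UNIV[OF bdd_open_sets[OF E(3)], of g] by simp
  qed
  have iP: "integrable lebesgue (\<lambda>x. if x \<in> E then g x else 0)" if "E \<subseteq> D" "bdd_open E" for E
    using gi[OF that] Lebesgue_Measure.integrable_restrict_UNIV[OF bdd_open_sets[OF that(2)], of g] by simp
  have "(\<Sum>P\<in>T. hess_form (region P) u u) = (LINT x|lebesgue. (\<Sum>P\<in>T. if x \<in> region P then g x else 0))"
    using hP iP[OF sub bdd_open_region] by simp
  also have "\<dots> \<le> (LINT x|lebesgue. (if x \<in> D then g x else 0))"
  proof (intro integral_mono Bochner_Integration.integrable_sum iP sub bdd_open_region D order.refl)
    fix x
    show "(\<Sum>P\<in>T. if x \<in> region P then g x else 0) \<le> (if x \<in> D then g x else 0)"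
    proof (cases "\<exists>P\<in>T. x \<in> region P")
      case True
      then obtain P where P: "P \<in> T" "x \<in> region P" by blast
      \<comment> \<open>By disjointness only the element containing the point contributes.\<close>
      have "(\<Sum>Q\<in>T. if x \<in> region Q then g x else 0) = (\<Sum>Q\<in>T. if P = Q then g x else 0)"
        using P dis by (intro sum.cong) auto
      then show ?thesis using P sub fin by auto
    next
      case False
      then show ?thesis using g0 by auto
    qed
  qed
  also have "\<dots> = hess_form D u u"
    using Lebesgue_Measure.integral_restrict_UNIV[OF bdd_open_sets[OF D], of g]
    by (simp add: hess_form_def g_def[abs_def])
  finally show ?thesis
    by (simp add: br_seminorm_def H2semi_def hess_form_nonneg)
qed

section \<open>The discrete convection form\<close>

definition B_elem :: "pt set \<Rightarrow> (pt \<Rightarrow> real) \<Rightarrow> (pt \<Rightarrow> real) \<Rightarrow> (pt \<Rightarrow> real) \<Rightarrow> real" where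
  "B_elem D z u v = (LINT x|lebesgue_on D. L2proj D 0 (lap D z) x *
      (L2projv D 1 (curl D u) x \<bullet> L2projv D 1 (grad D v) x))"

lemma B_h_elem: "B_h T z u v = (\<Sum>P\<in>T. B_elem (region P) (z P) (u P) (v P))"
  by (simp add: B_h_def B_elem_def)

lemma grad_nth_L2: "u \<in> H2 D \<Longrightarrow> (\<lambda>x. grad D u x $ k) \<in> L2 D"
  by (simp add: grad_def H2_wd_L2)

text \<open>The projections are polynomials, so the integrand is smooth on a bounded set.\<close>

lemma B_elem_integrable:
  assumes D: "bdd_open D" "D \<noteq> {}" and H: "z \<in> H2 D" "u \<in> H2 D" "v \<in> H2 D"
  shows "integrable (lebesgue_on D) (\<lambda>x. L2proj D 0 (lap D z) x *
      (L2projv D 1 (curl D u) x \<bullet> L2projv D 1 (grad D v) x))"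
proof -
  have "smooth_fun (L2proj D 0 (lap D z))" "smooth_fun (L2proj D 1 (\<lambda>x. curl D u x $ k))"
    "smooth_fun (L2proj D 1 (\<lambda>x. grad D v x $ k))" for k
    using H by (auto intro!: smooth_fun_polys L2proj_polys_2 D lap_L2 curl_L2 grad_nth_L2)
  then have "smooth_fun (\<lambda>x. L2proj D 0 (lap D z) x *
      (L2projv D 1 (curl D u) x \<bullet> L2projv D 1 (grad D v) x))"
    unfolding inner_vec_def sum_2 L2projv_def
    by (simp, intro smooth_fun_mult smooth_fun_add) auto
  then show ?thesis by (intro L2_integrable L2_smooth D)
qed

lemma L2projv_lin:
  assumes D: "bdd_open D" "D \<noteq> {}"
    and v: "\<And>k. (\<lambda>x. v x $ k) \<in> L2 D" "\<And>k. (\<lambda>x. v' x $ k) \<in> L2 D" "\<And>k. (\<lambda>x. w x $ k) \<in> L2 D"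
    and w: "AE x in lebesgue_on D. w x = c *\<^sub>R v x + d *\<^sub>R v' x"
  shows "L2projv D 1 w x = c *\<^sub>R L2projv D 1 v x + d *\<^sub>R L2projv D 1 v' x"
proof -
  have "L2proj D 1 (\<lambda>x. w x $ k) = (\<lambda>x. c * L2proj D 1 (\<lambda>x. v x $ k) x + d * L2proj D 1 (\<lambda>x. v' x $ k) x)" for k
  proof (rule L2proj_lin[OF D order.refl v(1) v(2) v(3)])
    show "AE x in lebesgue_on D. w x $ k = c * v x $ k + d * v' x $ k"
      using w by eventually_elim simp
  qed
  then show ?thesis by (simp add: L2projv_def vec_eq_iff)
qed

lemma B_elem_lin_1:
  assumes D: "bdd_open D" "D \<noteq> {}" and H: "z \<in> H2 D" "z' \<in> H2 D" "u \<in> H2 D" "v \<in> H2 D"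
  shows "B_elem D (\<lambda>x. c * z x + d * z' x) u v = c * B_elem D z u v + d * B_elem D z' u v"
proof -
  have "L2proj D 0 (lap D (\<lambda>x. c * z x + d * z' x)) = (\<lambda>x. c * L2proj D 0 (lap D z) x + d * L2proj D 0 (lap D z') x)"
    by (intro L2proj_lin D lap_L2 lap_lin H2_lin H) auto
  then show ?thesis
    using B_elem_integrable[OF D H(1,3,4)] B_elem_integrable[OF D H(2,3,4)]
    by (simp add: B_elem_def distrib_right mult.assoc)
qed

lemma B_elem_lin_2:
  assumes D: "bdd_open D" "D \<noteq> {}" and H: "z \<in> H2 D" "u \<in> H2 D" "u' \<in> H2 D" "v \<in> H2 D"
  shows "B_elem D z (\<lambda>x. c * u x + d * u' x) v = c * B_elem D z u v + d * B_elem D z u' v"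
proof -
  have "L2projv D 1 (curl D (\<lambda>x. c * u x + d * u' x)) x
      = c *\<^sub>R L2projv D 1 (curl D u) x + d *\<^sub>R L2projv D 1 (curl D u') x" for x
    by (intro L2projv_lin D curl_L2 curl_lin H2_lin H)
  then show ?thesis
    using B_elem_integrable[OF D H(1,2,4)] B_elem_integrable[OF D H(1,3,4)]
    by (simp add: B_elem_def inner_add_left distrib_left mult.left_commute)
qed

text \<open>The projection commutes with the rotation taking gradients to curls, so the projected curl
  and the projected gradient of the same function are orthogonal pointwise.\<close>
lemma B_elem_skew:
  assumes D: "bdd_open D" "D \<noteq> {}" and u: "u \<in> H2 D"
  shows "B_elem D z u u = 0"
proof -
  have neg: "L2proj D 1 (\<lambda>x. - wd D 1 u x) = (\<lambda>x. - L2proj D 1 (wd D 1 u) x)"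
    using L2proj_lin[OF D order.refl H2_wd_L2[OF u] H2_wd_L2[OF u], of "\<lambda>x. - wd D 1 u x" "-1" 1 0 1]
      L2_lin[OF H2_wd_L2[OF u, of 1] H2_wd_L2[OF u, of 1], of "-1" 0] by simp
  have g: "(\<lambda>x. grad D u x $ k) = wd D k u" for k by (simp add: grad_def)
  have "L2projv D 1 (curl D u) x \<bullet> L2projv D 1 (grad D u) x = 0" for x
    unfolding inner_vec_def sum_2 L2projv_def vec_lambda_beta curl_nth g neg by simp
  then show ?thesis by (simp add: B_elem_def)
qed

lemma B_h_diff_1:
  assumes ne: "\<And>P. P \<in> T \<Longrightarrow> region P \<noteq> {}"
    and H: "\<And>P. P \<in> T \<Longrightarrow> z P \<in> H2 (region P)" "\<And>P. P \<in> T \<Longrightarrow> z' P \<in> H2 (region P)"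
      "\<And>P. P \<in> T \<Longrightarrow> u P \<in> H2 (region P)" "\<And>P. P \<in> T \<Longrightarrow> v P \<in> H2 (region P)"
  shows "B_h T (br_diff z z') u v = B_h T z u v - B_h T z' u v"
proof -
  have "B_elem (region P) (br_diff z z' P) (u P) (v P)
      = B_elem (region P) (z P) (u P) (v P) - B_elem (region P) (z' P) (u P) (v P)" if P: "P \<in> T" for P
    using B_elem_lin_1[OF bdd_open_region ne[OF P] H[OF P], of 1 "-1"] by (simp add: br_diff_def)
  then show ?thesis by (simp add: B_h_elem sum_subtractf)
qed

lemma B_h_diff_2:
  assumes ne: "\<And>P. P \<in> T \<Longrightarrow> region P \<noteq> {}"
    and H: "\<And>P. P \<in> T \<Longrightarrow> z P \<in> H2 (region P)" "\<And>P. P \<in> T \<Longrightarrow> u P \<in> H2 (region P)"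
      "\<And>P. P \<in> T \<Longrightarrow> u' P \<in> H2 (region P)" "\<And>P. P \<in> T \<Longrightarrow> v P \<in> H2 (region P)"
  shows "B_h T z (br_diff u u') v = B_h T z u v - B_h T z u' v"
proof -
  have "B_elem (region P) (z P) (br_diff u u' P) (v P)
      = B_elem (region P) (z P) (u P) (v P) - B_elem (region P) (z P) (u' P) (v P)" if P: "P \<in> T" for P
    using B_elem_lin_2[OF bdd_open_region ne[OF P] H[OF P], of 1 "-1"] by (simp add: br_diff_def)
  then show ?thesis by (simp add: B_h_elem sum_subtractf)
qed

lemma B_h_skew:
  assumes "\<And>P. P \<in> T \<Longrightarrow> region P \<noteq> {}" "\<And>P. P \<in> T \<Longrightarrow> u P \<in> H2 (region P)"
  shows "B_h T z u u = 0"
  unfolding B_h_elem using assms by (intro sum.neutral ballI B_elem_skew bdd_open_region)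

section \<open>The discrete bilinear form\<close>

lemma A_h_diff:
  assumes ne: "\<And>P. P \<in> T \<Longrightarrow> region P \<noteq> {}" and S: "stabilization c1 c2 T S"
    and u: "u \<in> morley D T" and v: "v \<in> morley D T" and w: "w \<in> morley D T"
  shows "A_h S T (br_diff u v) w = A_h S T u w - A_h S T v w"
proof -
  have "hess_form (region P) (PiD P (br_diff u v P)) (PiD P (w P))
      + S P (\<lambda>x. br_diff u v P x - PiD P (br_diff u v P) x) (\<lambda>x. w P x - PiD P (w P) x)
    = (hess_form (region P) (PiD P (u P)) (PiD P (w P))
      + S P (\<lambda>x. u P x - PiD P (u P) x) (\<lambda>x. w P x - PiD P (w P) x))
      - (hess_form (region P) (PiD P (v P)) (PiD P (w P))
      + S P (\<lambda>x. v P x - PiD P (v P) x) (\<lambda>x. w P x - PiD P (w P) x))" if P: "P \<in> T" for P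
  proof -
    note m = morleyD(1)[OF u P] morleyD(1)[OF v P] morleyD(1)[OF w P]
    note H = m[THEN morley_local_H2]
    note k = PiD_kernel(1)[OF ne[OF P] m(1)] PiD_kernel(1)[OF ne[OF P] m(2)] PiD_kernel(1)[OF ne[OF P] m(3)]
    let ?u = "\<lambda>x. u P x - PiD P (u P) x" and ?v = "\<lambda>x. v P x - PiD P (v P) x"
      and ?w = "\<lambda>x. w P x - PiD P (w P) x"
    have p: "PiD P (br_diff u v P) = (\<lambda>x. PiD P (u P) x - PiD P (v P) x)"
      using PiD_lin[OF ne[OF P] H(1,2), of 1 "-1"] by (simp add: br_diff_def)
    have "S P (\<lambda>x. 1 * ?u x + (-1) * ?v x) ?w = 1 * S P ?u ?w + (-1) * S P ?v ?w"
      by (rule stabilization_lin[OF ne[OF P] P S k])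
    then have "S P (\<lambda>x. br_diff u v P x - PiD P (br_diff u v P) x) ?w = S P ?u ?w - S P ?v ?w"
      unfolding p by (simp add: br_diff_def algebra_simps)
    then show ?thesis
      unfolding p using hess_form_diff[OF bdd_open_region PiD_in_H2[OF ne[OF P] H(1)] PiD_in_H2[OF ne[OF P] H(2)]
          PiD_in_H2[OF ne[OF P] H(3)]] by simp
  qed
  then show ?thesis by (simp add: A_h_def sum_subtractf)
qed

text \<open>Cauchy-Schwarz over the elements turns the sum of local products into a product of
  broken seminorms, and Minkowski separates the two approximation errors.\<close>

lemma A_h_consistency:
  assumes ne: "\<And>P. P \<in> T \<Longrightarrow> region P \<noteq> {}" and S: "stabilization c1 c2 T S" and c2: "0 < c2"
    and u: "u \<in> morley D T" and v: "v \<in> morley D T"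
    and \<psi>: "\<And>P. P \<in> T \<Longrightarrow> \<psi> P \<in> H2 (region P)" and r: "r \<in> br_polys 2 T"
  shows "\<bar>br_A T \<psi> v - A_h S T u v\<bar>
    \<le> (2 + c2) * (br_seminorm T (br_diff \<psi> u) + br_seminorm T (br_diff \<psi> r)) * br_seminorm T v"
proof -
  let ?x = "\<lambda>P. H2semi (region P) (br_diff \<psi> u P)" and ?y = "\<lambda>P. H2semi (region P) (br_diff \<psi> r P)"
    and ?z = "\<lambda>P. H2semi (region P) (v P)"
  have "\<bar>br_A T \<psi> v - A_h S T u v\<bar> \<le> (\<Sum>P\<in>T. (2 + c2) * (?x P + ?y P) * ?z P)"
    unfolding br_A_def A_h_def sum_subtractf[symmetric]
  proof (rule order.trans[OF sum_abs], rule sum_mono)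
    fix P assume P: "P \<in> T"
    have "r P \<in> polys 2" using r P by (simp add: br_polys_def)
    then show "\<bar>hess_form (region P) (\<psi> P) (v P) - (hess_form (region P) (PiD P (u P)) (PiD P (v P))
        + S P (\<lambda>x. u P x - PiD P (u P) x) (\<lambda>x. v P x - PiD P (v P) x))\<bar> \<le> (2 + c2) * (?x P + ?y P) * ?z P"
      using element_consistency[OF ne[OF P] P S c2 morleyD(1)[OF u P] morleyD(1)[OF v P] \<psi>[OF P]]
      by (simp add: br_diff_def)
  qed
  also have "\<dots> = (2 + c2) * (\<Sum>P\<in>T. \<bar>?x P + ?y P\<bar> * \<bar>?z P\<bar>)"
    by (simp add: sum_distrib_left H2semi_nonneg mult.assoc)
  also have "\<dots> \<le> (2 + c2) * (L2_set (\<lambda>P. ?x P + ?y P) T * L2_set ?z T)"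
    using c2 by (intro mult_left_mono L2_set_mult_ineq) auto
  also have "\<dots> \<le> (2 + c2) * ((L2_set ?x T + L2_set ?y T) * L2_set ?z T)"
    using c2 by (intro mult_left_mono mult_right_mono L2_set_triangle_ineq) (auto simp: L2_set_nonneg)
  finally show ?thesis by (simp add: br_seminorm_L2_set mult.assoc)
qed

section \<open>Elements of the sum space\<close>

text \<open>Zero is obtained as 0 u + 0 u from a known member u of the space.\<close>

lemma morley_zero:
  assumes "\<And>P. P \<in> T \<Longrightarrow> region P \<noteq> {}" "u \<in> morley D T" shows "(\<lambda>P x. 0) \<in> morley D T"
  using morley_lin[OF assms(1) assms(2,2), of 0 0] by simp

lemma morley_diff:
  assumes "\<And>P. P \<in> T \<Longrightarrow> region P \<noteq> {}" "u \<in> morley D T" "v \<in> morley D T"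
  shows "br_diff u v \<in> morley D T"
  using morley_lin[OF assms, of 1 "-1"] by (simp add: br_diff_def)

lemma sum_spaceI:
  assumes "u \<in> Phi D" "v \<in> morley D T" shows "(\<lambda>P x. u x + v P x) \<in> Phi_plus_morley D T"
  using assms unfolding Phi_plus_morley_def by blast

section \<open>The error estimate\<close>

text \<open>Passes from a bound for each pair of competitors to the two infima, with one and the
  same constant. The third summand \<open>L\<close> collects whatever is independent of the
  competitors.\<close>

lemma le_ennreal_INF_add:
  assumes C: "0 < C" and A: "\<And>a b. a \<in> A \<Longrightarrow> b \<in> B \<Longrightarrow> x \<le> ennreal C * (p a + q b + L)"
  shows "x \<le> ennreal C * ((INF a\<in>A. p a) + (INF b\<in>B. q b) + L)"
proof (rule ennreal_le_epsilon)
  fix e :: real assume fin: "ennreal C * ((INF a\<in>A. p a) + (INF b\<in>B. q b) + L) < top" and e: "0 < e"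
  \<comment> \<open>Slack e/(2C) in each infimum adds up to e after multiplication by C. The
    right-hand side may be assumed finite, and as C > 0 both infima are then finite and nearly
    attained.\<close>
  let ?P = "INF a\<in>A. p a" and ?Q = "INF b\<in>B. q b" and ?e = "e / (2 * C)"
  have "P \<noteq> \<infinity> \<and> Q \<noteq> \<infinity>" if "ennreal C * (P + Q + L) < top" for P Q
    using that C by (auto simp: ennreal_mult_less_top)
  from this[OF fin] have "?P \<noteq> \<infinity>" "?Q \<noteq> \<infinity>" by blast+
  moreover have e': "0 < ?e" using e C by simp
  ultimately obtain a b where a: "a \<in> A" "p a < ?P + ?e" and b: "b \<in> B" "q b < ?Q + ?e"
    using INF_approx_ennreal[of ?e ?P p A] INF_approx_ennreal[of ?e ?Q q B] by blast
  have "x \<le> ennreal C * (p a + q b + L)" by (rule A[OF a(1) b(1)])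
  also have "\<dots> \<le> ennreal C * ((?P + ?e) + (?Q + ?e) + L)"
    using a(2) b(2) by (intro mult_left_mono add_mono) auto
  also have "\<dots> = ennreal C * ((?P + ?Q + L) + (ennreal ?e + ennreal ?e))"
    by (simp add: ac_simps)
  also have "\<dots> = ennreal C * (?P + ?Q + L) + ennreal C * ennreal (?e + ?e)"
    using e' by (simp only: distrib_left ennreal_plus less_imp_le)
  also have "ennreal C * ennreal (?e + ?e) = ennreal e"
    using e' C by (simp add: ennreal_mult[symmetric])
  finally show "x \<le> ennreal C * (?P + ?Q + L) + ennreal e" .
qed

text \<open>One mesh and one discrete solution. \<open>F\<close> stands for the L2 norm of the
  load.\<close>

locale discrete_problem =
  fixes \<Omega> :: "pt set" and f :: "pt \<Rightarrow> pt" and \<psi> :: "pt \<Rightarrow> real" and T :: "polygon set" and S :: stab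
    and \<nu> c1 c2 \<alpha> CBh CFh F :: real and \<psi>h :: broken
  assumes \<Omega>: "bdd_open \<Omega>"
    and fin: "finite T"
    and sub: "\<And>P. P \<in> T \<Longrightarrow> region P \<subseteq> \<Omega>"
    and dis: "\<And>P Q. P \<in> T \<Longrightarrow> Q \<in> T \<Longrightarrow> P \<noteq> Q \<Longrightarrow> region P \<inter> region Q = {}"
    and ne: "\<And>P. P \<in> T \<Longrightarrow> region P \<noteq> {}"
    and S: "stabilization c1 c2 T S" and c2: "0 < c2"
    and \<nu>: "0 < \<nu>" and \<alpha>: "0 < \<alpha>" and CBh: "0 < CBh" and CFh: "0 < CFh" and F: "0 \<le> F"
    and coercive: "\<And>\<phi>. \<phi> \<in> morley \<Omega> T \<Longrightarrow> \<alpha> * (br_seminorm T \<phi>)\<^sup>2 \<le> A_h S T \<phi> \<phi>"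
    and bounded_F: "\<And>\<phi>. \<phi> \<in> morley \<Omega> T \<Longrightarrow> \<bar>F_h T f \<phi>\<bar> \<le> CFh * F * br_seminorm T \<phi>"
    and bounded_B: "\<And>\<zeta> \<eta> \<phi>. \<zeta> \<in> Phi_plus_morley \<Omega> T \<Longrightarrow> \<eta> \<in> Phi_plus_morley \<Omega> T \<Longrightarrow> \<phi> \<in> Phi_plus_morley \<Omega> T \<Longrightarrow>
       \<bar>B_h T \<zeta> \<eta> \<phi>\<bar> \<le> CBh * br_seminorm T \<zeta> * br_seminorm T \<eta> * br_seminorm T \<phi>"
    and small: "CBh * CFh / (\<alpha> * \<nu>)\<^sup>2 * F < 1"
    and \<psi>: "\<psi> \<in> Phi \<Omega>"
    and sol: "discrete_solution \<Omega> \<nu> f S T \<psi>h"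
begin

section \<open>A priori bounds on a fixed mesh and the error estimate\<close>

abbreviation nrm :: "broken \<Rightarrow> real" where "nrm \<equiv> br_seminorm T"

lemma \<psi>h_morley: "\<psi>h \<in> morley \<Omega> T"
  using sol by (simp add: discrete_solution_def)

lemma morley_H2: "u \<in> morley \<Omega> T \<Longrightarrow> P \<in> T \<Longrightarrow> u P \<in> H2 (region P)"
  by (intro morley_local_H2 morleyD(1))

lemma \<psi>_H2: "P \<in> T \<Longrightarrow> \<psi> \<in> H2 (region P)"
  using H2_restrict[OF sub \<Omega> bdd_open_region, of P \<psi>] \<psi> by (simp add: Phi_def)

lemma morley_in_sum: "u \<in> morley \<Omega> T \<Longrightarrow> u \<in> Phi_plus_morley \<Omega> T"
  using sum_spaceI[of "\<lambda>_. 0" \<Omega> u T] Phi_lin[OF \<Omega> \<psi> \<psi>, of 0 0] by simp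

lemma \<psi>_in_sum: "(\<lambda>_. \<psi>) \<in> Phi_plus_morley \<Omega> T"
  using sum_spaceI[OF \<psi> morley_zero[OF ne \<psi>h_morley]] by simp

lemma \<psi>_diff_in_sum:
  assumes "\<phi> \<in> morley \<Omega> T" shows "br_diff (\<lambda>_. \<psi>) \<phi> \<in> Phi_plus_morley \<Omega> T"
  using sum_spaceI[OF \<psi> morley_lin[OF ne assms assms, of "-1" 0]] by (simp add: br_diff_def)

lemma \<psi>h_bound: "nrm \<psi>h \<le> CFh * F / (\<alpha> * \<nu>)"
proof (cases "nrm \<psi>h = 0")
  case True
  then show ?thesis using \<alpha> \<nu> CFh F by simp
next
  case False
  then have pos: "0 < nrm \<psi>h" using br_seminorm_nonneg[of T \<psi>h] by simp
  have "\<nu> * (\<alpha> * (nrm \<psi>h)\<^sup>2) \<le> \<nu> * A_h S T \<psi>h \<psi>h"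
    using coercive[OF \<psi>h_morley] \<nu> by simp
  also have "\<dots> = F_h T f \<psi>h"
  proof -
    have "\<nu> * A_h S T \<psi>h \<psi>h + B_h T \<psi>h \<psi>h \<psi>h = F_h T f \<psi>h"
      using sol \<psi>h_morley unfolding discrete_solution_def by blast
    then show ?thesis
      using B_h_skew[of T \<psi>h \<psi>h, OF ne morley_H2[OF \<psi>h_morley]] by simp
  qed
  also have "\<dots> \<le> CFh * F * nrm \<psi>h" using bounded_F[OF \<psi>h_morley] by simp
  finally have "(\<alpha> * \<nu> * nrm \<psi>h) * nrm \<psi>h \<le> (CFh * F) * nrm \<psi>h"
    by (simp add: power2_eq_square mult_ac)
  then have "\<alpha> * \<nu> * nrm \<psi>h \<le> CFh * F" using pos by (rule mult_right_le_imp_le)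
  then show ?thesis using \<alpha> \<nu> by (simp add: field_simps)
qed

text \<open>Equals \<alpha> \<nu> (1 - lambda), where lambda is the quantity in
  \<open>small\<close>: the coercivity that is left after the convection term quadratic in the
  discrete error has been absorbed.\<close>

definition gap :: real where "gap = \<alpha> * \<nu> - CBh * (CFh * F / (\<alpha> * \<nu>))"

text \<open>Sum of the mesh independent bounds \<open>\<psi>_bound\<close> and
  \<open>\<psi>h_bound\<close>; these are the two functions paired with \<psi> - \<phi> in the
  convection terms.\<close>

definition growth :: real where "growth = H2semi \<Omega> \<psi> + CFh * F / (\<alpha> * \<nu>)"

lemma gap_pos: "0 < gap"
proof -
  have p: "0 < \<alpha> * \<nu>" using \<alpha> \<nu> by simp
  have "CBh * CFh * F / (\<alpha> * \<nu>)\<^sup>2 < 1" using small by simp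
  then have "CBh * CFh * F < (\<alpha> * \<nu>) * (\<alpha> * \<nu>)"
    using p by (subst (asm) pos_divide_less_eq) (simp_all add: power2_eq_square)
  then have "CBh * CFh * F / (\<alpha> * \<nu>) < \<alpha> * \<nu>"
    by (subst pos_divide_less_eq[OF p])
  then have "CBh * (CFh * F / (\<alpha> * \<nu>)) < \<alpha> * \<nu>" by simp
  then show ?thesis by (simp add: gap_def)
qed

lemma \<psi>_bound: "nrm (\<lambda>_. \<psi>) \<le> H2semi \<Omega> \<psi>"
  using \<psi> by (intro br_seminorm_restrict_le \<Omega> fin sub dis) (auto simp: Phi_def)

lemma growth_nonneg: "0 \<le> growth"
  using H2semi_nonneg[of \<Omega> \<psi>] CFh F \<alpha> \<nu> by (simp add: growth_def)

text \<open>Change one argument at a time, then write \<psi> - \<open>\<psi>h\<close> as (\<psi> -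
  \<phi>) - \<delta>. Besides the vanishing term there remain two terms linear in \<psi> - \<phi>,
  giving the factor \<open>growth\<close>, and one quadratic in \<delta>.\<close>

lemma convection_difference:
  assumes \<phi>: "\<phi> \<in> morley \<Omega> T"
  defines "\<delta> \<equiv> br_diff \<psi>h \<phi>" and "X \<equiv> nrm (br_diff (\<lambda>_. \<psi>) \<phi>)"
  shows "\<bar>B_h T (\<lambda>_. \<psi>) (\<lambda>_. \<psi>) \<delta> - B_h T \<psi>h \<psi>h \<delta>\<bar>
    \<le> CBh * growth * X * nrm \<delta> + CBh * (CFh * F / (\<alpha> * \<nu>)) * (nrm \<delta>)\<^sup>2"
proof -
  let ?\<psi> = "\<lambda>_ :: polygon. \<psi>"
  let ?e = "br_diff ?\<psi> \<phi>" and ?\<eta> = "br_diff ?\<psi> \<psi>h" and ?M = "CFh * F / (\<alpha> * \<nu>)"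
  have \<delta>: "\<delta> \<in> morley \<Omega> T" unfolding \<delta>_def by (rule morley_diff[OF ne \<psi>h_morley \<phi>])
  note H = \<psi>_H2 morley_H2[OF \<psi>h_morley] morley_H2[OF \<delta>]
  have He: "?e P \<in> H2 (region P)" if "P \<in> T" for P
    unfolding br_diff_def by (intro H2_diff bdd_open_region \<psi>_H2[OF that] morley_H2[OF \<phi> that])
  have \<eta>: "?\<eta> = br_diff ?e \<delta>" by (auto simp: br_diff_def \<delta>_def)
  have H\<eta>: "?\<eta> P \<in> H2 (region P)" if "P \<in> T" for P
    unfolding br_diff_def by (intro H2_diff bdd_open_region \<psi>_H2[OF that] H(2)[OF that])
  have "B_h T ?\<psi> ?\<psi> \<delta> - B_h T \<psi>h \<psi>h \<delta> = B_h T ?\<psi> ?\<eta> \<delta> + B_h T ?\<eta> \<psi>h \<delta>"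
    using B_h_diff_2[of T ?\<psi> ?\<psi> \<psi>h \<delta>, OF ne H(1) H(1) H(2) H(3)]
      B_h_diff_1[of T ?\<psi> \<psi>h \<psi>h \<delta>, OF ne H(1) H(2) H(2) H(3)] by simp
  also have "B_h T ?\<psi> ?\<eta> \<delta> = B_h T ?\<psi> ?e \<delta>"
    unfolding \<eta> using B_h_diff_2[of T ?\<psi> ?e \<delta> \<delta>, OF ne H(1) He H(3) H(3)] B_h_skew[OF ne H(3)] by simp
  also have "B_h T ?\<eta> \<psi>h \<delta> = B_h T ?e \<psi>h \<delta> - B_h T \<delta> \<psi>h \<delta>"
    unfolding \<eta> by (rule B_h_diff_1[OF ne He H(3) H(2) H(3)])
  finally have eq: "B_h T ?\<psi> ?\<psi> \<delta> - B_h T \<psi>h \<psi>h \<delta>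
      = B_h T ?\<psi> ?e \<delta> + (B_h T ?e \<psi>h \<delta> - B_h T \<delta> \<psi>h \<delta>)" .
  note s = \<psi>_in_sum \<psi>_diff_in_sum[OF \<phi>] morley_in_sum[OF \<psi>h_morley] morley_in_sum[OF \<delta>]
  note nn = br_seminorm_nonneg
  have "\<bar>B_h T ?\<psi> ?e \<delta>\<bar> \<le> CBh * nrm ?\<psi> * X * nrm \<delta>"
    unfolding X_def by (rule bounded_B[OF s(1,2,4)])
  also have "\<dots> \<le> CBh * H2semi \<Omega> \<psi> * X * nrm \<delta>"
    unfolding X_def using \<psi>_bound CBh nn by (intro mult_right_mono mult_left_mono) auto
  finally have 1: "\<bar>B_h T ?\<psi> ?e \<delta>\<bar> \<le> CBh * H2semi \<Omega> \<psi> * X * nrm \<delta>" .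
  have "\<bar>B_h T ?e \<psi>h \<delta>\<bar> \<le> CBh * X * nrm \<psi>h * nrm \<delta>"
    unfolding X_def by (rule bounded_B[OF s(2,3,4)])
  also have "\<dots> \<le> CBh * X * ?M * nrm \<delta>"
    unfolding X_def using \<psi>h_bound CBh nn by (intro mult_right_mono mult_left_mono mult_nonneg_nonneg) auto
  finally have 2: "\<bar>B_h T ?e \<psi>h \<delta>\<bar> \<le> CBh * X * ?M * nrm \<delta>" .
  have "\<bar>B_h T \<delta> \<psi>h \<delta>\<bar> \<le> CBh * nrm \<delta> * nrm \<psi>h * nrm \<delta>"
    by (rule bounded_B[OF s(4,3,4)])
  also have "\<dots> \<le> CBh * nrm \<delta> * ?M * nrm \<delta>"
    using \<psi>h_bound CBh nn by (intro mult_right_mono mult_left_mono mult_nonneg_nonneg) auto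
  finally have 3: "\<bar>B_h T \<delta> \<psi>h \<delta>\<bar> \<le> CBh * nrm \<delta> * ?M * nrm \<delta>" .
  have "CBh * growth * X * nrm \<delta> + CBh * ?M * (nrm \<delta>)\<^sup>2
      = CBh * H2semi \<Omega> \<psi> * X * nrm \<delta> + CBh * X * ?M * nrm \<delta> + CBh * nrm \<delta> * ?M * nrm \<delta>"
    unfolding growth_def distrib_left distrib_right power2_eq_square by (simp only: mult_ac)
  then show ?thesis unfolding eq using 1 2 3 by linarith
qed

text \<open>\<open>E1\<close> and \<open>E2\<close> stand for the suprema, taken as real numbers and
  used only at \<delta>. The seminorm of \<delta> is nonzero because it is divided out at the
  end.\<close>

lemma discrete_error_bound:
  assumes \<phi>: "\<phi> \<in> morley \<Omega> T" and r: "r \<in> br_polys 2 T"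
  defines "\<delta> \<equiv> br_diff \<psi>h \<phi>" and "X \<equiv> nrm (br_diff (\<lambda>_. \<psi>) \<phi>)" and "Y \<equiv> nrm (br_diff (\<lambda>_. \<psi>) r)"
  assumes n0: "nrm \<delta> \<noteq> 0"
    and E1: "\<bar>br_F T f \<delta> - F_h T f \<delta>\<bar> \<le> E1 * nrm \<delta>"
    and E2: "\<bar>N_term \<nu> f T \<psi> \<delta>\<bar> + \<bar>C_term T \<psi> \<delta>\<bar> \<le> E2 * nrm \<delta>"
  shows "gap * nrm \<delta> \<le> E1 + E2 + \<nu> * (2 + c2) * (X + Y) + CBh * growth * X"
proof -
  let ?\<psi> = "\<lambda>_ :: polygon. \<psi>"
  let ?n = "nrm \<delta>"
  have n: "0 < ?n" using n0 br_seminorm_nonneg[of T \<delta>] by simp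
  have \<delta>: "\<delta> \<in> morley \<Omega> T" unfolding \<delta>_def by (rule morley_diff[OF ne \<psi>h_morley \<phi>])
  have Ad: "A_h S T \<delta> \<delta> = A_h S T \<psi>h \<delta> - A_h S T \<phi> \<delta>"
    using A_h_diff[OF ne S \<psi>h_morley \<phi> \<delta>] by (simp add: \<delta>_def)
  have disc: "\<nu> * A_h S T \<psi>h \<delta> = F_h T f \<delta> - B_h T \<psi>h \<psi>h \<delta>"
    using sol \<delta> by (simp add: discrete_solution_def eq_diff_eq)
  \<comment> \<open>The continuous load, the continuous diffusion and convection forms at \<psi>,
    and the discrete convection form at \<psi> each enter twice with opposite signs and
    cancel.\<close>
  have id: "\<nu> * A_h S T \<delta> \<delta> = (F_h T f \<delta> - br_F T f \<delta>) - N_term \<nu> f T \<psi> \<delta> + C_term T \<psi> \<delta>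
      + \<nu> * (br_A T ?\<psi> \<delta> - A_h S T \<phi> \<delta>) + (B_h T ?\<psi> ?\<psi> \<delta> - B_h T \<psi>h \<psi>h \<delta>)"
    unfolding Ad right_diff_distrib disc N_term_def C_term_def by simp
  have "\<bar>br_A T ?\<psi> \<delta> - A_h S T \<phi> \<delta>\<bar> \<le> (2 + c2) * (X + Y) * ?n"
    unfolding X_def Y_def by (intro A_h_consistency[OF ne S c2 \<phi> \<delta> \<psi>_H2 r])
  then have "\<nu> * (br_A T ?\<psi> \<delta> - A_h S T \<phi> \<delta>) \<le> \<nu> * ((2 + c2) * (X + Y) * ?n)"
    using \<nu> by (intro mult_left_mono) auto
  moreover have "B_h T ?\<psi> ?\<psi> \<delta> - B_h T \<psi>h \<psi>h \<delta>
      \<le> CBh * growth * X * ?n + CBh * (CFh * F / (\<alpha> * \<nu>)) * ?n\<^sup>2"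
    using convection_difference[OF \<phi>] unfolding \<delta>_def[symmetric] X_def[symmetric] by linarith
  moreover have "\<nu> * (\<alpha> * ?n\<^sup>2) \<le> \<nu> * A_h S T \<delta> \<delta>"
    using coercive[OF \<delta>] \<nu> by simp
  ultimately have "\<nu> * (\<alpha> * ?n\<^sup>2) \<le> E1 * ?n + E2 * ?n + \<nu> * ((2 + c2) * (X + Y) * ?n)
      + (CBh * growth * X * ?n + CBh * (CFh * F / (\<alpha> * \<nu>)) * ?n\<^sup>2)"
    unfolding id using E1 E2 by linarith
  \<comment> \<open>The quadratic part of the convection bound moves to the left, where it lowers
    \<alpha> \<nu> to \<open>gap\<close>.\<close>
  then have "(gap * ?n) * ?n \<le> (E1 + E2 + \<nu> * (2 + c2) * (X + Y) + CBh * growth * X) * ?n"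
    unfolding gap_def power2_eq_square by (simp add: algebra_simps)
  then show ?thesis using n by (rule mult_right_le_imp_le)
qed

text \<open>The leading 1 pays for \<psi> - \<phi> in the triangle inequality; the fraction is the
  bound for the discrete error, its numerator collecting the data, diffusion and convection
  contributions.\<close>

definition err_const :: real where
  "err_const = 1 + (1 + \<nu> * (2 + c2) + CBh * growth) / gap"

lemma err_const_pos: "0 < err_const"
  using gap_pos growth_nonneg \<nu> c2 CBh by (simp add: err_const_def add_pos_nonneg)

text \<open>The bounds by \<open>E1\<close> and \<open>E2\<close> are asked for only if the discrete
  error has nonzero seminorm, the case in which it is a competitor in the suprema. If the seminorm
  is zero, the triangle inequality alone is enough.\<close>

lemma error_bound:
  assumes \<phi>: "\<phi> \<in> morley \<Omega> T" and r: "r \<in> br_polys 2 T" and E: "0 \<le> E1" "0 \<le> E2"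
    and E1: "nrm (br_diff \<psi>h \<phi>) \<noteq> 0 \<Longrightarrow>
      \<bar>br_F T f (br_diff \<psi>h \<phi>) - F_h T f (br_diff \<psi>h \<phi>)\<bar> \<le> E1 * nrm (br_diff \<psi>h \<phi>)"
    and E2: "nrm (br_diff \<psi>h \<phi>) \<noteq> 0 \<Longrightarrow>
      \<bar>N_term \<nu> f T \<psi> (br_diff \<psi>h \<phi>)\<bar> + \<bar>C_term T \<psi> (br_diff \<psi>h \<phi>)\<bar> \<le> E2 * nrm (br_diff \<psi>h \<phi>)"
  shows "nrm (br_diff (\<lambda>_. \<psi>) \<psi>h)
    \<le> err_const * (nrm (br_diff (\<lambda>_. \<psi>) \<phi>) + nrm (br_diff (\<lambda>_. \<psi>) r) + E1 + E2)"
proof -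
  define \<delta> where "\<delta> = br_diff \<psi>h \<phi>"
  define X where "X = nrm (br_diff (\<lambda>_. \<psi>) \<phi>)"
  define Y where "Y = nrm (br_diff (\<lambda>_. \<psi>) r)"
  have XY: "0 \<le> X" "0 \<le> Y" by (simp_all add: X_def Y_def br_seminorm_nonneg)
  define k1 where "k1 = \<nu> * (2 + c2)"
  define k2 where "k2 = CBh * growth"
  have k: "0 \<le> k1" "0 \<le> k2" using \<nu> c2 CBh growth_nonneg by (simp_all add: k1_def k2_def)
  have \<delta>: "\<delta> \<in> morley \<Omega> T" unfolding \<delta>_def by (rule morley_diff[OF ne \<psi>h_morley \<phi>])
  have "gap * nrm \<delta> \<le> (1 + k1 + k2) * (X + Y + E1 + E2)"
  proof (cases "nrm \<delta> = 0")
    case True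
    then show ?thesis using k XY E by simp
  next
    case False
    have "gap * nrm \<delta> \<le> E1 + E2 + k1 * (X + Y) + k2 * X"
      using discrete_error_bound[OF \<phi> r, of E1 E2] E1 E2 False
      unfolding \<delta>_def[symmetric] X_def[symmetric] Y_def[symmetric] k1_def k2_def by simp
    also have "\<dots> \<le> (E1 + E2 + X + Y) + k1 * (X + Y + E1 + E2) + k2 * (X + Y + E1 + E2)"
    proof -
      have "k1 * (X + Y) \<le> k1 * (X + Y + E1 + E2)" "k2 * X \<le> k2 * (X + Y + E1 + E2)"
        using k XY E by (intro mult_left_mono; simp)+
      then show ?thesis using XY by linarith
    qed
    finally show ?thesis by (simp add: algebra_simps)
  qed
  then have n: "nrm \<delta> \<le> (1 + k1 + k2) / gap * (X + Y + E1 + E2)"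
    using gap_pos by (simp add: field_simps)
  have "br_diff (\<lambda>_. \<psi>) \<psi>h = br_diff (br_diff (\<lambda>_. \<psi>) \<phi>) \<delta>"
    by (auto simp: br_diff_def \<delta>_def)
  then have "nrm (br_diff (\<lambda>_. \<psi>) \<psi>h) \<le> X + nrm \<delta>"
    unfolding X_def using br_seminorm_diff_le[of T "br_diff (\<lambda>_. \<psi>) \<phi>" \<delta>] morley_H2[OF \<delta>]
      H2_diff[OF bdd_open_region \<psi>_H2 morley_H2[OF \<phi>]] by (simp add: br_diff_def)
  also have "\<dots> \<le> (X + Y + E1 + E2) + (1 + k1 + k2) / gap * (X + Y + E1 + E2)"
    using n XY E by simp
  also have "\<dots> = err_const * (X + Y + E1 + E2)"
    unfolding err_const_def k1_def k2_def by (simp only: distrib_right mult_1)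
  finally show ?thesis by (simp add: X_def Y_def)
qed

text \<open>\<open>le_ennreal_INF_add\<close> reduces the claim to fixed \<phi> and r. Finite
  suprema are then real numbers, to which \<open>error_bound\<close> applies.\<close>

lemma error_bound_ennreal:
  shows "ennreal (nrm (br_diff (\<lambda>_. \<psi>) \<psi>h)) \<le> ennreal err_const *
       ((INF \<phi>\<in>morley \<Omega> T. ennreal (nrm (br_diff (\<lambda>_. \<psi>) \<phi>)))
      + (INF p\<in>br_polys 2 T. ennreal (nrm (br_diff (\<lambda>_. \<psi>) p)))
      + (load_error \<Omega> f T
      + (SUP \<phi>\<in>{\<phi>\<in>morley \<Omega> T. \<not> br_zero T \<phi>}.
           ennreal (\<bar>N_term \<nu> f T \<psi> \<phi>\<bar> / nrm \<phi>) + ennreal (\<bar>C_term T \<psi> \<phi>\<bar> / nrm \<phi>))))"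
    (is "_ \<le> _ * (_ + _ + (?L + ?S))")
proof (rule le_ennreal_INF_add[OF err_const_pos])
  fix \<phi> r assume \<phi>: "\<phi> \<in> morley \<Omega> T" and r: "r \<in> br_polys 2 T"
  let ?\<delta> = "br_diff \<psi>h \<phi>"
  let ?X = "nrm (br_diff (\<lambda>_. \<psi>) \<phi>)" and ?Y = "nrm (br_diff (\<lambda>_. \<psi>) r)"
  have \<delta>: "?\<delta> \<in> morley \<Omega> T" by (rule morley_diff[OF ne \<psi>h_morley \<phi>])
  show "ennreal (nrm (br_diff (\<lambda>_. \<psi>) \<psi>h)) \<le> ennreal err_const * (ennreal ?X + ennreal ?Y + (?L + ?S))"
  proof (cases "?L = top \<or> ?S = top")
    case True
    \<comment> \<open>An infinite supremum makes the right-hand side infinite, because the constant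
      is positive.\<close>
    then have "?L + ?S = top" unfolding ennreal_add_eq_top .
    then have "ennreal ?X + ennreal ?Y + (?L + ?S) = top" unfolding ennreal_add_eq_top[of "_ + _"] by blast
    then show ?thesis using err_const_pos by (simp only: ennreal_mult_top) simp
  next
    case False
    then have "?L \<noteq> top" "?S \<noteq> top" by blast+
    moreover have "\<exists>E\<ge>0. x = ennreal E" if "x \<noteq> top" for x
      using that by (cases x rule: ennreal_cases) auto
    ultimately obtain E1 E2 where E: "0 \<le> E1" "?L = ennreal E1" "0 \<le> E2" "?S = ennreal E2"
      by meson
    \<comment> \<open>A function that is zero on every element has zero seminorm, so the discrete
      error is an admissible index of both suprema.\<close>
    have mem: "?\<delta> \<in> {\<phi>\<in>morley \<Omega> T. \<not> br_zero T \<phi>}" if "nrm ?\<delta> \<noteq> 0"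
      using that \<delta> br_seminorm_zero[OF morley_H2[OF \<delta>]] by blast
    have "\<bar>br_F T f ?\<delta> - F_h T f ?\<delta>\<bar> \<le> E1 * nrm ?\<delta>" if n: "nrm ?\<delta> \<noteq> 0"
    proof -
      have "ennreal (\<bar>br_F T f ?\<delta> - F_h T f ?\<delta>\<bar> / nrm ?\<delta>) \<le> ?L"
        unfolding load_error_def by (rule SUP_upper[OF mem[OF n]])
      then have "\<bar>br_F T f ?\<delta> - F_h T f ?\<delta>\<bar> / nrm ?\<delta> \<le> E1"
        unfolding E(2) ennreal_le_iff[OF E(1)] .
      then show ?thesis using n br_seminorm_nonneg[of T ?\<delta>] by (simp add: divide_le_eq)
    qed
    moreover have "\<bar>N_term \<nu> f T \<psi> ?\<delta>\<bar> + \<bar>C_term T \<psi> ?\<delta>\<bar> \<le> E2 * nrm ?\<delta>" if n: "nrm ?\<delta> \<noteq> 0"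
    proof -
      have "ennreal (\<bar>N_term \<nu> f T \<psi> ?\<delta>\<bar> / nrm ?\<delta>) + ennreal (\<bar>C_term T \<psi> ?\<delta>\<bar> / nrm ?\<delta>) \<le> ?S"
        by (rule SUP_upper[OF mem[OF n]])
      then have "\<bar>N_term \<nu> f T \<psi> ?\<delta>\<bar> / nrm ?\<delta> + \<bar>C_term T \<psi> ?\<delta>\<bar> / nrm ?\<delta> \<le> E2"
        unfolding E(4) using E(3) br_seminorm_nonneg[of T ?\<delta>]
        by (simp add: ennreal_plus[symmetric] del: ennreal_plus)
      then show ?thesis
        using n br_seminorm_nonneg[of T ?\<delta>] by (simp add: add_divide_distrib[symmetric] divide_le_eq)
    qed
    ultimately have "nrm (br_diff (\<lambda>_. \<psi>) \<psi>h) \<le> err_const * (?X + ?Y + E1 + E2)"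
      by (intro error_bound \<phi> r E)
    then have "ennreal (nrm (br_diff (\<lambda>_. \<psi>) \<psi>h)) \<le> ennreal (err_const * (?X + ?Y + (E1 + E2)))"
      by (intro ennreal_leI) (simp add: add.assoc)
    also have "\<dots> = ennreal err_const * (ennreal ?X + ennreal ?Y + (?L + ?S))"
      using err_const_pos E(1,3) by (simp add: E(2,4) ennreal_mult' br_seminorm_nonneg)
    finally show ?thesis .
  qed
qed

end

theorem theorem5p1:
  fixes \<Omega> :: "pt set" and f :: "pt \<Rightarrow> pt" and \<psi> :: "pt \<Rightarrow> real"
    and H :: "real set" and T :: "real \<Rightarrow> polygon set" and S :: "real \<Rightarrow> stab"
    and \<nu> \<rho> c1 c2 Csob CB CF \<alpha> CBh CFh :: real
  assumes domain: "polygonal_domain \<Omega>"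
    and meshes: "H \<subseteq> {0<..}" "\<And>h. h \<in> H \<Longrightarrow> is_mesh \<Omega> (T h)"
      "\<And>h. h \<in> H \<Longrightarrow> mesh_size (T h) = h"
    and regular: "0 < \<rho>" "\<And>h. h \<in> H \<Longrightarrow> shape_regular \<rho> (T h)"
    and stab: "0 < c1" "0 < c2" "\<And>h. h \<in> H \<Longrightarrow> stabilization c1 c2 (T h) (S h)"
    and f: "f \<in> L2v \<Omega>"
    and nu: "0 < \<nu>"
    and CF: "\<And>\<phi>. \<phi> \<in> Phi \<Omega> \<Longrightarrow> \<bar>load_form \<Omega> f \<phi>\<bar> \<le> CF * L2vnorm \<Omega> f * H2semi \<Omega> \<phi>"
    and CB: "sobolev_L4_const \<Omega> Csob" "CB = Csob\<^sup>2"
    and alpha: "0 < \<alpha>"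
      "\<And>h \<phi>. h \<in> H \<Longrightarrow> \<phi> \<in> morley \<Omega> (T h) \<Longrightarrow>
         \<alpha> * (br_seminorm (T h) \<phi>)\<^sup>2 \<le> A_h (S h) (T h) \<phi> \<phi>"
    and CFh: "0 < CFh"
      "\<And>h \<phi>. h \<in> H \<Longrightarrow> \<phi> \<in> morley \<Omega> (T h) \<Longrightarrow>
         \<bar>F_h (T h) f \<phi>\<bar> \<le> CFh * L2vnorm \<Omega> f * br_seminorm (T h) \<phi>"
    and CBh: "0 < CBh"
      "\<And>h \<zeta> \<eta> \<phi>. h \<in> H \<Longrightarrow> \<zeta> \<in> Phi_plus_morley \<Omega> (T h) \<Longrightarrow> \<eta> \<in> Phi_plus_morley \<Omega> (T h) \<Longrightarrow>
         \<phi> \<in> Phi_plus_morley \<Omega> (T h) \<Longrightarrow>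
         \<bar>B_h (T h) \<zeta> \<eta> \<phi>\<bar>
           \<le> CBh * br_seminorm (T h) \<zeta> * br_seminorm (T h) \<eta> * br_seminorm (T h) \<phi>"
    and small: "CB * CF / \<nu>\<^sup>2 * L2vnorm \<Omega> f < 1"
    and small_h: "CBh * CFh / (\<alpha> * \<nu>)\<^sup>2 * L2vnorm \<Omega> f < 1"
    and sol: "continuous_solution \<Omega> \<nu> f \<psi>"
  shows "\<exists>C>0. \<forall>h\<in>H. \<forall>\<psi>h. discrete_solution \<Omega> \<nu> f (S h) (T h) \<psi>h \<longrightarrow>
     ennreal (br_seminorm (T h) (br_diff (\<lambda>_. \<psi>) \<psi>h)) \<le> ennreal C *
       ((INF \<phi>\<in>morley \<Omega> (T h). ennreal (br_seminorm (T h) (br_diff (\<lambda>_. \<psi>) \<phi>)))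
      + (INF p\<in>br_polys 2 (T h). ennreal (br_seminorm (T h) (br_diff (\<lambda>_. \<psi>) p)))
      + load_error \<Omega> f (T h)
      + (SUP \<phi>\<in>{\<phi>\<in>morley \<Omega> (T h). \<not> br_zero (T h) \<phi>}.
           ennreal (\<bar>N_term \<nu> f (T h) \<psi> \<phi>\<bar> / br_seminorm (T h) \<phi>)
         + ennreal (\<bar>C_term (T h) \<psi> \<phi>\<bar> / br_seminorm (T h) \<phi>)))"
proof -
  have D: "bdd_open \<Omega>" using domain by (simp add: polygonal_domain_def bdd_open_def)
  have prob: "discrete_problem \<Omega> f \<psi> (T h) (S h) \<nu> c1 c2 \<alpha> CBh CFh (L2vnorm \<Omega> f) \<psi>h"
    if h: "h \<in> H" and "discrete_solution \<Omega> \<nu> f (S h) (T h) \<psi>h" for h \<psi>h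
  proof unfold_locales
    \<comment> \<open>Shape regularity provides a ball of positive radius in each element;
      nonemptiness is what unisolvence of the projections relies on.\<close>
    show "region P \<noteq> {}" if "P \<in> T h" for P
    proof -
      obtain x r where "0 < r" "ball x r \<subseteq> region P"
        using regular(2)[OF h] \<open>P \<in> T h\<close> unfolding shape_regular_def by blast
      then show ?thesis using centre_in_ball by blast
    qed
    show "0 \<le> L2vnorm \<Omega> f" by (simp add: L2vnorm_def)
    show "\<psi> \<in> Phi \<Omega>" using sol by (simp add: continuous_solution_def)
  qed (use that D meshes(2)[OF h] stab(2) stab(3)[OF h] nu alpha CFh CBh small_h in
      \<open>auto simp: is_mesh_def\<close>)
  \<comment> \<open>The locale constants \<open>gap\<close> and \<open>err_const\<close> written
    out, which shows that they are the same for all meshes.\<close>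
  define g where "g = \<alpha> * \<nu> - CBh * (CFh * L2vnorm \<Omega> f / (\<alpha> * \<nu>))"
  define C where "C = 1 + (1 + \<nu> * (2 + c2) + CBh * (H2semi \<Omega> \<psi> + CFh * L2vnorm \<Omega> f / (\<alpha> * \<nu>))) / g"
  show ?thesis
  \<comment> \<open>Positivity of \<open>C\<close> is taken from the locale, whose assumptions
    include a discrete solution. If no mesh has one, the claim is vacuous and the constant 1
    serves.\<close>
  proof (cases "\<exists>h\<in>H. \<exists>\<psi>h. discrete_solution \<Omega> \<nu> f (S h) (T h) \<psi>h")
    case False
    then show ?thesis by (intro exI[of _ 1]) auto
  next
    case True
    have const: "discrete_problem.err_const \<Omega> \<psi> \<nu> c2 \<alpha> CBh CFh (L2vnorm \<Omega> f) = C"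
      if "h \<in> H" "discrete_solution \<Omega> \<nu> f (S h) (T h) \<psi>h" for h \<psi>h
      using prob[OF that]
      by (simp add: discrete_problem.err_const_def discrete_problem.growth_def discrete_problem.gap_def C_def g_def)
    have "0 < C" using True const discrete_problem.err_const_pos[OF prob] by metis
    then show ?thesis
      using discrete_problem.error_bound_ennreal[OF prob] const
      by (intro exI[of _ C]) (simp only: add.assoc, blast)
  qed
qed

end
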